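(* Let $d\ge1$. For a certain small constant $c_{ps}>0$ (that is, there exists such a constant), the following holds with $$\varphi(t):=-\log t+c_{ps}\Big(\log t\,\arctan(\log t)-\tfrac12\log(1+\log^2t)\Big),\quad t>0,\qquad \phi(x):=\tau\varphi(|x|).$$ There exist $h_0,\delta_0\in(0,1)$ with $h_0<\delta_0$, $C>1$ and $\tau_0>1$ such that for all $h\in(0,h_0)$, all $\tau\in(\tau_0,\delta_0h^{-1})$ and all $u:(h\mathbb{Z})^d\to\mathbb{R}$ with $h^{-2}\Delta_du=g$ in $B_4$, $\operatorname{supp}(u)\subset B_2\setminus B_{1/2}$ and $g\in L^2(B_4)$, we have $$\tau^3\|e^{\phi}u\|_{L^2}^2+\tau\|e^{\phi}h^{-1}D_su\|_{L^2}^2+\tau^{-1}\|e^{\phi}h^{-2}D_s^2u\|_{L^2}^2\le C\|e^{\phi}g\|_{L^2}^2.$$ The constants $h_0,\delta_0,C,\tau_0$ are independent of $u$ (and of $h$, $\tau$).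
   Context: For $u:(h\mathbb{Z})^d\to\mathbb{R}$, with $e_j$ the unit vector in the $j$-th direction: $\Delta_du(n):=\sum_{j=1}^d\big(u(n+he_j)+u(n-he_j)-2u(n)\big)$ is the non-normalized discrete Laplacian, and $D_su(n):=\frac12\sum_{j=1}^d\big(u(n+he_j)-u(n-he_j)\big)$ is the symmetric discrete difference operator (a scalar, summed over $j$); $D_s^2u=D_s(D_su)$. For $r>0$, $B_r:=B_r(0)\cap(h\mathbb{Z})^d$ with $B_r(0)\subset\mathbb{R}^d$ the Euclidean ball of radius $r$ centred at $0$. The $L^2$ norms are norms on the lattice, $\|f\|_{L^2}^2=\sum_n|f(n)|^2$; $e^{\phi}f$ is understood to vanish where $f$ vanishes (in particular at $n=0$, where $\phi$ is not defined; $h_0$ is small enough that $u$, $D_su$, $D_s^2u$ and $g$ vanish there). *)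

theory Defs
  imports "HOL-Analysis.Analysis"
begin

text \<open>Lattice functions are modelled as functions on the whole of the Euclidean space. All
  operators, supports and norms below see only their values on the lattice when evaluated at
  lattice points.\<close>

definition grid :: "real \<Rightarrow> (real ^ 'd) set" where
  "grid h = {x. \<forall>i. \<exists>k::int. x $ i = h * of_int k}"

definition grid_ball :: "real \<Rightarrow> real \<Rightarrow> (real ^ 'd) set" where
  "grid_ball h r = ball 0 r \<inter> grid h"

definition discrete_laplacian :: "real \<Rightarrow> (real ^ 'd \<Rightarrow> real) \<Rightarrow> real ^ 'd \<Rightarrow> real" where
  "discrete_laplacian h u x =
     (\<Sum>j\<in>UNIV. u (x + h *\<^sub>R axis j 1) + u (x - h *\<^sub>R axis j 1) - 2 * u x)"

definition sym_diff_op :: "real \<Rightarrow> (real ^ 'd \<Rightarrow> real) \<Rightarrow> real ^ 'd \<Rightarrow> real" where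
  "sym_diff_op h u x =
     1 / 2 * (\<Sum>j\<in>UNIV. u (x + h *\<^sub>R axis j 1) - u (x - h *\<^sub>R axis j 1))"

definition grid_supp :: "real \<Rightarrow> (real ^ 'd \<Rightarrow> real) \<Rightarrow> (real ^ 'd) set" where
  "grid_supp h u = {x \<in> grid h. u x \<noteq> 0}"

definition l2_on :: "'a set \<Rightarrow> ('a \<Rightarrow> real) \<Rightarrow> bool" where
  "l2_on A f \<longleftrightarrow> (\<lambda>x. \<bar>f x\<bar>\<^sup>2) summable_on A"

definition l2_norm :: "'a set \<Rightarrow> ('a \<Rightarrow> real) \<Rightarrow> real" where
  "l2_norm A f = sqrt (\<Sum>\<^sub>\<infinity>x\<in>A. \<bar>f x\<bar>\<^sup>2)"

definition carleman_profile :: "real \<Rightarrow> real \<Rightarrow> real" where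
  "carleman_profile c t =
     - ln t + c * (ln t * arctan (ln t) - 1 / 2 * ln (1 + (ln t)\<^sup>2))"

text \<open>The value at the origin is a placeholder coming from \<open>ln 0 = 0\<close>. It is harmless: the weight
  only occurs in products with functions that vanish at the origin once the mesh size is small,
  and a smaller bound on the mesh size is always an admissible choice.\<close>

definition carleman_weight :: "real \<Rightarrow> real \<Rightarrow> real ^ 'd \<Rightarrow> real" where
  "carleman_weight c \<tau> x = \<tau> * carleman_profile c (norm x)"

end

theory Submission
  imports Defs
begin

text \<open>Conjugate with the weight: for \<open>f = exp \<phi> * u\<close> the operator \<open>exp \<phi> \<Delta> exp (- \<phi>)\<close> is, up to
  an error of size \<open>h\<^sup>2 \<tau> f\<close>, the sum of \<open>S f = \<Sum>\<^sub>j cosh b\<^sub>j * \<Delta>\<^sub>j f + V * f\<close> and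
  \<open>A f = - \<Sum>\<^sub>j sinh b\<^sub>j * (f (x + h e\<^sub>j) - f (x - h e\<^sub>j))\<close>, where \<open>b = h \<nabla>\<phi>\<close> is small because
  \<open>h \<tau>\<close> is. Summation by parts shows that \<open>2 \<langle>S f, A f\<rangle>\<close> is to leading order
  \<open>4 D\<^sup>2\<phi>(\<nabla>f, \<nabla>f) + 4 D\<^sup>2\<phi>(\<nabla>\<phi>, \<nabla>\<phi>) f\<^sup>2 - 2 \<Delta>\<phi> (|\<nabla>f|\<^sup>2 - |\<nabla>\<phi>|\<^sup>2 f\<^sup>2)\<close>, as in the continuum. This is
  not positive, since the Hessian of \<open>- log |x|\<close> is negative in tangential directions. Adding
  \<open>\<langle>S f, Q f\<rangle>\<close>, which costs half of \<open>\<parallel>S f\<parallel>\<^sup>2\<close>, trades \<open>|\<nabla>f|\<^sup>2\<close> for \<open>|\<nabla>\<phi>|\<^sup>2 f\<^sup>2\<close>; with a suitable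
  radial \<open>Q\<close> both coefficients become positive, the one of \<open>f\<^sup>2\<close> thanks to the convex correction of
  the logarithm. High frequencies need no separate treatment: all discretisation errors involve at
  most second differences of \<open>f\<close>, and these are controlled by \<open>\<parallel>S f\<parallel>\<close>.\<close>

section \<open>Estimates for hyperbolic functions\<close>

text \<open>Why a multiplier exists: with \<rho> = |x|^2 the Hessian of the weight has the
  tangential eigenvalue \<open>psi\<close>, which is negative, and the radial eigenvalue
  \<open>psi + 2 * \<rho> * psi1\<close>. Let T be its trace. The gradient coefficient asks for Q
  \<ge> 2 T - 4 psi, the coefficient of f^2 for Q \<le> 2 T + 4 psi + 8 \<rho> psi1. This window has
  width 8 (psi + \<rho> psi1), which is 0 for the pure logarithm and 1 / (\<rho> (1 + log^2 |x|))
  for \<open>c_ps\<close> = 1/4. Q is placed 1/160 above the lower edge. Why both bounds on \<tau>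
  are needed: replacing increments by derivatives costs a relative error of order \<eta>, that is
  \<tau> h. Differences that fall on Q, the price of pairing with Q, and the Taylor remainder of the
  weight cost a relative error of order h / \<eta>, that is 1 / \<tau>. Absorbing the first kind
  determines \<open>\<delta>\<^sub>0\<close>, the second kind \<open>\<tau>\<^sub>0\<close>. The
  powers of \<eta> in \<open>energy\<close> are balanced so that every product of two differences of
  f can be measured against it.\<close>

lemma cosh_le_2:
  fixes b :: real
  assumes "\<bar>b\<bar> \<le> 1"
  shows "cosh b \<le> 2"
proof -
  have "exp \<bar>b\<bar> \<le> exp 1" "exp (-\<bar>b\<bar>) \<le> 1" using assms by auto
  then have "exp \<bar>b\<bar> + exp (-\<bar>b\<bar>) \<le> 4" using exp_le by linarith
  then have "cosh \<bar>b\<bar> \<le> 2" unfolding cosh_def by simp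
  then show ?thesis by simp
qed

lemma abs_sinh_le:
  fixes b :: real
  assumes "\<bar>b\<bar> \<le> 1"
  shows "\<bar>sinh b\<bar> \<le> 2 * \<bar>b\<bar>"
proof -
  have "norm (sinh b - sinh 0) \<le> 2 * norm (b - 0)"
  proof (rule field_differentiable_bound[where S = "{-1..1}" and f' = cosh])
    show "norm (cosh z) \<le> 2" if "z \<in> {-1..1}" for z :: real
      using that cosh_le_2[of z] by auto
    show "(sinh has_field_derivative cosh z) (at z within {-1..1})" for z :: real
      by (auto intro!: derivative_eq_intros)
  qed (use assms in auto)
  then show ?thesis by simp
qed

lemma abs_cosh_diff_le:
  fixes a b \<beta> :: real
  assumes "\<bar>a\<bar> \<le> \<beta>" "\<bar>b\<bar> \<le> \<beta>" "\<beta> \<le> 1"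
  shows "\<bar>cosh b - cosh a\<bar> \<le> 2 * \<beta> * \<bar>b - a\<bar>"
proof -
  have "norm (cosh b - cosh a) \<le> 2 * \<beta> * norm (b - a)"
  proof (rule field_differentiable_bound[where S = "{-\<beta>..\<beta>}" and f' = sinh])
    show "norm (sinh z) \<le> 2 * \<beta>" if "z \<in> {-\<beta>..\<beta>}" for z :: real
      using that abs_sinh_le[of z] assms by (auto simp: abs_le_iff)
    show "(cosh has_field_derivative sinh z) (at z within {-\<beta>..\<beta>})" for z :: real
      by (auto intro!: derivative_eq_intros)
  qed (use assms in auto)
  then show ?thesis by simp
qed

lemma abs_cosh_minus_1_le:
  fixes b :: real
  assumes "\<bar>b\<bar> \<le> 1"
  shows "\<bar>cosh b - 1\<bar> \<le> 2 * b\<^sup>2"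
  using abs_cosh_diff_le[of 0 "\<bar>b\<bar>" b] assms by (simp add: power2_eq_square)

text \<open>The function sinh z - z has the quadratically small derivative cosh z - 1, so the
  increments of sinh and of the identity agree up to a relative error of order
  \<open>\<beta>\<^sup>2\<close>.\<close>

lemma abs_sinh_diff_le:
  fixes a b \<beta> :: real
  assumes "\<bar>a\<bar> \<le> \<beta>" "\<bar>b\<bar> \<le> \<beta>" "\<beta> \<le> 1"
  shows "\<bar>sinh b - sinh a - (b - a)\<bar> \<le> 2 * \<beta>\<^sup>2 * \<bar>b - a\<bar>"
proof -
  have "norm ((sinh b - b) - (sinh a - a)) \<le> 2 * \<beta>\<^sup>2 * norm (b - a)"
  proof (rule field_differentiable_bound[where S = "{-\<beta>..\<beta>}" and f' = "\<lambda>z. cosh z - 1" and f = "\<lambda>z. sinh z - z"])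
    show "norm (cosh z - 1) \<le> 2 * \<beta>\<^sup>2" if "z \<in> {-\<beta>..\<beta>}" for z :: real
    proof -
      have "\<bar>z\<bar> \<le> \<beta>" using that by auto
      then have "z\<^sup>2 \<le> \<beta>\<^sup>2" using abs_le_square_iff[of z \<beta>] by linarith
      then show ?thesis using abs_cosh_minus_1_le[of z] \<open>\<bar>z\<bar> \<le> \<beta>\<close> assms by auto
    qed
    show "((\<lambda>z. sinh z - z) has_field_derivative (cosh z - 1)) (at z within {-\<beta>..\<beta>})" for z :: real
      by (auto intro!: derivative_eq_intros)
  qed (use assms in auto)
  then show ?thesis by (simp add: algebra_simps)
qed

lemma abs_sinh_minus_id_le:
  fixes b \<beta> :: real
  assumes "\<bar>b\<bar> \<le> \<beta>" "\<beta> \<le> 1"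
  shows "\<bar>sinh b - b\<bar> \<le> 2 * \<beta> ^ 3"
proof -
  have "\<bar>sinh b - b\<bar> \<le> 2 * \<beta>\<^sup>2 * \<bar>b\<bar>"
    using abs_sinh_diff_le[of 0 \<beta> b] assms by simp
  also have "\<dots> \<le> 2 * \<beta>\<^sup>2 * \<beta>" using assms by (intro mult_left_mono) auto
  finally show ?thesis by (simp add: power3_eq_cube power2_eq_square mult.assoc)
qed

text \<open>The plain mean value bound for cosh has the same order as the main term in
  \<open>potential_diff_estimate\<close>, so the linear part has to be split off. The derivative of
  cosh z - a z is (sinh z - z) + (z - a), and both summands are small on the segment.\<close>

lemma abs_cosh_taylor_le:
  fixes a b \<beta> :: real
  assumes "\<bar>a\<bar> \<le> \<beta>" "\<bar>b\<bar> \<le> \<beta>" "\<beta> \<le> 1"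
  shows "\<bar>cosh b - cosh a - a * (b - a)\<bar> \<le> (2 * \<beta> ^ 3 + \<bar>b - a\<bar>) * \<bar>b - a\<bar>"
proof -
  have "norm ((cosh b - a * b) - (cosh a - a * a)) \<le> (2 * \<beta> ^ 3 + \<bar>b - a\<bar>) * norm (b - a)"
  proof (rule field_differentiable_bound[where S = "closed_segment a b" and f' = "\<lambda>z. sinh z - a" and f = "\<lambda>z. cosh z - a * z"])
    show "norm (sinh z - a) \<le> 2 * \<beta> ^ 3 + \<bar>b - a\<bar>" if "z \<in> closed_segment a b" for z :: real
    proof -
      have z: "\<bar>z\<bar> \<le> \<beta>" "\<bar>z - a\<bar> \<le> \<bar>b - a\<bar>"
        using that assms by (auto simp: closed_segment_eq_real_ivl split: if_splits)
      then show ?thesis using abs_sinh_minus_id_le[of z \<beta>] assms by auto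
    qed
    show "((\<lambda>z. cosh z - a * z) has_field_derivative (sinh z - a)) (at z within closed_segment a b)" for z :: real
      by (auto intro!: derivative_eq_intros)
  qed auto
  then show ?thesis by (simp add: algebra_simps)
qed

lemma abs_cosh_minus_square_le:
  fixes b \<beta> :: real
  assumes "\<bar>b\<bar> \<le> \<beta>" "\<beta> \<le> 1"
  shows "\<bar>2 * (cosh b - 1) - b\<^sup>2\<bar> \<le> 4 * \<beta> ^ 3"
proof -
  have "norm ((2 * cosh b - b\<^sup>2) - (2 * cosh 0 - 0\<^sup>2)) \<le> 4 * \<beta> ^ 3 * norm (b - 0)"
  proof (rule field_differentiable_bound[where S = "{-\<beta>..\<beta>}" and f' = "\<lambda>z. 2 * sinh z - 2 * z" and f = "\<lambda>z. 2 * cosh z - z\<^sup>2"])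
    show "norm (2 * sinh z - 2 * z) \<le> 4 * \<beta> ^ 3" if "z \<in> {-\<beta>..\<beta>}" for z :: real
    proof -
      have "\<bar>sinh z - z\<bar> \<le> 2 * \<beta> ^ 3" using abs_sinh_minus_id_le[of z \<beta>] that assms by auto
      then show ?thesis unfolding real_norm_def by linarith
    qed
    show "((\<lambda>z. 2 * cosh z - z\<^sup>2) has_field_derivative (2 * sinh z - 2 * z)) (at z within {-\<beta>..\<beta>})" for z :: real
      by (auto intro!: derivative_eq_intros)
  qed (use assms in auto)
  \<comment> \<open>The mean value theorem gives a fourth power; cubic precision is all that the
    later estimates ask for.\<close>
  also have "\<dots> \<le> 4 * \<beta> ^ 3 * 1" using assms by (intro mult_left_mono) auto
  finally show ?thesis by simp
qed

text \<open>Each factor is replaced by its leading term at the cost of a relative error of order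
  \<open>\<eta>\<close>.\<close>

lemma cosh_sinh_diff_estimate:
  fixes h \<eta> a a' b b' H :: real
  assumes h: "0 < h" "h \<le> \<eta>" "\<eta> \<le> 1"
    and a: "\<bar>a\<bar> \<le> \<eta>" and a': "\<bar>a'\<bar> \<le> \<eta>" and b: "\<bar>b\<bar> \<le> \<eta>" and b': "\<bar>b'\<bar> \<le> \<eta>"
    and da: "\<bar>a' - a\<bar> \<le> 2 * (h * \<eta>)" and db: "\<bar>b' - b\<bar> \<le> 2 * (h * \<eta>)"
    and dH: "\<bar>b' - b - h * \<eta> * H\<bar> \<le> h * h * \<eta>"
  shows "\<bar>cosh a' * sinh b' - cosh a * sinh b - h * \<eta> * H\<bar> \<le> 30 * (h * \<eta>\<^sup>2)"
proof -
  have sq: "\<eta>\<^sup>2 \<le> \<eta>" using h by (simp add: power2_eq_square mult_left_le)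
  have 1: "\<bar>(cosh a' - cosh a) * sinh b'\<bar> \<le> (2 * \<eta> * (2 * (h * \<eta>))) * (2 * \<eta>)"
    unfolding abs_mult
  proof (rule mult_mono)
    show "\<bar>cosh a' - cosh a\<bar> \<le> 2 * \<eta> * (2 * (h * \<eta>))"
      by (rule order_trans[OF abs_cosh_diff_le mult_left_mono[OF da]]) (use a a' h in auto)
    show "\<bar>sinh b'\<bar> \<le> 2 * \<eta>" using abs_sinh_le[of b'] b' h by auto
  qed (use h in auto)
  have 2: "\<bar>sinh b' - sinh b - (b' - b)\<bar> \<le> 2 * \<eta>\<^sup>2 * (2 * (h * \<eta>))"
    by (rule order_trans[OF abs_sinh_diff_le mult_left_mono[OF db]]) (use b b' h in auto)
  have 3: "\<bar>sinh b' - sinh b\<bar> \<le> 6 * (h * \<eta>)"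
  proof -
    have "2 * \<eta>\<^sup>2 * (2 * (h * \<eta>)) \<le> 2 * 1 * (2 * (h * \<eta>))"
      using h sq by (intro mult_right_mono) auto
    then show ?thesis using 2 db by linarith
  qed
  have "\<bar>cosh a - 1\<bar> \<le> 2 * \<eta>\<^sup>2"
    using abs_cosh_minus_1_le[of a] a h abs_le_square_iff[of a \<eta>] by auto
  then have 4: "\<bar>(cosh a - 1) * (sinh b' - sinh b)\<bar> \<le> 2 * \<eta>\<^sup>2 * (6 * (h * \<eta>))"
    unfolding abs_mult using 3 h by (intro mult_mono) auto
  have 5: "\<bar>b' - b - h * \<eta> * H\<bar> \<le> h * \<eta> * \<eta>"
  proof (rule order_trans[OF dH])
    show "h * h * \<eta> \<le> h * \<eta> * \<eta>" using h by (intro mult_right_mono mult_left_mono) auto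
  qed
  have *: "cosh a' * sinh b' - cosh a * sinh b - h * \<eta> * H =
     (cosh a' - cosh a) * sinh b' + (cosh a - 1) * (sinh b' - sinh b) +
     (sinh b' - sinh b - (b' - b)) + (b' - b - h * \<eta> * H)"
    by (simp add: algebra_simps)
  have cub: "h * \<eta> ^ 3 \<le> h * \<eta>\<^sup>2"
    using h by (intro mult_left_mono power_decreasing) auto
  have "\<bar>cosh a' * sinh b' - cosh a * sinh b - h * \<eta> * H\<bar> \<le>
      8 * (h * \<eta> ^ 3) + 12 * (h * \<eta> ^ 3) + 4 * (h * \<eta> ^ 3) + h * \<eta>\<^sup>2"
  proof -
    have 1: "\<bar>(cosh a' - cosh a) * sinh b'\<bar> \<le> 8 * (h * \<eta> ^ 3)"
      by (rule order_trans[OF 1]) (simp add: power2_eq_square power3_eq_cube power4_eq_xxxx mult_ac)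
    have 2: "\<bar>sinh b' - sinh b - (b' - b)\<bar> \<le> 4 * (h * \<eta> ^ 3)"
      by (rule order_trans[OF 2]) (simp add: power2_eq_square power3_eq_cube power4_eq_xxxx mult_ac)
    have 4: "\<bar>(cosh a - 1) * (sinh b' - sinh b)\<bar> \<le> 12 * (h * \<eta> ^ 3)"
      by (rule order_trans[OF 4]) (simp add: power2_eq_square power3_eq_cube power4_eq_xxxx mult_ac)
    have 5: "\<bar>b' - b - h * \<eta> * H\<bar> \<le> h * \<eta>\<^sup>2"
      by (rule order_trans[OF 5]) (simp add: power2_eq_square power3_eq_cube power4_eq_xxxx mult_ac)
    show ?thesis unfolding * using 1 2 4 5 by linarith
  qed
  then show ?thesis using cub mult_nonneg_nonneg[of h "\<eta>\<^sup>2"] h zero_le_power2[of \<eta>] by linarith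
qed

text \<open>Since 2 (cosh a - 1) is a^2 to leading order, the main term is the product rule for a^2
  b with the increments \<open>h * \<eta> * Ha\<close> and \<open>h * \<eta> * Hb\<close>. It has
  size \<open>h * \<eta> ^ 3\<close>, so each factor is expanded one order beyond its own
  size.\<close>

lemma potential_diff_estimate:
  fixes h \<eta> a a' b b' Ha Hb :: real
  assumes h: "0 < h" "h \<le> \<eta>" "\<eta> \<le> 1"
    and a: "\<bar>a\<bar> \<le> \<eta>" and a': "\<bar>a'\<bar> \<le> \<eta>" and b: "\<bar>b\<bar> \<le> \<eta>" and b': "\<bar>b'\<bar> \<le> \<eta>"
    and HH: "\<bar>Ha\<bar> \<le> 1" "\<bar>Hb\<bar> \<le> 1"
    and da: "\<bar>a' - a\<bar> \<le> 2 * (h * \<eta>)" and db: "\<bar>b' - b\<bar> \<le> 2 * (h * \<eta>)"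
    and dHa: "\<bar>a' - a - h * \<eta> * Ha\<bar> \<le> h * h * \<eta>"
    and dHb: "\<bar>b' - b - h * \<eta> * Hb\<bar> \<le> h * h * \<eta>"
  shows "\<bar>2 * (cosh a' - 1) * sinh b' - 2 * (cosh a - 1) * sinh b
      - h * \<eta> * (2 * a * Ha * b + a\<^sup>2 * Hb)\<bar> \<le> 100 * (h * \<eta> ^ 4)"
proof -
  have hh: "h * h \<le> h * \<eta>" using h by auto
  have sq: "\<eta>\<^sup>2 \<le> \<eta>" using h by (simp add: power2_eq_square mult_left_le)
  have cub: "\<eta> ^ 3 \<le> \<eta>\<^sup>2" "\<eta> ^ 4 \<le> \<eta> ^ 3"
    using h by (auto intro!: power_decreasing)
  have a1: "\<bar>cosh a' - cosh a - a * (a' - a)\<bar> \<le> 8 * (h * \<eta> ^ 3)"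
  proof -
    have "\<bar>cosh a' - cosh a - a * (a' - a)\<bar> \<le> (2 * \<eta> ^ 3 + \<bar>a' - a\<bar>) * \<bar>a' - a\<bar>"
      using abs_cosh_taylor_le[OF a a'] h by auto
    also have "\<dots> \<le> (2 * \<eta>\<^sup>2 + 2 * (\<eta> * \<eta>)) * (2 * (h * \<eta>))"
    proof (intro mult_mono)
      have "h * \<eta> \<le> \<eta> * \<eta>" using h by (intro mult_right_mono) auto
      then show "2 * \<eta> ^ 3 + \<bar>a' - a\<bar> \<le> 2 * \<eta>\<^sup>2 + 2 * (\<eta> * \<eta>)"
        using da cub by linarith
    qed (use da h in auto)
    finally show ?thesis by (simp add: power2_eq_square power3_eq_cube algebra_simps)
  qed
  have a2: "\<bar>a * (a' - a) - h * \<eta> * (a * Ha)\<bar> \<le> h * \<eta> ^ 3"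
  proof -
    have "\<bar>a * (a' - a) - h * \<eta> * (a * Ha)\<bar> = \<bar>a\<bar> * \<bar>a' - a - h * \<eta> * Ha\<bar>"
      unfolding abs_mult[symmetric] by (simp add: algebra_simps)
    also have "\<dots> \<le> \<eta> * (h * \<eta> * \<eta>)"
      using order_trans[OF dHa mult_right_mono[OF hh, of \<eta>]] h a by (intro mult_mono) auto
    finally show ?thesis by (simp add: power3_eq_cube mult_ac)
  qed
  have a3: "\<bar>cosh a' - cosh a - h * \<eta> * (a * Ha)\<bar> \<le> 9 * (h * \<eta> ^ 3)"
    using a1 a2 by linarith
  have sb: "\<bar>sinh b'\<bar> \<le> 2 * \<eta>" using abs_sinh_le[of b'] b' h by auto
  have b1: "\<bar>(cosh a' - cosh a - h * \<eta> * (a * Ha)) * sinh b'\<bar> \<le> 9 * (h * \<eta> ^ 3) * (2 * \<eta>)"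
    unfolding abs_mult using a3 sb h by (intro mult_mono) auto
  have sb2: "\<bar>sinh b' - b\<bar> \<le> 4 * \<eta>\<^sup>2"
  proof -
    have "h * \<eta> \<le> \<eta>\<^sup>2" using h by (simp add: power2_eq_square)
    then show ?thesis using abs_sinh_minus_id_le[OF b'] db cub h by linarith
  qed
  have b2: "\<bar>h * \<eta> * (a * Ha) * (sinh b' - b)\<bar> \<le> (h * \<eta> * (\<eta> * 1)) * (4 * \<eta>\<^sup>2)"
    unfolding abs_mult using sb2 h HH(1) a by (intro mult_mono) auto
  have s1: "\<bar>sinh b' - sinh b - h * \<eta> * Hb\<bar> \<le> 5 * (h * \<eta>\<^sup>2)"
  proof -
    have "\<bar>sinh b' - sinh b - (b' - b)\<bar> \<le> 2 * \<eta>\<^sup>2 * (2 * (h * \<eta>))"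
      by (rule order_trans[OF abs_sinh_diff_le mult_left_mono[OF db]]) (use b b' h in auto)
    moreover have "h * h * \<eta> \<le> h * \<eta>\<^sup>2"
      using hh h mult_right_mono[OF hh, of \<eta>] by (simp add: power2_eq_square mult_ac)
    moreover have "2 * \<eta>\<^sup>2 * (2 * (h * \<eta>)) \<le> 4 * (h * \<eta>\<^sup>2)"
      using mult_left_mono[OF cub(1), of h] h by (simp add: power2_eq_square power3_eq_cube mult_ac)
    ultimately show ?thesis using dHb by linarith
  qed
  have s2: "\<bar>sinh b' - sinh b\<bar> \<le> 6 * (h * \<eta>)"
  proof -
    have "\<bar>h * \<eta> * Hb\<bar> \<le> h * \<eta> * 1" unfolding abs_mult using HH(2) h by (intro mult_mono) auto
    moreover have "5 * (h * \<eta>\<^sup>2) \<le> 5 * (h * \<eta>)" using sq h by auto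
    ultimately show ?thesis using s1 by linarith
  qed
  have c1: "\<bar>(2 * (cosh a - 1) - a\<^sup>2) * (sinh b' - sinh b)\<bar> \<le> (4 * \<eta> ^ 3) * (6 * (h * \<eta>))"
    unfolding abs_mult using abs_cosh_minus_square_le[OF a] s2 h by (intro mult_mono) auto
  have c2: "\<bar>a\<^sup>2 * (sinh b' - sinh b - h * \<eta> * Hb)\<bar> \<le> \<eta>\<^sup>2 * (5 * (h * \<eta>\<^sup>2))"
    unfolding abs_mult using s1 abs_le_square_iff[of a \<eta>] a h by (intro mult_mono) auto
  have *: "2 * (cosh a' - 1) * sinh b' - 2 * (cosh a - 1) * sinh b
      - h * \<eta> * (2 * a * Ha * b + a\<^sup>2 * Hb) =
      2 * ((cosh a' - cosh a - h * \<eta> * (a * Ha)) * sinh b') + 2 * (h * \<eta> * (a * Ha) * (sinh b' - b))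
      + (2 * (cosh a - 1) - a\<^sup>2) * (sinh b' - sinh b) + a\<^sup>2 * (sinh b' - sinh b - h * \<eta> * Hb)"
    by (simp add: algebra_simps)
  have "\<bar>2 * (cosh a' - 1) * sinh b' - 2 * (cosh a - 1) * sinh b
      - h * \<eta> * (2 * a * Ha * b + a\<^sup>2 * Hb)\<bar> \<le>
      36 * (h * \<eta> ^ 4) + 8 * (h * \<eta> ^ 4) + 24 * (h * \<eta> ^ 4) + 5 * (h * \<eta> ^ 4)"
  proof -
    have b1: "\<bar>(cosh a' - cosh a - h * \<eta> * (a * Ha)) * sinh b'\<bar> \<le> 18 * (h * \<eta> ^ 4)"
      by (rule order_trans[OF b1]) (simp add: power2_eq_square power3_eq_cube power4_eq_xxxx mult_ac)
    have b2: "\<bar>h * \<eta> * (a * Ha) * (sinh b' - b)\<bar> \<le> 4 * (h * \<eta> ^ 4)"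
      by (rule order_trans[OF b2]) (simp add: power2_eq_square power3_eq_cube power4_eq_xxxx mult_ac)
    have c1: "\<bar>(2 * (cosh a - 1) - a\<^sup>2) * (sinh b' - sinh b)\<bar> \<le> 24 * (h * \<eta> ^ 4)"
      by (rule order_trans[OF c1]) (simp add: power2_eq_square power3_eq_cube power4_eq_xxxx mult_ac)
    have c2: "\<bar>a\<^sup>2 * (sinh b' - sinh b - h * \<eta> * Hb)\<bar> \<le> 5 * (h * \<eta> ^ 4)"
      by (rule order_trans[OF c2]) (simp add: power2_eq_square power3_eq_cube power4_eq_xxxx mult_ac)
    show ?thesis unfolding * using b1 b2 c1 c2 by linarith
  qed
  moreover have "0 \<le> h * \<eta> ^ 4" using h by auto
  ultimately show ?thesis by linarith
qed

section \<open>Summation by parts on a lattice\<close>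

definition fd :: "'a::ab_group_add \<Rightarrow> ('a \<Rightarrow> real) \<Rightarrow> 'a \<Rightarrow> real" where
  "fd v f x = f (x + v) - f x"

definition cd :: "'a::ab_group_add \<Rightarrow> ('a \<Rightarrow> real) \<Rightarrow> 'a \<Rightarrow> real" where
  "cd v f x = f (x + v) - f (x - v)"

definition lap :: "'a::ab_group_add \<Rightarrow> ('a \<Rightarrow> real) \<Rightarrow> 'a \<Rightarrow> real" where
  "lap v f x = f (x + v) + f (x - v) - 2 * f x"

definition supp_on :: "'a set \<Rightarrow> ('a \<Rightarrow> real) \<Rightarrow> bool" where
  "supp_on A f \<longleftrightarrow> (\<forall>x. f x \<noteq> 0 \<longrightarrow> x \<in> A)"

lemma supp_onD: "supp_on A f \<Longrightarrow> x \<notin> A \<Longrightarrow> f x = 0"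
  unfolding supp_on_def by blast

lemma fd_lap: "fd v (lap w f) x = lap w (fd v f) x"
  unfolding fd_def lap_def by (simp add: algebra_simps)

lemma fd_cd: "fd v (cd w f) x = cd w (fd v f) x"
  unfolding fd_def cd_def by (simp add: algebra_simps)

lemma fd_mult: "fd v (\<lambda>y. f y * g y) x = fd v f x * g (x + v) + f x * fd v g x"
  unfolding fd_def by (simp add: algebra_simps)

lemma lap_eq: "lap v f x = fd v f x - fd v f (x - v)"
  unfolding fd_def lap_def by (simp add: algebra_simps)

text \<open>A shift moves the support of a function from one layer \<open>B m\<close> into the next one. All sums run over
  \<open>B 6\<close>, and functions are supported so far inside that no boundary terms occur.\<close>

locale lattice_layers =
  fixes B :: "nat \<Rightarrow> 'a::ab_group_add set" and e :: "'d::finite \<Rightarrow> 'a"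
  assumes finite_B: "finite (B m)"
    and B_Suc: "B m \<subseteq> B (Suc m)"
    and B_add: "x \<in> B m \<Longrightarrow> x + e j \<in> B (Suc m)"
    and B_diff: "x \<in> B m \<Longrightarrow> x - e j \<in> B (Suc m)"
begin

abbreviation S :: "('a \<Rightarrow> real) \<Rightarrow> real" where
  "S F \<equiv> sum F (B 6)"

lemma B_mono: "m \<le> n \<Longrightarrow> B m \<subseteq> B n"
  using B_Suc by (rule lift_Suc_mono_le)

lemma supp_mono: "supp_on (B m) f \<Longrightarrow> m \<le> n \<Longrightarrow> supp_on (B n) f"
  using B_mono[of m n] unfolding supp_on_def by blast

lemma supp_add: "supp_on (B m) f \<Longrightarrow> supp_on (B (Suc m)) (\<lambda>x. f (x + e j))"
  using B_diff[of "_ + e j" m j] unfolding supp_on_def by (metis add_diff_cancel_right')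

lemma supp_diff: "supp_on (B m) f \<Longrightarrow> supp_on (B (Suc m)) (\<lambda>x. f (x - e j))"
  using B_add[of "_ - e j" m j] unfolding supp_on_def by (metis diff_add_cancel)

lemma supp_fd: "supp_on (B m) f \<Longrightarrow> supp_on (B (Suc m)) (fd (e j) f)"
  using supp_add[of m f j] supp_mono[of m f "Suc m"] unfolding supp_on_def fd_def by force

text \<open>Translation invariance on a finite set: a point that leaves or enters \<open>B 6\<close>
  under the shift carries no mass, because F lives in \<open>B 5\<close>.\<close>

lemma S_shift:
  assumes "supp_on (B 5) F"
  shows "S (\<lambda>x. F (x + e j)) = S F"
proof -
  have "S (\<lambda>x. F (x + e j)) = sum F ((\<lambda>x. x + e j) ` B 6)"
    by (subst sum.reindex) (auto simp: inj_on_def)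
  also have "\<dots> = S F"
  proof (rule sum.mono_neutral_cong)
    show "F x = 0" if "x \<in> B 6 - (\<lambda>x. x + e j) ` B 6" for x
    proof (rule ccontr)
      assume "F x \<noteq> 0"
      then have "x - e j \<in> B (Suc 5)" using assms B_diff unfolding supp_on_def by blast
      then have "x - e j + e j \<in> (\<lambda>x. x + e j) ` B 6" by (intro imageI) simp
      then show False using that by simp
    qed
    show "F x = 0" if "x \<in> (\<lambda>x. x + e j) ` B 6 - B 6" for x
      using assms that B_mono[of 5 6] unfolding supp_on_def by auto
  qed (auto simp: finite_B)
  finally show ?thesis .
qed

text \<open>One layer is lost compared with \<open>S_shift\<close>, which is applied to the
  translate of F, and this translate reaches into \<open>B 5\<close>.\<close>

lemma S_shift_diff:
  assumes "supp_on (B 4) F"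
  shows "S (\<lambda>x. F (x - e j)) = S F"
  using S_shift[of "\<lambda>x. F (x - e j)" j] supp_diff[OF assms, of j] by simp

text \<open>Discrete form of the rule that twice the integral of a g g' is minus the integral of a'
  g^2. The two products in g * cd g are translates of each other, so only the difference of their
  coefficients survives and no difference of g remains.\<close>

lemma S_mult_cd:
  assumes "supp_on (B 4) g"
  shows "S (\<lambda>x. a x * (g x * cd (e k) g x)) = - S (\<lambda>x. fd (e k) a x * (g x * g (x + e k)))"
proof -
  define F where "F x = a x * g x * g (x - e k)" for x
  have "supp_on (B 5) F"
    using supp_mono[OF assms, of 5] unfolding supp_on_def F_def by auto
  then have "S (\<lambda>x. F (x + e k)) = S F" by (rule S_shift)
  then show ?thesis
    unfolding F_def fd_def cd_def by (simp add: algebra_simps sum_subtractf)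
qed

lemma S_lap:
  assumes "supp_on (B 4) g"
  shows "S (\<lambda>x. lap (e j) g x * G x) = - S (\<lambda>x. fd (e j) g x * fd (e j) G x)"
proof -
  define F where "F x = fd (e j) g (x - e j) * G x" for x
  have "supp_on (B 5) F"
    using supp_mono[OF assms, of 5] supp_diff[OF assms, of j]
    unfolding supp_on_def F_def fd_def by force
  then have "S (\<lambda>x. F (x + e j)) = S F" by (rule S_shift)
  then show ?thesis
    unfolding F_def lap_eq fd_def[of _ G]
    by (simp add: left_diff_distrib right_diff_distrib sum_subtractf)
qed

text \<open>Two summations by parts exchange one difference of each factor. Differences commute and
  have constant coefficients, so there is no remainder: the Laplacian alone controls all mixed
  second differences.\<close>

lemma S_lap_lap:
  assumes "supp_on (B 3) g"
  shows "S (\<lambda>x. lap (e j) g x * lap (e k) g x) = S (\<lambda>x. (fd (e k) (fd (e j) g) x)\<^sup>2)"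
proof -
  have "S (\<lambda>x. lap (e j) g x * lap (e k) g x) = - S (\<lambda>x. lap (e k) (fd (e j) g) x * fd (e j) g x)"
    by (subst S_lap) (use supp_mono[OF assms] in \<open>auto simp: fd_lap mult.commute\<close>)
  also have "\<dots> = S (\<lambda>x. (fd (e k) (fd (e j) g) x)\<^sup>2)"
    by (subst S_lap) (use supp_fd[OF assms] in \<open>auto simp: power2_eq_square eval_nat_numeral\<close>)
  finally show ?thesis .
qed

lemma S_sum_lap_square:
  assumes "supp_on (B 3) g"
  shows "S (\<lambda>x. (\<Sum>j\<in>UNIV. lap (e j) g x)\<^sup>2) =
    (\<Sum>j\<in>UNIV. \<Sum>k\<in>UNIV. S (\<lambda>x. (fd (e j) (fd (e k) g) x)\<^sup>2))"
proof -
  have "S (\<lambda>x. (\<Sum>j\<in>UNIV. lap (e j) g x)\<^sup>2) =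
      S (\<lambda>x. \<Sum>j\<in>UNIV. \<Sum>k\<in>UNIV. lap (e k) g x * lap (e j) g x)"
    unfolding power2_eq_square sum_product by (subst sum.swap) simp
  also have "\<dots> = (\<Sum>j\<in>UNIV. \<Sum>k\<in>UNIV. S (\<lambda>x. lap (e k) g x * lap (e j) g x))"
    by (subst sum.swap, intro sum.cong refl, rule sum.swap)
  finally show ?thesis unfolding S_lap_lap[OF assms] .
qed

text \<open>An exact identity, the discrete counterpart of computing a commutator. In
  \<open>W\<close> one difference is moved off the Laplacian. Where it meets
  \<open>cd (e k) f\<close>, the outcome has the form a g cd g with g = \<open>fd (e j) f\<close>,
  and \<open>S_mult_cd\<close> removes the extra difference. Thus only increments of coefficients
  and products of first differences of f remain, never third differences.\<close>

lemma S_cross: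
  assumes f: "supp_on (B 2) f"
  shows "2 * S (\<lambda>x. ((\<Sum>j\<in>UNIV. c j x * lap (e j) f x) + V x * f x) *
        - (\<Sum>k\<in>UNIV. s k x * cd (e k) f x)) =
    S (\<lambda>x. (\<Sum>k\<in>UNIV. 2 * (fd (e k) (\<lambda>y. V y * s k y) x * (f x * f (x + e k)))) +
      (\<Sum>j\<in>UNIV. \<Sum>k\<in>UNIV.
         2 * (fd (e j) f x * fd (e j) (\<lambda>y. c j y * s k y) x * cd (e k) f (x + e j))
       - 2 * (fd (e k) (\<lambda>y. c j y * s k y) x * (fd (e j) f x * fd (e j) f (x + e k)))))"
proof -
  have f4: "supp_on (B 4) f" using supp_mono[OF f] by simp
  have df4: "supp_on (B 4) (fd (e j) f)" for j
    by (rule supp_mono[OF supp_fd[OF f]]) simp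
  have V: "- (2 * S (\<lambda>x. V x * f x * (s k x * cd (e k) f x))) =
      S (\<lambda>x. 2 * (fd (e k) (\<lambda>y. V y * s k y) x * (f x * f (x + e k))))" for k
  proof -
    have "S (\<lambda>x. V x * f x * (s k x * cd (e k) f x)) =
        - S (\<lambda>x. fd (e k) (\<lambda>y. V y * s k y) x * (f x * f (x + e k)))"
      using S_mult_cd[OF f4, of "\<lambda>x. V x * s k x" k] by (simp add: mult_ac)
    then show ?thesis by (simp add: sum_distrib_left)
  qed
  have W: "- (2 * S (\<lambda>x. c j x * lap (e j) f x * (s k x * cd (e k) f x))) =
      S (\<lambda>x. 2 * (fd (e j) f x * fd (e j) (\<lambda>y. c j y * s k y) x * cd (e k) f (x + e j))
       - 2 * (fd (e k) (\<lambda>y. c j y * s k y) x * (fd (e j) f x * fd (e j) f (x + e k))))" for j k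
  proof -
    define w where "w = (\<lambda>y. c j y * s k y)"
    have "S (\<lambda>x. c j x * lap (e j) f x * (s k x * cd (e k) f x)) =
        S (\<lambda>x. lap (e j) f x * (w x * cd (e k) f x))"
      unfolding w_def by (simp add: mult_ac)
    also have "\<dots> = - S (\<lambda>x. fd (e j) f x * fd (e j) (\<lambda>x. w x * cd (e k) f x) x)"
      by (rule S_lap[OF f4])
    also have "\<dots> = - S (\<lambda>x. fd (e j) f x * fd (e j) w x * cd (e k) f (x + e j))
        - S (\<lambda>x. w x * (fd (e j) f x * cd (e k) (fd (e j) f) x))"
      unfolding fd_mult fd_cd by (simp add: algebra_simps sum.distrib)
    also have "\<dots> = - S (\<lambda>x. fd (e j) f x * fd (e j) w x * cd (e k) f (x + e j))
        + S (\<lambda>x. fd (e k) w x * (fd (e j) f x * fd (e j) f (x + e k)))"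
      unfolding S_mult_cd[OF df4] by simp
    finally show ?thesis
      unfolding w_def[symmetric] by (simp add: sum_subtractf sum_distrib_left[symmetric])
  qed
  have "2 * S (\<lambda>x. ((\<Sum>j\<in>UNIV. c j x * lap (e j) f x) + V x * f x) *
        - (\<Sum>k\<in>UNIV. s k x * cd (e k) f x)) =
      S (\<lambda>x. (\<Sum>j\<in>UNIV. \<Sum>k\<in>UNIV. - (2 * (c j x * lap (e j) f x * (s k x * cd (e k) f x))))
        + (\<Sum>k\<in>UNIV. - (2 * (V x * f x * (s k x * cd (e k) f x)))))"
    unfolding sum_distrib_left
    by (intro sum.cong refl)
      (simp add: distrib_right sum_product sum_distrib_left sum_negf algebra_simps, rule sum.swap)
  also have "\<dots> = (\<Sum>j\<in>UNIV. \<Sum>k\<in>UNIV. - (2 * S (\<lambda>x. c j x * lap (e j) f x * (s k x * cd (e k) f x))))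
        + (\<Sum>k\<in>UNIV. - (2 * S (\<lambda>x. V x * f x * (s k x * cd (e k) f x))))"
    unfolding sum.distrib sum_distrib_left sum_negf[symmetric]
    by (intro arg_cong2[where f = "(+)"])
      (subst sum.swap, intro sum.cong refl, rule sum.swap, rule sum.swap)
  also have "\<dots> = (\<Sum>j\<in>UNIV. \<Sum>k\<in>UNIV. S (\<lambda>x. 2 * (fd (e j) f x * fd (e j) (\<lambda>y. c j y * s k y) x * cd (e k) f (x + e j))
       - 2 * (fd (e k) (\<lambda>y. c j y * s k y) x * (fd (e j) f x * fd (e j) f (x + e k)))))
      + (\<Sum>k\<in>UNIV. S (\<lambda>x. 2 * (fd (e k) (\<lambda>y. V y * s k y) x * (f x * f (x + e k)))))"
    unfolding V W ..
  also have "\<dots> = S (\<lambda>x. (\<Sum>k\<in>UNIV. 2 * (fd (e k) (\<lambda>y. V y * s k y) x * (f x * f (x + e k)))) +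
      (\<Sum>j\<in>UNIV. \<Sum>k\<in>UNIV.
         2 * (fd (e j) f x * fd (e j) (\<lambda>y. c j y * s k y) x * cd (e k) f (x + e j))
       - 2 * (fd (e k) (\<lambda>y. c j y * s k y) x * (fd (e j) f x * fd (e j) f (x + e k)))))"
    unfolding sum.distrib[of _ _ "B 6"] add.commute[of "S _" "S _"]
    by (subst add.commute, intro arg_cong2[where f = "(+)"])
      (rule sum.swap, subst (2) sum.swap, intro sum.cong refl, rule sum.swap)
  finally show ?thesis .
qed

end

section \<open>The conjugated Laplacian\<close>

text \<open>The geometric mean of two numbers below E is below E. With two summands of the energy
  density as a and b, this bounds their mixed product.\<close>

lemma abs_le_of_square_products:
  fixes x y a b E :: real
  assumes "x\<^sup>2 = a * b" "0 \<le> a" "a \<le> E" "0 \<le> b" "b \<le> E"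
  shows "\<bar>x\<bar> \<le> E"
proof -
  have "x\<^sup>2 \<le> E * E" unfolding assms(1) using assms by (intro mult_mono) auto
  then have "x\<^sup>2 \<le> E\<^sup>2" by (simp add: power2_eq_square)
  moreover have "0 \<le> E" using assms by linarith
  ultimately show ?thesis using abs_le_square_iff[of x E] by linarith
qed

lemma sum_square_le_card:
  fixes g :: "'d::finite \<Rightarrow> real"
  shows "(\<Sum>j\<in>UNIV. g j)\<^sup>2 \<le> real CARD('d) * (\<Sum>j\<in>UNIV. (g j)\<^sup>2)"
  using sum_squared_le_sum_of_squares[of g UNIV] by (simp add: mult_ac)

lemma square_add_le: "(a + b)\<^sup>2 \<le> 2 * a\<^sup>2 + 2 * (b::real)\<^sup>2"
  using sum_squares_bound[of a b] by (simp add: power2_sum)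

lemma square_add3_le: "(a + b + c)\<^sup>2 \<le> 3 * a\<^sup>2 + 3 * b\<^sup>2 + 3 * (c::real)\<^sup>2"
proof -
  have "0 \<le> (a - b)\<^sup>2 + (a - c)\<^sup>2 + (b - c)\<^sup>2" by simp
  then show ?thesis by (simp add: power2_eq_square algebra_simps)
qed

lemma square_bound:
  fixes a :: real
  assumes "\<bar>a\<bar> \<le> k"
  shows "a\<^sup>2 \<le> k\<^sup>2"
  using assms abs_le_square_iff[of a k] by simp

text \<open>The weight is normalised by a constant \<open>M\<close> that bounds all its derivatives: \<open>p = \<nabla>\<phi> / M\<close> and
  \<open>H = D\<^sup>2\<phi> / M\<close> for the weight \<open>\<tau> \<phi>\<close>, with \<open>\<eta> = M \<tau> h\<close>. So \<open>h / \<eta> = 1 / (M \<tau>)\<close> and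
  \<open>\<eta>\<close> are the two small parameters of the argument.\<close>

locale carleman_coefficients = lattice_layers B e
  for B :: "nat \<Rightarrow> 'a::ab_group_add set" and e :: "'d::finite \<Rightarrow> 'a" +
  fixes p :: "'d \<Rightarrow> 'a \<Rightarrow> real" and H :: "'d \<Rightarrow> 'd \<Rightarrow> 'a \<Rightarrow> real" and Q f :: "'a \<Rightarrow> real"
    and h \<eta> \<epsilon> D :: real
  assumes h: "0 < h" "h \<le> \<eta>" "\<eta> \<le> 1" and eps: "0 < \<epsilon>" and D_eq: "D = real CARD('d)"
    and p_le: "x \<in> B 7 \<Longrightarrow> \<bar>p j x\<bar> \<le> 1"
    and H_le: "x \<in> B 7 \<Longrightarrow> \<bar>H j k x\<bar> \<le> 1"
    and Q_le: "x \<in> B 7 \<Longrightarrow> \<bar>Q x\<bar> \<le> 1"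
    and fd_p: "x \<in> B 6 \<Longrightarrow> \<bar>fd (e k) (p j) x - h * H j k x\<bar> \<le> h * h"
    and fd_Q: "x \<in> B 6 \<Longrightarrow> \<bar>fd (e k) Q x\<bar> \<le> h"
    and pos_grad: "x \<in> B 6 \<Longrightarrow> \<epsilon> * (\<Sum>j\<in>UNIV. (\<xi> j)\<^sup>2) \<le>
      4 * (\<Sum>j\<in>UNIV. \<Sum>k\<in>UNIV. H k j x * \<xi> j * \<xi> k) + (Q x - 2 * (\<Sum>k\<in>UNIV. H k k x)) * (\<Sum>j\<in>UNIV. (\<xi> j)\<^sup>2)"
    and pos_fun: "x \<in> B 6 \<Longrightarrow> \<epsilon> \<le>
      4 * (\<Sum>j\<in>UNIV. \<Sum>k\<in>UNIV. H j k x * p j x * p k x)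
      + (2 * (\<Sum>k\<in>UNIV. H k k x) - Q x) * (\<Sum>j\<in>UNIV. (p j x)\<^sup>2)"
    and supp_f: "supp_on (B 0) f"
begin

definition b where "b j x = \<eta> * p j x"
definition c where "c j x = cosh (b j x)"
definition s where "s j x = sinh (b j x)"
text \<open>The coefficient of f that remains when exp (- b) f (x + e j) + exp b f (x - e j) - 2 f x
  is written through cosh b * lap f and sinh b * cd f. To leading order it is
  \<open>\<eta>\<^sup>2\<close> |p|^2.\<close>

definition V where "V x = (\<Sum>j\<in>UNIV. 2 * (c j x - 1))"
definition symm_part where "symm_part x = (\<Sum>j\<in>UNIV. c j x * lap (e j) f x) + V x * f x"
definition anti_part where "anti_part x = - (\<Sum>k\<in>UNIV. s k x * cd (e k) f x)"

text \<open>Summed over the lattice this is comparable to \<open>energy\<close>. The shifted second differences are included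
  because expanding products of \<open>f\<close> at neighbouring points produces them.\<close>

definition energy_density where
  "energy_density x = \<eta> ^ 3 * (f x)\<^sup>2 + \<eta> * (\<Sum>j\<in>UNIV. (fd (e j) f x)\<^sup>2)
     + (1 / \<eta>) * ((\<Sum>j\<in>UNIV. \<Sum>k\<in>UNIV. (fd (e j) (fd (e k) f) x)\<^sup>2)
       + (\<Sum>l\<in>UNIV. \<Sum>j\<in>UNIV. \<Sum>k\<in>UNIV. (fd (e j) (fd (e k) f) (x - e l))\<^sup>2))"

definition N0 where "N0 = S (\<lambda>x. (f x)\<^sup>2)"
definition N1 where "N1 = (\<Sum>j\<in>UNIV. S (\<lambda>x. (fd (e j) f x)\<^sup>2))"
definition N2 where "N2 = (\<Sum>j\<in>UNIV. \<Sum>k\<in>UNIV. S (\<lambda>x. (fd (e j) (fd (e k) f) x)\<^sup>2))"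
text \<open>Every difference of f carries a factor h, and \<eta> is M \<tau> h. So these powers of
  \<eta> reproduce the weights \<open>\<tau> ^ 3\<close>, \<tau> and 1 / \<tau> of the theorem, up
  to powers of M and a common factor \<open>h ^ 3\<close>.\<close>

definition energy where "energy = \<eta> ^ 3 * N0 + \<eta> * N1 + N2 / \<eta>"

section \<open>Products of differences measured by the energy density\<close>

lemma D_ge_1: "1 \<le> D" unfolding D_eq using one_le_card_finite[where 'a = 'd] by linarith

lemma eta_pos: "0 < \<eta>" using h by linarith

lemma N_nonneg: "0 \<le> N0" "0 \<le> N1" "0 \<le> N2"
  unfolding N0_def N1_def N2_def by (auto intro!: sum_nonneg)

lemma energy_nonneg: "0 \<le> energy"
  unfolding energy_def using N_nonneg eta_pos by simp

lemma S_energy_density_le: "S energy_density \<le> (D + 1) * energy"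
proof -
  have 1: "S (\<lambda>x. \<Sum>j\<in>UNIV. (fd (e j) f x)\<^sup>2) = N1"
    unfolding N1_def by (rule sum.swap)
  have sw: "S (\<lambda>x. \<Sum>j\<in>UNIV. \<Sum>k\<in>UNIV. G j k x) = (\<Sum>j\<in>UNIV. \<Sum>k\<in>UNIV. S (G j k))"
    for G :: "'d \<Rightarrow> 'd \<Rightarrow> 'a \<Rightarrow> real"
    by (subst sum.swap, intro sum.cong refl, rule sum.swap)
  have 2: "S (\<lambda>x. \<Sum>j\<in>UNIV. \<Sum>k\<in>UNIV. (fd (e j) (fd (e k) f) x)\<^sup>2) = N2"
    unfolding N2_def sw ..
  have 3: "S (\<lambda>x. \<Sum>l\<in>UNIV. \<Sum>j\<in>UNIV. \<Sum>k\<in>UNIV. (fd (e j) (fd (e k) f) (x - e l))\<^sup>2) = D * N2"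
  proof -
    have "S (\<lambda>x. (fd (e j) (fd (e k) f) (x - e l))\<^sup>2) = S (\<lambda>x. (fd (e j) (fd (e k) f) x)\<^sup>2)" for j k l
    proof (rule S_shift_diff[of "\<lambda>x. (fd (e j) (fd (e k) f) x)\<^sup>2"])
      have "supp_on (B 4) (fd (e j) (fd (e k) f))"
        by (rule supp_mono[OF supp_fd[OF supp_fd[OF supp_f]]]) simp
      then show "supp_on (B 4) (\<lambda>x. (fd (e j) (fd (e k) f) x)\<^sup>2)"
        unfolding supp_on_def by auto
    qed
    then show ?thesis unfolding N2_def by (subst sum.swap) (simp only: sw, simp add: D_eq)
  qed
  have "S energy_density = \<eta> ^ 3 * N0 + \<eta> * N1 + (1 / \<eta>) * (N2 + D * N2)"
    unfolding energy_density_def sum.distrib sum_distrib_left[symmetric] 1 2 3 N0_def ..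
  also have "\<dots> \<le> (D + 1) * energy"
  proof -
    have "0 \<le> D * (\<eta> ^ 3 * N0)" "0 \<le> D * (\<eta> * N1)"
      using N_nonneg eta_pos D_ge_1 by auto
    then show ?thesis unfolding energy_def by (simp add: algebra_simps add_divide_distrib)
  qed
  finally show ?thesis .
qed

lemma density_nonneg: "0 \<le> energy_density x"
  unfolding energy_density_def using eta_pos by (intro add_nonneg_nonneg mult_nonneg_nonneg sum_nonneg) auto

lemma
  shows density_fun: "\<eta> ^ 3 * (f x)\<^sup>2 \<le> energy_density x"
    and density_fd: "\<eta> * (fd (e j) f x)\<^sup>2 \<le> energy_density x"
    and density_fd2: "(fd (e j) (fd (e k) f) x)\<^sup>2 / \<eta> \<le> energy_density x"
    and density_fd2_shift: "(fd (e j) (fd (e k) f) (x - e l))\<^sup>2 / \<eta> \<le> energy_density x"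
proof -
  define a1 where "a1 = \<eta> ^ 3 * (f x)\<^sup>2"
  define a2 where "a2 = \<eta> * (\<Sum>j\<in>UNIV. (fd (e j) f x)\<^sup>2)"
  define a3 where "a3 = (1 / \<eta>) * (\<Sum>j\<in>UNIV. \<Sum>k\<in>UNIV. (fd (e j) (fd (e k) f) x)\<^sup>2)"
  define a4 where "a4 = (1 / \<eta>) * (\<Sum>l\<in>UNIV. \<Sum>j\<in>UNIV. \<Sum>k\<in>UNIV. (fd (e j) (fd (e k) f) (x - e l))\<^sup>2)"
  have E: "energy_density x = a1 + a2 + a3 + a4"
    unfolding energy_density_def a1_def a2_def a3_def a4_def by (simp only: distrib_left add.assoc)
  have nn: "0 \<le> a1" "0 \<le> a2" "0 \<le> a3" "0 \<le> a4"
    unfolding a1_def a2_def a3_def a4_def using eta_pos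
    by (auto intro!: mult_nonneg_nonneg divide_nonneg_nonneg sum_nonneg)
  have mem: "G j \<le> sum G UNIV" if "\<And>i. 0 \<le> G i" for G :: "'d \<Rightarrow> real" and j
    using that by (intro member_le_sum) auto
  show "\<eta> ^ 3 * (f x)\<^sup>2 \<le> energy_density x" using nn unfolding E a1_def[symmetric] by linarith
  have "\<eta> * (fd (e j) f x)\<^sup>2 \<le> a2"
    unfolding a2_def using eta_pos mem[of "\<lambda>j. (fd (e j) f x)\<^sup>2"] by auto
  then show "\<eta> * (fd (e j) f x)\<^sup>2 \<le> energy_density x" using nn unfolding E by linarith
  have "(fd (e j) (fd (e k) f) x)\<^sup>2 \<le> (\<Sum>j\<in>UNIV. \<Sum>k\<in>UNIV. (fd (e j) (fd (e k) f) x)\<^sup>2)"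
    by (rule order_trans[OF mem mem]) (auto intro: sum_nonneg)
  then have "(fd (e j) (fd (e k) f) x)\<^sup>2 / \<eta> \<le> a3"
    unfolding a3_def using eta_pos by (simp add: divide_right_mono)
  then show "(fd (e j) (fd (e k) f) x)\<^sup>2 / \<eta> \<le> energy_density x" using nn unfolding E by linarith
  have "(fd (e j) (fd (e k) f) (x - e l))\<^sup>2 \<le> (\<Sum>j\<in>UNIV. \<Sum>k\<in>UNIV. (fd (e j) (fd (e k) f) (x - e l))\<^sup>2)"
    by (rule order_trans[OF mem mem]) (auto intro: sum_nonneg)
  also have "\<dots> \<le> (\<Sum>l\<in>UNIV. \<Sum>j\<in>UNIV. \<Sum>k\<in>UNIV. (fd (e j) (fd (e k) f) (x - e l))\<^sup>2)"
    by (rule mem) (auto intro!: sum_nonneg)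
  finally have "(fd (e j) (fd (e k) f) (x - e l))\<^sup>2 / \<eta> \<le> a4"
    unfolding a4_def using eta_pos by (simp add: divide_right_mono)
  then show "(fd (e j) (fd (e k) f) (x - e l))\<^sup>2 / \<eta> \<le> energy_density x" using nn unfolding E by linarith
qed

text \<open>The factors in this and the next three bounds are geometric means of the weights
  \<open>\<eta> ^ 3\<close>, \<eta> and 1 / \<eta>: \<open>\<eta>\<^sup>2\<close> for f times a
  first difference, \<eta> for two first differences, 1 for a first times a second
  difference.\<close>

lemma density_fun_fd: "\<bar>\<eta>\<^sup>2 * f x * fd (e j) f x\<bar> \<le> energy_density x"
  by (rule abs_le_of_square_products[OF _ _ density_fun _ density_fd[of j]])
    (use eta_pos in \<open>auto simp: power_mult_distrib eval_nat_numeral\<close>)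

lemma density_fd_fd: "\<bar>\<eta> * fd (e j) f x * fd (e k) f x\<bar> \<le> energy_density x"
  by (rule abs_le_of_square_products[OF _ _ density_fd[of j] _ density_fd[of k]])
    (use eta_pos in \<open>auto simp: power_mult_distrib eval_nat_numeral\<close>)

lemma density_fd_fd2: "\<bar>fd (e l) f x * fd (e j) (fd (e k) f) x\<bar> \<le> energy_density x"
  by (rule abs_le_of_square_products[OF _ _ density_fd[of l] _ density_fd2[of j k]])
    (use eta_pos in \<open>auto simp: power_mult_distrib\<close>)

lemma density_fd_fd2_shift: "\<bar>fd (e l) f x * fd (e j) (fd (e k) f) (x - e i)\<bar> \<le> energy_density x"
  by (rule abs_le_of_square_products[OF _ _ density_fd[of l] _ density_fd2_shift[of j k _ i]])
    (use eta_pos in \<open>auto simp: power_mult_distrib\<close>)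

section \<open>Increments of the coefficients\<close>

lemma B6_7: "x \<in> B 6 \<Longrightarrow> x \<in> B 7" using B_mono[of 6 7] by auto

lemma B6_add: "x \<in> B 6 \<Longrightarrow> x + e l \<in> B 7" using B_add[of x 6 l] by simp

lemma b_le: "x \<in> B 7 \<Longrightarrow> \<bar>b j x\<bar> \<le> \<eta>"
  unfolding b_def abs_mult using p_le[of x j] eta_pos by (simp add: mult_left_le)

lemma fd_b: "x \<in> B 6 \<Longrightarrow> \<bar>b j (x + e l) - b j x - h * \<eta> * H j l x\<bar> \<le> h * h * \<eta>"
proof -
  assume "x \<in> B 6"
  have "\<bar>b j (x + e l) - b j x - h * \<eta> * H j l x\<bar> = \<eta> * \<bar>fd (e l) (p j) x - h * H j l x\<bar>"
  proof -
    have "b j (x + e l) - b j x - h * \<eta> * H j l x = \<eta> * (fd (e l) (p j) x - h * H j l x)"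
      unfolding b_def fd_def by (simp add: algebra_simps)
    then show ?thesis using eta_pos by (simp add: abs_mult)
  qed
  also have "\<dots> \<le> \<eta> * (h * h)" using fd_p[OF \<open>x \<in> B 6\<close>] eta_pos by (intro mult_left_mono) auto
  finally show ?thesis by (simp add: mult_ac)
qed

lemma fd_b_le: 
  assumes "x \<in> B 6" 
  shows "\<bar>b j (x + e l) - b j x\<bar> \<le> 2 * (h * \<eta>)"
proof -
  have "\<bar>h * \<eta> * H j l x\<bar> \<le> h * \<eta> * 1"
    unfolding abs_mult using h H_le[OF B6_7[OF assms]] by (intro mult_mono) auto
  moreover have "h * h * \<eta> \<le> h * 1 * \<eta>" using h by (intro mult_right_mono mult_left_mono) auto
  ultimately show ?thesis using fd_b[OF assms, of j l] by linarith
qed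

text \<open>The index j leaves no trace in the main term: \<open>c j\<close> is 1 up to order
  \<open>\<eta>\<^sup>2\<close>, so the Hessian entry comes from \<open>s k\<close> alone.\<close>

lemma fd_w:
  assumes "x \<in> B 6"
  shows "\<bar>fd (e l) (\<lambda>y. c j y * s k y) x - h * \<eta> * H k l x\<bar> \<le> 30 * (h * \<eta>\<^sup>2)"
  unfolding fd_def c_def s_def
  by (rule cosh_sinh_diff_estimate[OF h b_le b_le b_le b_le fd_b_le fd_b_le fd_b])
    (use assms B6_7 B6_add in auto)

lemma fd_w_le:
  assumes "x \<in> B 6"
  shows "\<bar>fd (e l) (\<lambda>y. c j y * s k y) x\<bar> \<le> 31 * (h * \<eta>)"
proof -
  have "\<bar>h * \<eta> * H k l x\<bar> \<le> h * \<eta> * 1"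
    unfolding abs_mult using h H_le[OF B6_7[OF assms]] by (intro mult_mono) auto
  moreover have "h * \<eta>\<^sup>2 \<le> h * \<eta>" using h by (simp add: power2_eq_square mult_left_le)
  ultimately show ?thesis using fd_w[OF assms, of l j k] by linarith
qed

text \<open>The derivative in direction k of |p|^2 p_k, where H is the Jacobian of p. It appears
  because V * s k is \<open>\<eta> ^ 3\<close> |p|^2 p_k to leading order.\<close>

definition G where "G k x = (\<Sum>j\<in>UNIV. 2 * p j x * H j k x * p k x + (p j x)\<^sup>2 * H k k x)"

lemma fd_Vs:
  assumes "x \<in> B 6"
  shows "\<bar>fd (e k) (\<lambda>y. V y * s k y) x - h * \<eta> ^ 3 * G k x\<bar> \<le> 100 * D * (h * \<eta> ^ 4)"
proof -
  define t where "t j = 2 * (cosh (b j (x + e k)) - 1) * sinh (b k (x + e k))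
    - 2 * (cosh (b j x) - 1) * sinh (b k x)
    - h * \<eta> * (2 * b j x * H j k x * b k x + (b j x)\<^sup>2 * H k k x)" for j
  have t: "\<bar>t j\<bar> \<le> 100 * (h * \<eta> ^ 4)" for j
    unfolding t_def
    by (rule potential_diff_estimate[OF h b_le b_le b_le b_le H_le H_le fd_b_le fd_b_le fd_b fd_b])
      (use assms B6_7 B6_add in auto)
  have "fd (e k) (\<lambda>y. V y * s k y) x - h * \<eta> ^ 3 * G k x = (\<Sum>j\<in>UNIV. t j)"
    unfolding fd_def V_def G_def t_def c_def s_def b_def sum_distrib_left sum_distrib_right
      sum_subtractf[symmetric]
    by (intro sum.cong refl) (simp add: power2_eq_square power3_eq_cube algebra_simps)
  also have "\<bar>\<dots>\<bar> \<le> (\<Sum>j\<in>(UNIV::'d set). 100 * (h * \<eta> ^ 4))"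
    by (rule order_trans[OF sum_abs sum_mono[OF t]])
  finally show ?thesis by (simp add: D_eq)
qed

lemma G_le:
  assumes "x \<in> B 6"
  shows "\<bar>G k x\<bar> \<le> 3 * D"
proof -
  note pp = p_le[OF B6_7[OF assms]] and HH = H_le[OF B6_7[OF assms]]
  have "\<bar>2 * p j x * H j k x * p k x + (p j x)\<^sup>2 * H k k x\<bar> \<le> 3" for j
  proof -
    have "\<bar>p j x * H j k x * p k x\<bar> \<le> 1 * 1 * 1"
      unfolding abs_mult using pp HH by (intro mult_mono) auto
    moreover have "\<bar>p j x * p j x * H k k x\<bar> \<le> 1 * 1 * 1"
      unfolding abs_mult using pp HH by (intro mult_mono) auto
    ultimately show ?thesis by (simp add: power2_eq_square mult.assoc)
  qed
  then have "\<bar>G k x\<bar> \<le> (\<Sum>j\<in>(UNIV::'d set). 3)"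
    unfolding G_def by (intro order_trans[OF sum_abs sum_mono])
  then show ?thesis by (simp add: D_eq)
qed

lemma fd_Vs_le:
  assumes "x \<in> B 6"
  shows "\<bar>fd (e k) (\<lambda>y. V y * s k y) x\<bar> \<le> 103 * D * (h * \<eta> ^ 3)"
proof -
  have "\<bar>h * \<eta> ^ 3 * G k x\<bar> \<le> h * \<eta> ^ 3 * (3 * D)"
    using h G_le[OF assms, of k] by (simp add: abs_mult)
  moreover have "100 * D * (h * \<eta> ^ 4) \<le> 100 * D * (h * \<eta> ^ 3)"
    using h D_ge_1 by (intro mult_left_mono power_decreasing) auto
  ultimately show ?thesis using fd_Vs[OF assms, of k] by (simp add: algebra_simps)
qed

section \<open>Leading terms of the commutator\<close>

lemma potential_term:
  assumes "x \<in> B 6"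
  shows "\<bar>2 * (fd (e k) (\<lambda>y. V y * s k y) x * (f x * f (x + e k))) - 2 * (h * \<eta> ^ 3 * G k x * (f x)\<^sup>2)\<bar>
    \<le> 406 * D * (h * \<eta> * energy_density x)"
proof -
  define g where "g = fd (e k) (\<lambda>y. V y * s k y) x"
  have "\<bar>(g - h * \<eta> ^ 3 * G k x) * (f x)\<^sup>2\<bar> \<le> 100 * D * (h * \<eta> ^ 4) * (f x)\<^sup>2"
    unfolding abs_mult g_def using fd_Vs[OF assms, of k] h D_ge_1 by (intro mult_mono) auto
  also have "\<dots> = 100 * D * (h * \<eta>) * (\<eta> ^ 3 * (f x)\<^sup>2)" by (simp add: eval_nat_numeral)
  also have "\<dots> \<le> 100 * D * (h * \<eta>) * energy_density x"
    using density_fun h D_ge_1 by (intro mult_left_mono) auto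
  finally have 1: "\<bar>(g - h * \<eta> ^ 3 * G k x) * (f x)\<^sup>2\<bar> \<le> 100 * D * (h * \<eta>) * energy_density x" .
  have "\<bar>g * (f x * fd (e k) f x)\<bar> \<le> 103 * D * (h * \<eta> ^ 3) * \<bar>f x * fd (e k) f x\<bar>"
    unfolding abs_mult[of g]
    by (rule mult_mono) (use fd_Vs_le[OF assms, of k] h D_ge_1 in \<open>auto simp: g_def\<close>)
  also have "\<dots> = 103 * D * (h * \<eta>) * \<bar>\<eta>\<^sup>2 * f x * fd (e k) f x\<bar>"
    using eta_pos by (simp add: abs_mult eval_nat_numeral)
  also have "\<dots> \<le> 103 * D * (h * \<eta>) * energy_density x"
    using density_fun_fd h D_ge_1 by (intro mult_left_mono) auto
  finally have 2: "\<bar>g * (f x * fd (e k) f x)\<bar> \<le> 103 * D * (h * \<eta>) * energy_density x" .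
  \<comment> \<open>Replacing the neighbouring value by f x leaves g * f * fd f. Here g has size
    \<open>h * \<eta> ^ 3\<close> and the density pays for \<open>\<eta>\<^sup>2\<close> times f *
    fd f, so a factor \<eta> is gained.\<close>
  have "2 * (g * (f x * f (x + e k))) - 2 * (h * \<eta> ^ 3 * G k x * (f x)\<^sup>2) =
      2 * ((g - h * \<eta> ^ 3 * G k x) * (f x)\<^sup>2) + 2 * (g * (f x * fd (e k) f x))"
    unfolding fd_def by (simp add: power2_eq_square algebra_simps)
  then show ?thesis using 1 2 unfolding g_def[symmetric] by (simp add: mult.assoc)
qed

lemma grad_term:
  assumes "x \<in> B 6"
  shows "\<bar>2 * (fd (e j) f x * fd (e j) (\<lambda>y. c j y * s k y) x * cd (e k) f (x + e j))
      - 4 * (h * \<eta> * H k j x * fd (e j) f x * fd (e k) f x)\<bar>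
    \<le> 306 * (h * \<eta> * energy_density x)"
proof -
  define g where "g = fd (e j) (\<lambda>y. c j y * s k y) x"
  define d where "d = fd (e j) f x"
  define d' where "d' = fd (e k) f x"
  \<comment> \<open>At x + e j the central difference is twice the forward difference at x, up to
    second differences. Two of these sit at x - e k, which is the reason for the shifted terms in
    \<open>energy_density\<close>.\<close>
  define Y where "Y = fd (e j) (fd (e k) f) x + fd (e j) (fd (e k) f) (x - e k) - fd (e k) (fd (e k) f) (x - e k)"
  have cd: "cd (e k) f (x + e j) = 2 * d' + Y"
    unfolding Y_def cd_def d'_def fd_def by (simp add: algebra_simps)
  have dY: "\<bar>d * Y\<bar> \<le> 3 * energy_density x"
    using density_fd_fd2[of j x j k] density_fd_fd2_shift[of j x j k k] density_fd_fd2_shift[of j x k k k]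
    unfolding d_def[symmetric] Y_def distrib_left right_diff_distrib by linarith
  have 1: "\<bar>g * (d * Y)\<bar> \<le> 31 * (h * \<eta>) * (3 * energy_density x)"
    unfolding abs_mult[of g] by (rule mult_mono) (use fd_w_le[OF assms] dY h in \<open>auto simp: g_def\<close>)
  have "\<bar>(g - h * \<eta> * H k j x) * (d * d')\<bar> \<le> 30 * (h * \<eta>\<^sup>2) * \<bar>d * d'\<bar>"
    unfolding abs_mult[of "g - h * \<eta> * H k j x"] abs_power2
    by (rule mult_right_mono) (use fd_w[OF assms] in \<open>auto simp: g_def\<close>)
  also have "\<dots> = 30 * (h * \<eta>) * \<bar>\<eta> * d * d'\<bar>"
    using eta_pos by (simp add: abs_mult power2_eq_square)
  also have "\<dots> \<le> 30 * (h * \<eta>) * energy_density x"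
    unfolding d_def d'_def using density_fd_fd h by (intro mult_left_mono) auto
  finally have 2: "\<bar>(g - h * \<eta> * H k j x) * (d * d')\<bar> \<le> 30 * (h * \<eta>) * energy_density x" .
  have "2 * (d * g * (2 * d' + Y)) - 4 * (h * \<eta> * H k j x * d * d') =
     2 * (g * (d * Y)) + 4 * ((g - h * \<eta> * H k j x) * (d * d'))"
    by (simp add: algebra_simps)
  then show ?thesis using 1 2 unfolding cd g_def[symmetric] d_def[symmetric] d'_def[symmetric]
    by (simp add: mult.assoc)
qed

lemma trace_term:
  assumes "x \<in> B 6"
  shows "\<bar>2 * (fd (e k) (\<lambda>y. c j y * s k y) x * (fd (e j) f x * fd (e j) f (x + e k)))
      - 2 * (h * \<eta> * H k k x * (fd (e j) f x)\<^sup>2)\<bar>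
    \<le> 122 * (h * \<eta> * energy_density x)"
proof -
  define g where "g = fd (e k) (\<lambda>y. c j y * s k y) x"
  define d where "d = fd (e j) f x"
  define Y where "Y = fd (e k) (fd (e j) f) x"
  have fdk: "fd (e j) f (x + e k) = d + Y"
    unfolding Y_def d_def fd_def[of "e k"] by simp
  have 1: "\<bar>g * (d * Y)\<bar> \<le> 31 * (h * \<eta>) * energy_density x"
    unfolding abs_mult[of g]
    by (rule mult_mono) (use fd_w_le[OF assms] density_fd_fd2 h in \<open>auto simp: g_def d_def Y_def\<close>)
  have "\<bar>(g - h * \<eta> * H k k x) * d\<^sup>2\<bar> \<le> 30 * (h * \<eta>\<^sup>2) * d\<^sup>2"
    unfolding abs_mult[of "g - h * \<eta> * H k k x"] abs_power2
    by (rule mult_right_mono) (use fd_w[OF assms] in \<open>auto simp: g_def\<close>)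
  also have "\<dots> = 30 * (h * \<eta>) * (\<eta> * d\<^sup>2)"
    by (simp add: power2_eq_square)
  also have "\<dots> \<le> 30 * (h * \<eta>) * energy_density x"
    unfolding d_def using density_fd h by (intro mult_left_mono) auto
  finally have 2: "\<bar>(g - h * \<eta> * H k k x) * d\<^sup>2\<bar> \<le> 30 * (h * \<eta>) * energy_density x" .
  have "2 * (g * (d * (d + Y))) - 2 * (h * \<eta> * H k k x * d\<^sup>2) =
     2 * (g * (d * Y)) + 2 * ((g - h * \<eta> * H k k x) * d\<^sup>2)"
    by (simp add: algebra_simps power2_eq_square)
  then show ?thesis using 1 2 unfolding fdk g_def[symmetric] d_def[symmetric]
    by (simp add: mult.assoc)
qed

definition main_density where
  "main_density x = (\<Sum>k\<in>UNIV. 2 * (h * \<eta> ^ 3 * G k x * (f x)\<^sup>2)) +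
     (\<Sum>j\<in>UNIV. \<Sum>k\<in>UNIV. 4 * (h * \<eta> * H k j x * fd (e j) f x * fd (e k) f x)
        - 2 * (h * \<eta> * H k k x * (fd (e j) f x)\<^sup>2))"

lemma cross_ge:
  "S main_density - 834 * D\<^sup>2 * (h * \<eta>) * S energy_density \<le> 2 * S (\<lambda>x. symm_part x * anti_part x)"
proof -
  define P where "P k x = 2 * (fd (e k) (\<lambda>y. V y * s k y) x * (f x * f (x + e k)))" for k x
  define R where "R j k x = 2 * (fd (e j) f x * fd (e j) (\<lambda>y. c j y * s k y) x * cd (e k) f (x + e j))
       - 2 * (fd (e k) (\<lambda>y. c j y * s k y) x * (fd (e j) f x * fd (e j) f (x + e k)))" for j k x
  have "2 * S (\<lambda>x. symm_part x * anti_part x) = S (\<lambda>x. (\<Sum>k\<in>UNIV. P k x) + (\<Sum>j\<in>UNIV. \<Sum>k\<in>UNIV. R j k x))"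
    unfolding symm_part_def anti_part_def P_def R_def
    by (rule S_cross) (rule supp_mono[OF supp_f], simp)
  moreover have "S (\<lambda>x. main_density x - 834 * D\<^sup>2 * (h * \<eta>) * energy_density x) \<le>
      S (\<lambda>x. (\<Sum>k\<in>UNIV. P k x) + (\<Sum>j\<in>UNIV. \<Sum>k\<in>UNIV. R j k x))"
  proof (rule sum_mono)
    fix x assume x: "x \<in> B 6"
    define E where "E = h * \<eta> * energy_density x"
    have P: "2 * (h * \<eta> ^ 3 * G k x * (f x)\<^sup>2) - 406 * D * E \<le> P k x" for k
      using potential_term[OF x, of k] unfolding P_def E_def by linarith
    have R: "4 * (h * \<eta> * H k j x * fd (e j) f x * fd (e k) f x)
        - 2 * (h * \<eta> * H k k x * (fd (e j) f x)\<^sup>2) - 428 * E \<le> R j k x" for j k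
      using grad_term[OF x, of j k] trace_term[OF x, of k j] unfolding R_def E_def by linarith
    have "(\<Sum>k\<in>UNIV. 2 * (h * \<eta> ^ 3 * G k x * (f x)\<^sup>2) - 406 * D * E) \<le> (\<Sum>k\<in>UNIV. P k x)"
      by (intro sum_mono P)
    then have P': "(\<Sum>k\<in>UNIV. 2 * (h * \<eta> ^ 3 * G k x * (f x)\<^sup>2)) - D * (406 * D * E) \<le> (\<Sum>k\<in>UNIV. P k x)"
      by (simp add: sum_subtractf D_eq)
    have "(\<Sum>j\<in>UNIV. \<Sum>k\<in>UNIV. (4 * (h * \<eta> * H k j x * fd (e j) f x * fd (e k) f x)
        - 2 * (h * \<eta> * H k k x * (fd (e j) f x)\<^sup>2)) - 428 * E) \<le> (\<Sum>j\<in>UNIV. \<Sum>k\<in>UNIV. R j k x)"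
      by (intro sum_mono R)
    then have R': "(\<Sum>j\<in>UNIV. \<Sum>k\<in>UNIV. 4 * (h * \<eta> * H k j x * fd (e j) f x * fd (e k) f x)
        - 2 * (h * \<eta> * H k k x * (fd (e j) f x)\<^sup>2)) - D * (D * (428 * E)) \<le> (\<Sum>j\<in>UNIV. \<Sum>k\<in>UNIV. R j k x)"
      unfolding sum_subtractf[of _ "\<lambda>_. 428 * E"]
        sum_subtractf[of _ "\<lambda>_. (\<Sum>k\<in>(UNIV::'d set). 428 * E)"] by (simp add: D_eq)
    \<comment> \<open>834 is 406 + 428: there are D potential terms with error 406 D each, and D^2
      pairs of gradient and trace terms with error 306 + 122 each.\<close>
    have "834 * D\<^sup>2 * (h * \<eta>) * energy_density x = D * (406 * D * E) + D * (D * (428 * E))"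
      unfolding E_def by (simp add: power2_eq_square)
    then show "main_density x - 834 * D\<^sup>2 * (h * \<eta>) * energy_density x \<le>
       (\<Sum>k\<in>UNIV. P k x) + (\<Sum>j\<in>UNIV. \<Sum>k\<in>UNIV. R j k x)"
      using P' R' unfolding main_density_def by linarith
  qed
  ultimately show ?thesis by (simp add: sum_subtractf sum_distrib_left)
qed

section \<open>The multiplier term\<close>

lemma c_minus_1:
  assumes "x \<in> B 7"
  shows "\<bar>c j x - 1\<bar> \<le> 2 * \<eta>\<^sup>2"
proof -
  have "(b j x)\<^sup>2 \<le> \<eta>\<^sup>2" using b_le[OF assms, of j] eta_pos abs_le_square_iff[of "b j x" \<eta>] by simp
  moreover have "\<bar>c j x - 1\<bar> \<le> 2 * (b j x)\<^sup>2"
    unfolding c_def using b_le[OF assms, of j] h by (intro abs_cosh_minus_1_le) linarith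
  ultimately show ?thesis by linarith
qed

lemma fd_cQ_le:
  assumes "x \<in> B 6"
  shows "\<bar>fd (e j) (\<lambda>y. c j y * Q y) x\<bar> \<le> 6 * h"
proof -
  have "\<bar>fd (e j) (c j) x\<bar> \<le> 2 * \<eta> * \<bar>b j (x + e j) - b j x\<bar>"
    unfolding fd_def c_def
    by (rule abs_cosh_diff_le) (use b_le B6_7 B6_add assms h in auto)
  also have "\<dots> \<le> 2 * \<eta> * (2 * (h * \<eta>))"
    using fd_b_le[OF assms] eta_pos by (intro mult_left_mono) auto
  also have "\<dots> \<le> 2 * 1 * (2 * (h * 1))" using h by (intro mult_mono) auto
  finally have 1: "\<bar>fd (e j) (c j) x\<bar> \<le> 4 * h" by simp
  have "\<bar>fd (e j) (c j) x * Q (x + e j)\<bar> \<le> 4 * h * 1"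
    unfolding abs_mult using 1 Q_le[OF B6_add[OF assms]] h by (intro mult_mono) auto
  moreover have "\<bar>c j x\<bar> \<le> 2"
    unfolding c_def using cosh_le_2[of "b j x"] b_le[OF B6_7[OF assms], of j] h by simp
  then have "\<bar>c j x * fd (e j) Q x\<bar> \<le> 2 * h"
    unfolding abs_mult using fd_Q[OF assms] h by (intro mult_mono) auto
  ultimately show ?thesis unfolding fd_mult by linarith
qed

text \<open>When the difference falls on c Q, whose increment has size h, the result is
  \<open>h\<^sup>2 * \<eta>\<close> times f * fd f. The density pays for
  \<open>\<eta>\<^sup>2\<close> times that product, so the error has relative size h / \<eta>. It is
  not small with \<eta>, only for large \<tau>.\<close>

lemma multiplier_grad_term:
  assumes "x \<in> B 6"
  shows "\<bar>h * \<eta> * (fd (e j) f x * fd (e j) (\<lambda>y. c j y * Q y * f y) x) - h * \<eta> * (Q x * (fd (e j) f x)\<^sup>2)\<bar>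
    \<le> 8 * (h * (\<eta> + h / \<eta>) * energy_density x)"
proof -
  define d where "d = fd (e j) f x"
  define g where "g = fd (e j) (\<lambda>y. c j y * Q y) x"
  let ?E = "energy_density x"
  have nn: "0 \<le> ?E" by (rule density_nonneg)
  have fdm: "fd (e j) (\<lambda>y. c j y * Q y * f y) x = g * f x + g * d + c j x * Q x * d"
    unfolding g_def d_def fd_def by (simp add: algebra_simps)
  have g: "\<bar>g\<bar> \<le> 6 * h" unfolding g_def by (rule fd_cQ_le[OF assms])
  have "\<bar>h * \<eta> * (g * (f x * d))\<bar> = h * \<eta> * (\<bar>g\<bar> * \<bar>f x * d\<bar>)"
    using h eta_pos by (simp add: abs_mult)
  also have "\<dots> \<le> h * \<eta> * (6 * h * \<bar>f x * d\<bar>)"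
    using g h eta_pos by (intro mult_left_mono mult_right_mono) auto
  also have "\<dots> = 6 * (h * (h / \<eta>)) * \<bar>\<eta>\<^sup>2 * f x * d\<bar>"
    using h eta_pos by (simp add: abs_mult power2_eq_square)
  also have "\<dots> \<le> 6 * (h * (h / \<eta>)) * ?E"
    unfolding d_def using density_fun_fd[of x j] h eta_pos by (intro mult_left_mono) auto
  finally have 1: "\<bar>h * \<eta> * (g * (f x * d))\<bar> \<le> 6 * (h * (h / \<eta>)) * ?E" .
  have ed: "\<eta> * d\<^sup>2 \<le> ?E" unfolding d_def by (rule density_fd)
  have "\<bar>h * \<eta> * (g * d\<^sup>2)\<bar> = h * \<bar>g\<bar> * (\<eta> * d\<^sup>2)"
    using h eta_pos by (simp add: abs_mult)
  also have "\<dots> \<le> h * (6 * h) * ?E"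
    using g ed h eta_pos nn by (intro mult_mono) auto
  also have "\<dots> \<le> h * (6 * \<eta>) * ?E"
    using h nn by (intro mult_left_mono mult_right_mono) auto
  finally have 2: "\<bar>h * \<eta> * (g * d\<^sup>2)\<bar> \<le> 6 * (h * \<eta>) * ?E" by simp
  have cQ: "\<bar>(c j x - 1) * Q x\<bar> \<le> 2 * \<eta>\<^sup>2 * 1"
    unfolding abs_mult using c_minus_1[OF B6_7[OF assms]] Q_le[OF B6_7[OF assms]] by (intro mult_mono) auto
  have "\<bar>h * \<eta> * ((c j x - 1) * Q x * d\<^sup>2)\<bar> = h * \<bar>(c j x - 1) * Q x\<bar> * (\<eta> * d\<^sup>2)"
    using h eta_pos by (simp add: abs_mult)
  also have "\<dots> \<le> h * (2 * \<eta>\<^sup>2 * 1) * ?E"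
    using cQ ed h eta_pos nn by (intro mult_mono) auto
  also have "\<dots> \<le> h * (2 * \<eta> * 1) * ?E"
    using h nn by (intro mult_left_mono mult_right_mono) (auto simp: power2_eq_square mult_left_le)
  finally have 3: "\<bar>h * \<eta> * ((c j x - 1) * Q x * d\<^sup>2)\<bar> \<le> 2 * (h * \<eta>) * ?E" by simp
  have 4: "0 \<le> h * (h / \<eta>) * ?E" using h eta_pos nn by simp
  have eq: "h * \<eta> * (d * (g * f x + g * d + c j x * Q x * d)) - h * \<eta> * (Q x * d\<^sup>2) =
     h * \<eta> * (g * (f x * d)) + h * \<eta> * (g * d\<^sup>2) + h * \<eta> * ((c j x - 1) * Q x * d\<^sup>2)"
    by (simp add: algebra_simps power2_eq_square)
  have "8 * (h * (\<eta> + h / \<eta>) * ?E) = 8 * (h * \<eta>) * ?E + 8 * (h * (h / \<eta>)) * ?E"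
    by (simp add: algebra_simps)
  then show ?thesis unfolding fdm d_def[symmetric] eq using 1 2 3 4 by linarith
qed

lemma multiplier_fun_term:
  assumes "x \<in> B 6"
  shows "\<bar>h * \<eta> * (V x * Q x * (f x)\<^sup>2) - h * \<eta> * (\<eta>\<^sup>2 * (\<Sum>j\<in>UNIV. (p j x)\<^sup>2) * Q x * (f x)\<^sup>2)\<bar>
    \<le> 4 * D * (h * \<eta> * energy_density x)"
proof -
  let ?v = "V x - \<eta>\<^sup>2 * (\<Sum>j\<in>UNIV. (p j x)\<^sup>2)"
  have "?v = (\<Sum>j\<in>UNIV. 2 * (c j x - 1) - (b j x)\<^sup>2)"
    unfolding V_def b_def by (simp add: sum_subtractf sum_distrib_left power_mult_distrib)
  also have "\<bar>\<dots>\<bar> \<le> (\<Sum>j\<in>(UNIV::'d set). 4 * \<eta> ^ 3)"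
    unfolding c_def
    by (intro order_trans[OF sum_abs sum_mono] abs_cosh_minus_square_le b_le B6_7 assms h)
  finally have v: "\<bar>?v\<bar> \<le> 4 * D * \<eta> ^ 3" by (simp add: D_eq mult_ac)
  have vQ: "\<bar>?v * Q x\<bar> \<le> 4 * D * \<eta> ^ 3 * 1"
    unfolding abs_mult using v Q_le[OF B6_7[OF assms]] D_ge_1 eta_pos by (intro mult_mono) auto
  have "h * \<eta> * (V x * Q x * (f x)\<^sup>2) - h * \<eta> * (\<eta>\<^sup>2 * (\<Sum>j\<in>UNIV. (p j x)\<^sup>2) * Q x * (f x)\<^sup>2)
     = h * \<eta> * ((?v * Q x) * (f x)\<^sup>2)" by (simp add: algebra_simps)
  also have "\<bar>\<dots>\<bar> = h * \<eta> * (\<bar>?v * Q x\<bar> * (f x)\<^sup>2)"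
    using h eta_pos by (simp add: abs_mult)
  also have "\<dots> \<le> h * \<eta> * ((4 * D * \<eta> ^ 3 * 1) * (f x)\<^sup>2)"
    using vQ h eta_pos by (intro mult_left_mono mult_right_mono) auto
  also have "\<dots> = 4 * D * (h * \<eta> * (\<eta> ^ 3 * (f x)\<^sup>2))" by simp
  also have "\<dots> \<le> 4 * D * (h * \<eta> * energy_density x)"
    using density_fun h eta_pos D_ge_1 by (intro mult_left_mono) auto
  finally show ?thesis .
qed

text \<open>The leading part of the pairing of \<open>symm_part\<close> with
  \<open>h * \<eta> * Q * f\<close>; the factor \<open>h * \<eta>\<close> gives it the size of
  \<open>main_density\<close>.\<close>

definition multiplier_density where
  "multiplier_density x = h * \<eta> * (\<eta>\<^sup>2 * (\<Sum>j\<in>UNIV. (p j x)\<^sup>2) * Q x * (f x)\<^sup>2)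
    - (\<Sum>j\<in>UNIV. h * \<eta> * (Q x * (fd (e j) f x)\<^sup>2))"

lemma multiplier_le:
  "S (\<lambda>x. symm_part x * (h * \<eta> * Q x * f x)) \<le>
    S multiplier_density + 12 * D * (h * (\<eta> + h / \<eta>)) * S energy_density"
proof -
  have f4: "supp_on (B 4) f" by (rule supp_mono[OF supp_f]) simp
  have "S (\<lambda>x. symm_part x * (h * \<eta> * Q x * f x)) =
     S (\<lambda>x. h * \<eta> * (V x * Q x * (f x)\<^sup>2) + (\<Sum>j\<in>UNIV. h * \<eta> * (lap (e j) f x * (c j x * Q x * f x))))"
    unfolding symm_part_def
    by (intro sum.cong refl) (simp add: algebra_simps sum_distrib_left power2_eq_square)
  also have "\<dots> = S (\<lambda>x. h * \<eta> * (V x * Q x * (f x)\<^sup>2))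
      + (\<Sum>j\<in>UNIV. h * \<eta> * S (\<lambda>x. lap (e j) f x * (c j x * Q x * f x)))"
    unfolding sum.distrib
    by (intro arg_cong2[where f = "(+)"] refl) (subst sum.swap, simp add: sum_distrib_left)
  also have "\<dots> = S (\<lambda>x. h * \<eta> * (V x * Q x * (f x)\<^sup>2))
      - (\<Sum>j\<in>UNIV. h * \<eta> * S (\<lambda>x. fd (e j) f x * fd (e j) (\<lambda>y. c j y * Q y * f y) x))"
    unfolding S_lap[OF f4] by (simp add: sum_negf)
  also have "\<dots> = S (\<lambda>x. h * \<eta> * (V x * Q x * (f x)\<^sup>2)
      - (\<Sum>j\<in>UNIV. h * \<eta> * (fd (e j) f x * fd (e j) (\<lambda>y. c j y * Q y * f y) x)))"
    unfolding sum_subtractf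
    by (intro arg_cong2[where f = "(-)"] refl) (simp only: sum_distrib_left, rule sum.swap)
  also have "\<dots> \<le> S (\<lambda>x. multiplier_density x + 12 * D * (h * (\<eta> + h / \<eta>)) * energy_density x)"
  proof (rule sum_mono)
    fix x assume x: "x \<in> B 6"
    define E where "E = h * (\<eta> + h / \<eta>) * energy_density x"
    have "h * \<eta> * (Q x * (fd (e j) f x)\<^sup>2) - 8 * E \<le>
        h * \<eta> * (fd (e j) f x * fd (e j) (\<lambda>y. c j y * Q y * f y) x)" for j
      using multiplier_grad_term[OF x, of j] unfolding E_def by linarith
    then have "(\<Sum>j\<in>UNIV. h * \<eta> * (Q x * (fd (e j) f x)\<^sup>2) - 8 * E) \<le>
        (\<Sum>j\<in>UNIV. h * \<eta> * (fd (e j) f x * fd (e j) (\<lambda>y. c j y * Q y * f y) x))"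
      by (rule sum_mono)
    then have 1: "(\<Sum>j\<in>UNIV. h * \<eta> * (Q x * (fd (e j) f x)\<^sup>2)) - D * (8 * E) \<le>
        (\<Sum>j\<in>UNIV. h * \<eta> * (fd (e j) f x * fd (e j) (\<lambda>y. c j y * Q y * f y) x))"
      by (simp add: sum_subtractf D_eq)
    have "h * \<eta> * energy_density x \<le> E"
      unfolding E_def using h eta_pos density_nonneg by (intro mult_right_mono mult_left_mono) auto
    then have "4 * D * (h * \<eta> * energy_density x) \<le> 4 * D * E"
      using D_ge_1 by (intro mult_left_mono) auto
    then have 2: "h * \<eta> * (V x * Q x * (f x)\<^sup>2) \<le>
        h * \<eta> * (\<eta>\<^sup>2 * (\<Sum>j\<in>UNIV. (p j x)\<^sup>2) * Q x * (f x)\<^sup>2) + 4 * D * E"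
      using multiplier_fun_term[OF x] by linarith
    have "12 * D * (h * (\<eta> + h / \<eta>)) * energy_density x = 4 * D * E + D * (8 * E)"
      unfolding E_def by simp
    then show "h * \<eta> * (V x * Q x * (f x)\<^sup>2)
      - (\<Sum>j\<in>UNIV. h * \<eta> * (fd (e j) f x * fd (e j) (\<lambda>y. c j y * Q y * f y) x))
      \<le> multiplier_density x + 12 * D * (h * (\<eta> + h / \<eta>)) * energy_density x"
      unfolding multiplier_density_def using 1 2 by linarith
  qed
  finally show ?thesis by (simp add: sum.distrib sum_distrib_left)
qed

text \<open>Q enters the coefficient of f^2 and that of the squared differences with opposite signs.
  Once collected, the two coefficients are those of \<open>pos_fun\<close> and of
  \<open>pos_grad\<close>, the latter taken at the vector of differences of f.\<close>

lemma main_minus_multiplier: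
  assumes "x \<in> B 6"
  shows "\<epsilon> * h * (\<eta> ^ 3 * (f x)\<^sup>2 + \<eta> * (\<Sum>j\<in>UNIV. (fd (e j) f x)\<^sup>2)) \<le>
    main_density x - multiplier_density x"
proof -
  define P where "P = (\<Sum>j\<in>UNIV. (p j x)\<^sup>2)"
  define T where "T = (\<Sum>k\<in>UNIV. H k k x)"
  define HP where "HP = (\<Sum>j\<in>UNIV. \<Sum>k\<in>UNIV. H j k x * p j x * p k x)"
  define N where "N = (\<Sum>j\<in>UNIV. (fd (e j) f x)\<^sup>2)"
  define HN where "HN = (\<Sum>j\<in>UNIV. \<Sum>k\<in>UNIV. H k j x * fd (e j) f x * fd (e k) f x)"
  have G: "(\<Sum>k\<in>UNIV. G k x) = 2 * HP + P * T"
    unfolding G_def HP_def P_def T_def sum_product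
    by (subst sum.swap) (simp add: sum.distrib sum_distrib_left mult_ac)
  have "main_density x = 2 * h * \<eta> ^ 3 * (\<Sum>k\<in>UNIV. G k x) * (f x)\<^sup>2
     + (4 * h * \<eta> * HN - 2 * h * \<eta> * (N * T))"
    unfolding main_density_def HN_def N_def T_def sum_product
    by (simp add: sum_subtractf sum_distrib_left sum_distrib_right mult_ac)
  then have "main_density x - multiplier_density x =
     h * (\<eta> ^ 3 * (f x)\<^sup>2) * (4 * HP + (2 * T - Q x) * P) + h * \<eta> * (4 * HN + (Q x - 2 * T) * N)"
    unfolding G multiplier_density_def P_def[symmetric] sum_distrib_left[symmetric] N_def[symmetric]
    by (simp add: algebra_simps power2_eq_square power3_eq_cube)
  moreover have "h * (\<eta> ^ 3 * (f x)\<^sup>2) * \<epsilon> \<le> h * (\<eta> ^ 3 * (f x)\<^sup>2) * (4 * HP + (2 * T - Q x) * P)"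
    unfolding HP_def P_def T_def using h eta_pos by (intro mult_left_mono pos_fun[OF assms]) auto
  moreover have "h * \<eta> * (\<epsilon> * N) \<le> h * \<eta> * (4 * HN + (Q x - 2 * T) * N)"
    unfolding HN_def N_def T_def using h eta_pos by (intro mult_left_mono pos_grad[OF assms]) auto
  ultimately show ?thesis unfolding N_def[symmetric] by (simp add: algebra_simps)
qed

text \<open>The square of the sum is expanded and the square of \<open>anti_part\<close> is dropped.
  By Young's inequality one half of the square of \<open>symm_part\<close> pays for the pairing with
  Q; the other half stays on the left, where \<open>N2_le\<close> needs it.\<close>

lemma energy_symm_part_le:
  "S (\<lambda>x. (symm_part x)\<^sup>2) / 2 + \<epsilon> * h * (\<eta> ^ 3 * N0 + \<eta> * N1) \<le>
    S (\<lambda>x. (symm_part x + anti_part x)\<^sup>2) + 850 * D\<^sup>2 * (D + 1) * (h * (\<eta> + h / \<eta>)) * energy"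
proof -
  define P where "P = S (\<lambda>x. (symm_part x)\<^sup>2)"
  define E where "E = S energy_density"
  define \<kappa> where "\<kappa> = h * (\<eta> + h / \<eta>)"
  have E: "0 \<le> E" unfolding E_def by (intro sum_nonneg density_nonneg)
  have kappa: "0 \<le> \<kappa>" "h * \<eta> \<le> \<kappa>" "h * (h / \<eta>) \<le> \<kappa>"
    unfolding \<kappa>_def using h eta_pos by (auto simp: algebra_simps)
  have D2: "1 \<le> D\<^sup>2" "D \<le> D\<^sup>2"
    using D_ge_1 one_le_power[of D 2] self_le_power[of D 2] by auto
  have "S (\<lambda>x. \<epsilon> * h * (\<eta> ^ 3 * (f x)\<^sup>2 + \<eta> * (\<Sum>j\<in>UNIV. (fd (e j) f x)\<^sup>2))) \<le>
      S (\<lambda>x. main_density x - multiplier_density x)"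
    by (rule sum_mono[OF main_minus_multiplier])
  moreover have "S (\<lambda>x. \<epsilon> * h * (\<eta> ^ 3 * (f x)\<^sup>2 + \<eta> * (\<Sum>j\<in>UNIV. (fd (e j) f x)\<^sup>2)))
      = \<epsilon> * h * (\<eta> ^ 3 * N0 + \<eta> * N1)"
  proof -
    have N1: "N1 = S (\<lambda>x. \<Sum>j\<in>UNIV. (fd (e j) f x)\<^sup>2)" unfolding N1_def by (rule sum.swap)
    show ?thesis unfolding N1 N0_def sum_distrib_left[symmetric] sum.distrib ..
  qed
  ultimately have 1: "\<epsilon> * h * (\<eta> ^ 3 * N0 + \<eta> * N1) \<le> S main_density - S multiplier_density"
    by (simp add: sum_subtractf)
  have "- S (\<lambda>x. symm_part x * (h * \<eta> * Q x * f x)) \<le>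
      S (\<lambda>x. (symm_part x)\<^sup>2 / 2 + h * (h / \<eta>) * energy_density x)"
    unfolding sum_negf[symmetric]
  proof (rule sum_mono)
    fix x assume x: "x \<in> B 6"
    have "0 \<le> (symm_part x + h * \<eta> * Q x * f x)\<^sup>2" by simp
    then have "- (symm_part x * (h * \<eta> * Q x * f x)) \<le> (symm_part x)\<^sup>2 / 2 + (h * \<eta> * Q x * f x)\<^sup>2 / 2"
      by (simp add: power2_sum)
    also have "(h * \<eta> * Q x * f x)\<^sup>2 / 2 \<le> (h * \<eta> * 1 * f x)\<^sup>2"
    proof -
      have "(Q x)\<^sup>2 \<le> 1" using Q_le[OF B6_7[OF x]] by (simp add: abs_square_le_1)
      then have "(h * \<eta> * f x)\<^sup>2 * (Q x)\<^sup>2 \<le> (h * \<eta> * f x)\<^sup>2 * 1" by (intro mult_left_mono) auto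
      then have "(h * \<eta> * Q x * f x)\<^sup>2 \<le> (h * \<eta> * 1 * f x)\<^sup>2" by (simp add: power_mult_distrib mult_ac)
      then show ?thesis using zero_le_power2[of "h * \<eta> * 1 * f x"] by linarith
    qed
    \<comment> \<open>The price of Young's inequality is again of relative size h / \<eta>.\<close>
    also have "(h * \<eta> * 1 * f x)\<^sup>2 = h * (h / \<eta>) * (\<eta> ^ 3 * (f x)\<^sup>2)"
      using eta_pos by (simp add: power_mult_distrib power2_eq_square power3_eq_cube)
    also have "\<dots> \<le> h * (h / \<eta>) * energy_density x"
      using h eta_pos density_fun by (intro mult_left_mono) auto
    finally show "- (symm_part x * (h * \<eta> * Q x * f x)) \<le> (symm_part x)\<^sup>2 / 2 + h * (h / \<eta>) * energy_density x"
      by simp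
  qed
  then have 2: "- S (\<lambda>x. symm_part x * (h * \<eta> * Q x * f x)) \<le> P / 2 + h * (h / \<eta>) * E"
    unfolding P_def E_def by (simp add: sum.distrib sum_distrib_left sum_divide_distrib)
  have "S (\<lambda>x. (symm_part x + anti_part x)\<^sup>2) =
      P + S (\<lambda>x. (anti_part x)\<^sup>2) + 2 * S (\<lambda>x. symm_part x * anti_part x)"
    unfolding P_def by (simp add: power2_sum sum.distrib sum_distrib_left mult_ac)
  moreover have "0 \<le> S (\<lambda>x. (anti_part x)\<^sup>2)" by (intro sum_nonneg) auto
  ultimately have 3: "P + 2 * S (\<lambda>x. symm_part x * anti_part x) \<le> S (\<lambda>x. (symm_part x + anti_part x)\<^sup>2)"
    by linarith
  have e1: "834 * D\<^sup>2 * (h * \<eta>) * E \<le> 834 * D\<^sup>2 * \<kappa> * E"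
    using kappa E by (intro mult_right_mono mult_left_mono) auto
  have e2: "12 * D * \<kappa> * E \<le> 12 * D\<^sup>2 * \<kappa> * E"
    using kappa E D2 by (intro mult_right_mono mult_left_mono) auto
  have e3: "h * (h / \<eta>) * E \<le> 1 * D\<^sup>2 * \<kappa> * E"
    using order_trans[OF kappa(3), of "1 * D\<^sup>2 * \<kappa>"] mult_right_mono[OF D2(1) kappa(1)] E
    by (intro mult_right_mono) auto
  have e4: "850 * D\<^sup>2 * \<kappa> * E \<le> 850 * D\<^sup>2 * \<kappa> * ((D + 1) * energy)"
    unfolding E_def using kappa S_energy_density_le by (intro mult_left_mono) auto
  have e5: "0 \<le> D\<^sup>2 * \<kappa> * E" using kappa E by simp
  \<comment> \<open>The errors 834, 12 and 1 add up to less than 850.\<close>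
  have "P / 2 + \<epsilon> * h * (\<eta> ^ 3 * N0 + \<eta> * N1) \<le>
    S (\<lambda>x. (symm_part x + anti_part x)\<^sup>2) + 850 * D\<^sup>2 * \<kappa> * ((D + 1) * energy)"
    using 1 2 3 e1 e2 e3 e4 e5 cross_ge multiplier_le
    unfolding E_def[symmetric] \<kappa>_def[symmetric] by linarith
  then show ?thesis unfolding P_def \<kappa>_def by (simp add: mult_ac)
qed

text \<open>N2 is the squared norm of the Laplacian of f, which differs from
  \<open>symm_part\<close> by (c - 1) lap f and V f. The first of these is of order
  \<open>\<eta>\<^sup>2\<close> in second differences and is absorbed into half of N2; the second
  gives the term with N0.\<close>

lemma N2_le:
  assumes small: "24 * D * \<eta> ^ 4 \<le> 1"
  shows "N2 \<le> 6 * S (\<lambda>x. (symm_part x)\<^sup>2) + 96 * D\<^sup>2 * \<eta> ^ 4 * N0"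
proof -
  have f3: "supp_on (B 3) f" by (rule supp_mono[OF supp_f]) simp
  have V: "\<bar>V x\<bar> \<le> 4 * D * \<eta>\<^sup>2" if "x \<in> B 6" for x
  proof -
    have "\<bar>V x\<bar> \<le> (\<Sum>j\<in>(UNIV::'d set). 4 * \<eta>\<^sup>2)"
      unfolding V_def
    proof (rule order_trans[OF sum_abs sum_mono])
      show "\<bar>2 * (c j x - 1)\<bar> \<le> 4 * \<eta>\<^sup>2" for j using c_minus_1[OF B6_7[OF that], of j] by (simp add: abs_mult)
    qed
    then show ?thesis by (simp add: D_eq mult_ac)
  qed
  have "N2 = S (\<lambda>x. (\<Sum>j\<in>UNIV. lap (e j) f x)\<^sup>2)"
    unfolding N2_def S_sum_lap_square[OF f3] ..
  also have "\<dots> \<le> S (\<lambda>x. 3 * (symm_part x)\<^sup>2 + 12 * D * \<eta> ^ 4 * (\<Sum>j\<in>UNIV. (lap (e j) f x)\<^sup>2)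
     + 48 * D\<^sup>2 * \<eta> ^ 4 * (f x)\<^sup>2)"
  proof (rule sum_mono)
    fix x assume x: "x \<in> B 6"
    define R where "R = (\<Sum>j\<in>UNIV. (c j x - 1) * lap (e j) f x)"
    have "(\<Sum>j\<in>UNIV. lap (e j) f x) = symm_part x + - R + - (V x * f x)"
      unfolding symm_part_def R_def by (simp add: sum_subtractf left_diff_distrib)
    then have "(\<Sum>j\<in>UNIV. lap (e j) f x)\<^sup>2 \<le> 3 * (symm_part x)\<^sup>2 + 3 * R\<^sup>2 + 3 * (V x * f x)\<^sup>2"
      using square_add3_le[of "symm_part x" "- R" "- (V x * f x)"] by simp
    moreover have "R\<^sup>2 \<le> D * (\<Sum>j\<in>UNIV. (2 * \<eta>\<^sup>2)\<^sup>2 * (lap (e j) f x)\<^sup>2)"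
    proof (rule order_trans)
      show "R\<^sup>2 \<le> D * (\<Sum>j\<in>UNIV. ((c j x - 1) * lap (e j) f x)\<^sup>2)"
        unfolding R_def D_eq by (rule sum_square_le_card)
      have "(c j x - 1)\<^sup>2 \<le> (2 * \<eta>\<^sup>2)\<^sup>2" for j
        using c_minus_1[OF B6_7[OF x], of j] abs_le_square_iff[of "c j x - 1" "2 * \<eta>\<^sup>2"] by simp
      then show "D * (\<Sum>j\<in>UNIV. ((c j x - 1) * lap (e j) f x)\<^sup>2) \<le> D * (\<Sum>j\<in>UNIV. (2 * \<eta>\<^sup>2)\<^sup>2 * (lap (e j) f x)\<^sup>2)"
        using D_ge_1 unfolding power_mult_distrib[of "_ - 1"] by (intro mult_left_mono sum_mono mult_right_mono) auto
    qed
    moreover have "(V x * f x)\<^sup>2 \<le> (4 * D * \<eta>\<^sup>2)\<^sup>2 * (f x)\<^sup>2"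
    proof -
      have "(V x)\<^sup>2 \<le> (4 * D * \<eta>\<^sup>2)\<^sup>2"
        using V[OF x] abs_le_square_iff[of "V x" "4 * D * \<eta>\<^sup>2"] D_ge_1 by simp
      then show ?thesis unfolding power_mult_distrib[of "V x"] by (intro mult_right_mono) auto
    qed
    moreover have "3 * (D * (\<Sum>j\<in>UNIV. (2 * \<eta>\<^sup>2)\<^sup>2 * (lap (e j) f x)\<^sup>2)) =
        12 * D * \<eta> ^ 4 * (\<Sum>j\<in>UNIV. (lap (e j) f x)\<^sup>2)"
      by (simp add: sum_distrib_left[symmetric] power_mult_distrib flip: power_mult)
    moreover have "3 * ((4 * D * \<eta>\<^sup>2)\<^sup>2 * (f x)\<^sup>2) = 48 * D\<^sup>2 * \<eta> ^ 4 * (f x)\<^sup>2"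
      by (simp add: power_mult_distrib flip: power_mult)
    ultimately show "(\<Sum>j\<in>UNIV. lap (e j) f x)\<^sup>2 \<le> 3 * (symm_part x)\<^sup>2
      + 12 * D * \<eta> ^ 4 * (\<Sum>j\<in>UNIV. (lap (e j) f x)\<^sup>2) + 48 * D\<^sup>2 * \<eta> ^ 4 * (f x)\<^sup>2"
      by linarith
  qed
  also have "\<dots> = 3 * S (\<lambda>x. (symm_part x)\<^sup>2) + 12 * D * \<eta> ^ 4 * S (\<lambda>x. \<Sum>j\<in>UNIV. (lap (e j) f x)\<^sup>2)
     + 48 * D\<^sup>2 * \<eta> ^ 4 * N0"
    unfolding N0_def by (simp add: sum.distrib sum_distrib_left)
  also have "12 * D * \<eta> ^ 4 * S (\<lambda>x. \<Sum>j\<in>UNIV. (lap (e j) f x)\<^sup>2) \<le> 1 / 2 * N2"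
  proof -
    have "S (\<lambda>x. \<Sum>j\<in>UNIV. (lap (e j) f x)\<^sup>2) = (\<Sum>j\<in>UNIV. S (\<lambda>x. (fd (e j) (fd (e j) f) x)\<^sup>2))"
      unfolding S_lap_lap[OF f3, symmetric] unfolding power2_eq_square by (rule sum.swap)
    also have "\<dots> \<le> N2"
      unfolding N2_def by (intro sum_mono member_le_sum) (auto intro!: sum_nonneg)
    finally show ?thesis
      using small by (intro mult_mono) (auto intro!: sum_nonneg)
  qed
  finally show ?thesis by (simp add: algebra_simps)
qed

lemma energy_le:
  assumes small: "24 * D * \<eta> ^ 4 \<le> 1"
    and C1: "C1 = 12 + (96 * D\<^sup>2 + 1) / \<epsilon>"
    and small': "C1 * (850 * D\<^sup>2 * (D + 1)) * (\<eta> + h / \<eta>) \<le> 1 / 2"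
  shows "h * energy \<le> 2 * C1 * S (\<lambda>x. (symm_part x + anti_part x)\<^sup>2)"
proof -
  define P where "P = S (\<lambda>x. (symm_part x)\<^sup>2)"
  define W where "W = h * (\<eta> ^ 3 * N0 + \<eta> * N1)"
  define R where "R = S (\<lambda>x. (symm_part x + anti_part x)\<^sup>2)"
  have P: "0 \<le> P" unfolding P_def by (intro sum_nonneg) auto
  have W: "0 \<le> W" unfolding W_def using h eta_pos N_nonneg by auto
  have "h * (N2 / \<eta>) \<le> 6 * P + 96 * D\<^sup>2 * W"
  proof -
    have "h * (N2 / \<eta>) = h / \<eta> * N2" by simp
    also have "\<dots> \<le> h / \<eta> * (6 * P + 96 * D\<^sup>2 * \<eta> ^ 4 * N0)"
      unfolding P_def using N2_le[OF small] h eta_pos by (intro mult_left_mono) auto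
    also have "\<dots> = 6 * (h / \<eta> * P) + 96 * D\<^sup>2 * (h * (\<eta> ^ 3 * N0))"
      using eta_pos by (simp add: algebra_simps eval_nat_numeral)
    also have "\<dots> \<le> 6 * (1 * P) + 96 * D\<^sup>2 * W"
    proof -
      have "h / \<eta> * P \<le> 1 * P" using h eta_pos P by (intro mult_right_mono) auto
      moreover have "96 * D\<^sup>2 * (h * (\<eta> ^ 3 * N0)) \<le> 96 * D\<^sup>2 * W"
        unfolding W_def using h eta_pos N_nonneg by (intro mult_left_mono) auto
      ultimately show ?thesis by linarith
    qed
    finally show ?thesis by simp
  qed
  moreover have "h * energy = W + h * (N2 / \<eta>)" unfolding energy_def W_def by (simp add: algebra_simps)
  ultimately have "h * energy \<le> 6 * P + (96 * D\<^sup>2 + 1) * W" by (simp add: algebra_simps)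
  \<comment> \<open>C1 is the sum of the two factors wanted here: 12 turns P / 2 into 6 P, and (96
    D^2 + 1) / \<epsilon> turns \<epsilon> W into (96 D^2 + 1) W.\<close>
  also have "\<dots> \<le> C1 * (P / 2) + C1 * (\<epsilon> * W)"
  proof -
    have "12 * (P / 2) \<le> C1 * (P / 2)"
      unfolding C1 using P eps by (intro mult_right_mono) auto
    moreover have "((96 * D\<^sup>2 + 1) / \<epsilon>) * (\<epsilon> * W) \<le> C1 * (\<epsilon> * W)"
      unfolding C1 using W eps by (intro mult_right_mono) auto
    moreover have "((96 * D\<^sup>2 + 1) / \<epsilon>) * (\<epsilon> * W) = (96 * D\<^sup>2 + 1) * W" using eps by simp
    ultimately show ?thesis by linarith
  qed
  also have "\<dots> = C1 * (P / 2 + \<epsilon> * W)" by (simp add: algebra_simps)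
  also have "\<dots> \<le> C1 * (R + 850 * D\<^sup>2 * (D + 1) * (h * (\<eta> + h / \<eta>)) * energy)"
  proof (rule mult_left_mono)
    show "P / 2 + \<epsilon> * W \<le> R + 850 * D\<^sup>2 * (D + 1) * (h * (\<eta> + h / \<eta>)) * energy"
      using energy_symm_part_le unfolding P_def W_def R_def by (simp add: mult.assoc)
    show "0 \<le> C1" unfolding C1 using eps by simp
  qed
  also have "\<dots> = C1 * R + C1 * (850 * D\<^sup>2 * (D + 1)) * (\<eta> + h / \<eta>) * (h * energy)"
    by (simp add: algebra_simps)
  also have "\<dots> \<le> C1 * R + 1 / 2 * (h * energy)"
    using small' h energy_nonneg by (intro add_left_mono mult_right_mono) auto
  finally show ?thesis unfolding R_def by simp
qed

end

section \<open>Returning to the unconjugated operators\<close>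

lemma abs_exp_diff_le:
  fixes a b :: real
  assumes "\<bar>a\<bar> \<le> 2" "\<bar>b\<bar> \<le> 2"
  shows "\<bar>exp a - exp b\<bar> \<le> 9 * \<bar>a - b\<bar>"
proof -
  have "exp (2::real) = exp 1 * exp 1" by (simp flip: exp_add)
  also have "\<dots> \<le> 3 * 3" using exp_le by (intro mult_mono) auto
  finally have e2: "exp (2::real) \<le> 9" by simp
  have "norm (exp a - exp b) \<le> 9 * norm (a - b)"
  proof (rule field_differentiable_bound[where S = "{-2..2}" and f' = exp])
    show "norm (exp z) \<le> 9" if "z \<in> {-2..2}" for z :: real
      using that e2 order_trans[of "exp z" "exp 2" 9] by simp
    show "(exp has_field_derivative exp z) (at z within {-2..2})" for z :: real
      by (auto intro!: derivative_eq_intros)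
  qed (use assms in auto)
  then show ?thesis by simp
qed

definition sdiff :: "('d::finite \<Rightarrow> 'a::ab_group_add) \<Rightarrow> ('a \<Rightarrow> real) \<Rightarrow> 'a \<Rightarrow> real" where
  "sdiff e u x = 1 / 2 * (\<Sum>j\<in>UNIV. cd (e j) u x)"

context lattice_layers
begin

lemma S_square_shift:
  assumes "supp_on (B 4) g"
  shows "S (\<lambda>x. (g (x + e j))\<^sup>2) = S (\<lambda>x. (g x)\<^sup>2)"
    and "S (\<lambda>x. (g (x - e j))\<^sup>2) = S (\<lambda>x. (g x)\<^sup>2)"
proof -
  have "supp_on (B 4) (\<lambda>x. (g x)\<^sup>2)" using assms unfolding supp_on_def by auto
  then show "S (\<lambda>x. (g (x + e j))\<^sup>2) = S (\<lambda>x. (g x)\<^sup>2)" "S (\<lambda>x. (g (x - e j))\<^sup>2) = S (\<lambda>x. (g x)\<^sup>2)"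
    using S_shift[of "\<lambda>x. (g x)\<^sup>2" j] S_shift_diff[of "\<lambda>x. (g x)\<^sup>2" j] supp_mono[of 4 _ 5] by auto
qed

lemma S_cd_square_le:
  assumes "supp_on (B 3) g"
  shows "S (\<lambda>x. (cd (e j) g x)\<^sup>2) \<le> 4 * S (\<lambda>x. (fd (e j) g x)\<^sup>2)"
proof -
  have "(cd (e j) g x)\<^sup>2 \<le> 2 * (fd (e j) g x)\<^sup>2 + 2 * (fd (e j) g (x - e j))\<^sup>2" for x
  proof -
    have "cd (e j) g x = fd (e j) g x + fd (e j) g (x - e j)"
      unfolding cd_def fd_def by simp
    then show ?thesis using sum_squares_bound[of "fd (e j) g x" "fd (e j) g (x - e j)"]
      by (simp add: power2_sum)
  qed
  then have "S (\<lambda>x. (cd (e j) g x)\<^sup>2) \<le> S (\<lambda>x. 2 * (fd (e j) g x)\<^sup>2 + 2 * (fd (e j) g (x - e j))\<^sup>2)"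
    by (intro sum_mono)
  also have "\<dots> = 4 * S (\<lambda>x. (fd (e j) g x)\<^sup>2)"
    using S_square_shift(2)[of "fd (e j) g" j] supp_fd[OF assms, of j]
    by (simp add: sum.distrib sum_distrib_left[symmetric])
  finally show ?thesis .
qed

end

text \<open>The weight is seen only through its increments over one lattice step: a first order
  expansion with a remainder \<open>h * \<eta>\<close> of order \<tau> h^2, in both directions
  because both shifts occur in the operators.\<close>

locale carleman_weighted = carleman_coefficients B e p H Q f h \<eta> \<epsilon> D
  for B :: "nat \<Rightarrow> 'a::ab_group_add set" and e :: "'d::finite \<Rightarrow> 'a" and p H Q f h \<eta> \<epsilon> D +
  fixes \<Phi> u :: "'a \<Rightarrow> real"
  assumes f_eq: "f x = exp (\<Phi> x) * u x"
    and weight_add: "x \<in> B 7 \<Longrightarrow> \<bar>\<Phi> (x + e j) - \<Phi> x - \<eta> * p j x\<bar> \<le> h * \<eta>"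
    and weight_diff: "x \<in> B 7 \<Longrightarrow> \<bar>\<Phi> (x - e j) - \<Phi> x + \<eta> * p j x\<bar> \<le> h * \<eta>"
begin

section \<open>Exponential factors of the conjugated shifts\<close>

definition ap where "ap j x = exp (\<Phi> x - \<Phi> (x + e j))"
definition am where "am j x = exp (\<Phi> x - \<Phi> (x - e j))"

lemma conj_shift:
  assumes "\<And>x. g x = exp (\<Phi> x) * v x"
  shows "exp (\<Phi> x) * v (x + e j) = ap j x * g (x + e j)"
    and "exp (\<Phi> x) * v (x - e j) = am j x * g (x - e j)"
  unfolding ap_def am_def assms by (simp_all flip: mult.assoc exp_add)

lemma weight_le:
  assumes "x \<in> B 7"
  shows "\<bar>\<Phi> x - \<Phi> (x + e j)\<bar> \<le> 2 * \<eta>" "\<bar>\<Phi> x - \<Phi> (x - e j)\<bar> \<le> 2 * \<eta>"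
proof -
  have "h * \<eta> \<le> 1 * \<eta>" using h by (intro mult_right_mono) auto
  moreover have "\<bar>\<eta> * p j x\<bar> \<le> \<eta>" using b_le[OF assms, of j] unfolding b_def .
  ultimately show "\<bar>\<Phi> x - \<Phi> (x + e j)\<bar> \<le> 2 * \<eta>" "\<bar>\<Phi> x - \<Phi> (x - e j)\<bar> \<le> 2 * \<eta>"
    using weight_add[OF assms, of j] weight_diff[OF assms, of j] by linarith+
qed

lemma ap_am_exp:
  assumes "x \<in> B 7"
  shows "\<bar>ap j x - exp (- b j x)\<bar> \<le> 9 * (h * \<eta>)" "\<bar>am j x - exp (b j x)\<bar> \<le> 9 * (h * \<eta>)"
proof -
  note w = weight_le[OF assms, of j] and b = b_le[OF assms, of j]
  have "\<bar>ap j x - exp (- b j x)\<bar> \<le> 9 * \<bar>\<Phi> x - \<Phi> (x + e j) - (- b j x)\<bar>"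
    unfolding ap_def by (rule abs_exp_diff_le) (use w b h in linarith)+
  also have "\<dots> \<le> 9 * (h * \<eta>)"
    using weight_add[OF assms, of j] unfolding b_def by (intro mult_left_mono) linarith+
  finally show "\<bar>ap j x - exp (- b j x)\<bar> \<le> 9 * (h * \<eta>)" .
  have "\<bar>am j x - exp (b j x)\<bar> \<le> 9 * \<bar>\<Phi> x - \<Phi> (x - e j) - b j x\<bar>"
    unfolding am_def by (rule abs_exp_diff_le) (use w b h in linarith)+
  also have "\<dots> \<le> 9 * (h * \<eta>)"
    using weight_diff[OF assms, of j] unfolding b_def by (intro mult_left_mono) linarith+
  finally show "\<bar>am j x - exp (b j x)\<bar> \<le> 9 * (h * \<eta>)" .
qed

lemma ap_am_1:
  assumes "x \<in> B 7"
  shows "\<bar>ap j x - 1\<bar> \<le> 18 * \<eta>" "\<bar>am j x - 1\<bar> \<le> 18 * \<eta>"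
proof -
  note w = weight_le[OF assms, of j]
  have "\<bar>ap j x - exp 0\<bar> \<le> 9 * \<bar>\<Phi> x - \<Phi> (x + e j) - 0\<bar>"
    unfolding ap_def by (rule abs_exp_diff_le) (use w h in linarith)+
  then show "\<bar>ap j x - 1\<bar> \<le> 18 * \<eta>" using w by simp
  have "\<bar>am j x - exp 0\<bar> \<le> 9 * \<bar>\<Phi> x - \<Phi> (x - e j) - 0\<bar>"
    unfolding am_def by (rule abs_exp_diff_le) (use w h in linarith)+
  then show "\<bar>am j x - 1\<bar> \<le> 18 * \<eta>" using w by simp
qed

text \<open>The exponent changes by the increment of b plus two Taylor remainders, all of order
  \<open>h * \<eta>\<close>. This is relaxed to \<open>\<eta>\<^sup>2\<close>, whose square matches
  the term \<open>\<eta> ^ 4 * N0\<close> in \<open>fd_conj_sdiff_le\<close>.\<close>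

lemma fd_ap_am:
  assumes "x \<in> B 6"
  shows "\<bar>fd (e l) (ap j) x\<bar> \<le> 36 * \<eta>\<^sup>2" "\<bar>fd (e l) (am j) x\<bar> \<le> 36 * \<eta>\<^sup>2"
proof -
  note x = B6_7[OF assms] B6_add[OF assms, of l]
  note w = weight_le[OF x(1), of j] weight_le[OF x(2), of j]
  have he: "h * \<eta> \<le> \<eta>\<^sup>2" using h by (simp add: power2_eq_square)
  note bb = fd_b_le[OF assms, of j l, unfolded b_def]
  have "\<bar>ap j (x + e l) - ap j x\<bar> \<le> 9 * \<bar>(\<Phi> (x + e l) - \<Phi> (x + e l + e j)) - (\<Phi> x - \<Phi> (x + e j))\<bar>"
    unfolding ap_def by (rule abs_exp_diff_le) (use w h in linarith)+
  also have "\<dots> \<le> 9 * (4 * \<eta>\<^sup>2)"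
    using weight_add[OF x(1), of j] weight_add[OF x(2), of j] bb he by (intro mult_left_mono) linarith+
  finally show "\<bar>fd (e l) (ap j) x\<bar> \<le> 36 * \<eta>\<^sup>2" unfolding fd_def by simp
  have "\<bar>am j (x + e l) - am j x\<bar> \<le> 9 * \<bar>(\<Phi> (x + e l) - \<Phi> (x + e l - e j)) - (\<Phi> x - \<Phi> (x - e j))\<bar>"
    unfolding am_def by (rule abs_exp_diff_le) (use w h in linarith)+
  also have "\<dots> \<le> 9 * (4 * \<eta>\<^sup>2)"
    using weight_diff[OF x(1), of j] weight_diff[OF x(2), of j] bb he by (intro mult_left_mono) linarith+
  finally show "\<bar>fd (e l) (am j) x\<bar> \<le> 36 * \<eta>\<^sup>2" unfolding fd_def by simp
qed

text \<open>If the exponents are replaced by their linear parts, the conjugated Laplacian becomes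
  exactly \<open>symm_part\<close> plus \<open>anti_part\<close>, as exp (- b) = cosh b - sinh b and
  exp b = cosh b + sinh b. The functions \<open>r\<close> collect the error of this
  replacement.\<close>

lemma conj_laplacian_error:
  "S (\<lambda>x. (symm_part x + anti_part x)\<^sup>2) \<le>
    2 * S (\<lambda>x. (exp (\<Phi> x) * (\<Sum>j\<in>UNIV. lap (e j) u x))\<^sup>2) + 648 * D\<^sup>2 * (h * \<eta>)\<^sup>2 * N0"
proof -
  have f4: "supp_on (B 4) f" by (rule supp_mono[OF supp_f]) simp
  define L where "L x = exp (\<Phi> x) * (\<Sum>j\<in>UNIV. lap (e j) u x)" for x
  have "S (\<lambda>x. (symm_part x + anti_part x)\<^sup>2) \<le>
     S (\<lambda>x. 2 * (L x)\<^sup>2 + 324 * D * (h * \<eta>)\<^sup>2 * (\<Sum>j\<in>UNIV. (f (x + e j))\<^sup>2 + (f (x - e j))\<^sup>2))"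
  proof (rule sum_mono)
    fix x assume "x \<in> B 6"
    then have x: "x \<in> B 7" by (rule B6_7)
    define r where "r j = (exp (- b j x) - ap j x) * f (x + e j) + (exp (b j x) - am j x) * f (x - e j)" for j
    have "L x = (\<Sum>j\<in>UNIV. ap j x * f (x + e j) + am j x * f (x - e j) - 2 * f x)"
      unfolding L_def sum_distrib_left lap_def right_diff_distrib distrib_left
        conj_shift[of f u, OF f_eq] by (simp add: f_eq mult_ac)
    moreover have "symm_part x + anti_part x =
        (\<Sum>j\<in>UNIV. exp (- b j x) * f (x + e j) + exp (b j x) * f (x - e j) - 2 * f x)"
    proof -
      have "symm_part x + anti_part x =
        (\<Sum>j\<in>UNIV. c j x * lap (e j) f x + 2 * (c j x - 1) * f x - s j x * cd (e j) f x)"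
        unfolding symm_part_def anti_part_def V_def sum_distrib_right
        by (simp add: sum.distrib sum_subtractf)
      also have "\<dots> = (\<Sum>j\<in>UNIV. exp (- b j x) * f (x + e j) + exp (b j x) * f (x - e j) - 2 * f x)"
      proof (intro sum.cong refl)
        fix j
        have ex: "exp (- b j x) = c j x - s j x" "exp (b j x) = c j x + s j x"
          unfolding c_def s_def by (simp_all only: cosh_minus_sinh cosh_plus_sinh)
        show "c j x * lap (e j) f x + 2 * (c j x - 1) * f x - s j x * cd (e j) f x =
          exp (- b j x) * f (x + e j) + exp (b j x) * f (x - e j) - 2 * f x"
          unfolding ex lap_def cd_def by (simp add: algebra_simps)
      qed
      finally show ?thesis .
    qed
    ultimately have "symm_part x + anti_part x = L x + (\<Sum>j\<in>UNIV. r j)"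
      unfolding r_def by (simp add: sum.distrib[symmetric] algebra_simps)
    then have "(symm_part x + anti_part x)\<^sup>2 \<le> 2 * (L x)\<^sup>2 + 2 * (\<Sum>j\<in>UNIV. r j)\<^sup>2"
      using square_add_le[of "L x" "\<Sum>j\<in>UNIV. r j"] by simp
    also have "(\<Sum>j\<in>UNIV. r j)\<^sup>2 \<le> D * (\<Sum>j\<in>UNIV. (r j)\<^sup>2)"
      unfolding D_eq by (rule sum_square_le_card)
    also have "\<dots> \<le> D * (162 * (h * \<eta>)\<^sup>2 * (\<Sum>j\<in>UNIV. (f (x + e j))\<^sup>2 + (f (x - e j))\<^sup>2))"
      unfolding sum_distrib_left[of "162 * (h * \<eta>)\<^sup>2"]
    proof (intro mult_left_mono sum_mono)
      fix j
      have sq: "a\<^sup>2 \<le> (9 * (h * \<eta>))\<^sup>2" if "\<bar>a\<bar> \<le> 9 * (h * \<eta>)" for a :: real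
        using abs_le_square_iff[of a "9 * (h * \<eta>)"] that h by simp
      have "(r j)\<^sup>2 \<le> 2 * ((exp (- b j x) - ap j x)\<^sup>2 * (f (x + e j))\<^sup>2)
          + 2 * ((exp (b j x) - am j x)\<^sup>2 * (f (x - e j))\<^sup>2)"
        unfolding r_def power_mult_distrib[symmetric] by (rule square_add_le)
      also have "\<dots> \<le> 2 * ((9 * (h * \<eta>))\<^sup>2 * (f (x + e j))\<^sup>2) + 2 * ((9 * (h * \<eta>))\<^sup>2 * (f (x - e j))\<^sup>2)"
        using ap_am_exp[OF x, of j]
        by (intro add_mono mult_left_mono mult_right_mono sq) (auto simp: abs_minus_commute)
      also have "\<dots> = 162 * (h * \<eta>)\<^sup>2 * ((f (x + e j))\<^sup>2 + (f (x - e j))\<^sup>2)"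
        by (simp add: power_mult_distrib algebra_simps)
      finally show "(r j)\<^sup>2 \<le> 162 * (h * \<eta>)\<^sup>2 * ((f (x + e j))\<^sup>2 + (f (x - e j))\<^sup>2)" .
    qed (use D_ge_1 in simp)
    finally have "(symm_part x + anti_part x)\<^sup>2 \<le> 2 * (L x)\<^sup>2
       + 2 * (D * (162 * (h * \<eta>)\<^sup>2 * (\<Sum>j\<in>UNIV. (f (x + e j))\<^sup>2 + (f (x - e j))\<^sup>2)))"
      by simp
    moreover have "2 * (D * (162 * k * Z)) = 324 * D * k * Z" for k Z :: real by simp
    ultimately show "(symm_part x + anti_part x)\<^sup>2 \<le> 2 * (L x)\<^sup>2
       + 324 * D * (h * \<eta>)\<^sup>2 * (\<Sum>j\<in>UNIV. (f (x + e j))\<^sup>2 + (f (x - e j))\<^sup>2)"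
      by metis
  qed
  also have "\<dots> = 2 * S (\<lambda>x. (L x)\<^sup>2)
     + 324 * D * (h * \<eta>)\<^sup>2 * (\<Sum>j\<in>UNIV. S (\<lambda>x. (f (x + e j))\<^sup>2) + S (\<lambda>x. (f (x - e j))\<^sup>2))"
    unfolding sum.distrib[of _ _ "B 6"] sum_distrib_left[symmetric]
    by (intro arg_cong2[where f = "(+)"] arg_cong2[where f = "(*)"] refl)
      (subst sum.swap, simp add: sum.distrib)
  also have "\<dots> = 2 * S (\<lambda>x. (L x)\<^sup>2) + 648 * D\<^sup>2 * (h * \<eta>)\<^sup>2 * N0"
    unfolding S_square_shift[OF f4] N0_def by (simp add: D_eq[symmetric] power2_eq_square)
  finally show ?thesis unfolding L_def .
qed

lemma energy_le_conj_laplacian: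
  assumes small: "24 * D * \<eta> ^ 4 \<le> 1"
    and C1: "C1 = 12 + (96 * D\<^sup>2 + 1) / \<epsilon>"
    and small': "C1 * (850 * D\<^sup>2 * (D + 1)) * (\<eta> + h / \<eta>) \<le> 1 / 2"
  shows "h * energy \<le> 8 * C1 * S (\<lambda>x. (exp (\<Phi> x) * (\<Sum>j\<in>UNIV. lap (e j) u x))\<^sup>2)"
proof -
  define L where "L = S (\<lambda>x. (exp (\<Phi> x) * (\<Sum>j\<in>UNIV. lap (e j) u x))\<^sup>2)"
  have C1_pos: "0 \<le> C1" unfolding C1 using eps by simp
  have N0: "\<eta> ^ 3 * N0 \<le> energy"
    unfolding energy_def using N_nonneg eta_pos by auto
  have "h * energy \<le> 2 * C1 * (2 * L + 648 * D\<^sup>2 * (h * \<eta>)\<^sup>2 * N0)"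
    using C1_pos conj_laplacian_error unfolding L_def
    by (intro order_trans[OF energy_le[OF assms]] mult_left_mono) auto
  also have "\<dots> = 4 * C1 * L + 1296 * C1 * D\<^sup>2 * (h / \<eta>) * h * (\<eta> ^ 3 * N0)"
    using eta_pos by (simp add: power_mult_distrib power2_eq_square power3_eq_cube algebra_simps)
  also have "\<dots> \<le> 4 * C1 * L + 1296 * C1 * D\<^sup>2 * (h / \<eta>) * h * energy"
    using N0 C1_pos h eta_pos by (intro add_left_mono mult_left_mono) auto
  \<comment> \<open>This error is covered by \<open>small'\<close> as well, because D + 1 \<ge> 2
    and 1296 \<le> 850 * 2.\<close>
  also have "1296 * C1 * D\<^sup>2 * (h / \<eta>) * h * energy \<le> 1 / 2 * (h * energy)"
  proof -
    have "C1 * (850 * D\<^sup>2 * 2) * (h / \<eta>) \<le> C1 * (850 * D\<^sup>2 * (D + 1)) * (\<eta> + h / \<eta>)"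
      using C1_pos D_ge_1 h eta_pos by (intro mult_mono mult_nonneg_nonneg) auto
    moreover have "1296 * C1 * D\<^sup>2 * (h / \<eta>) \<le> C1 * (850 * D\<^sup>2 * 2) * (h / \<eta>)"
    proof -
      have "1296 * (C1 * D\<^sup>2 * (h / \<eta>)) \<le> 1700 * (C1 * D\<^sup>2 * (h / \<eta>))"
        using C1_pos h eta_pos by (intro mult_right_mono) auto
      then show ?thesis by (simp only: mult_ac)
    qed
    ultimately have "1296 * C1 * D\<^sup>2 * (h / \<eta>) \<le> 1 / 2" using small' by linarith
    then have "1296 * C1 * D\<^sup>2 * (h / \<eta>) * (h * energy) \<le> 1 / 2 * (h * energy)"
      using h energy_nonneg by (intro mult_right_mono) auto
    then show ?thesis by (simp add: mult.assoc)
  qed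
  finally show ?thesis unfolding L_def by simp
qed

section \<open>Weighted symmetric differences\<close>

lemma conj_sdiff_eq:
  assumes "\<And>x. g x = exp (\<Phi> x) * v x"
  shows "exp (\<Phi> x) * sdiff e v x =
    1 / 2 * (\<Sum>j\<in>UNIV. cd (e j) g x + (ap j x - 1) * g (x + e j) - (am j x - 1) * g (x - e j))"
proof -
  have "exp (\<Phi> x) * sdiff e v x = 1 / 2 * (\<Sum>j\<in>UNIV. ap j x * g (x + e j) - am j x * g (x - e j))"
    unfolding sdiff_def cd_def conj_shift[of g v, OF assms, symmetric]
    by (simp add: sum_distrib_left right_diff_distrib)
  then show ?thesis unfolding cd_def by (simp add: algebra_simps)
qed

lemma supp_conj_sdiff:
  assumes "\<And>x. g x = exp (\<Phi> x) * v x" "supp_on (B m) g"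
  shows "supp_on (B (Suc m)) (\<lambda>x. exp (\<Phi> x) * sdiff e v x)"
  unfolding supp_on_def
proof (intro allI impI)
  fix x assume nz: "exp (\<Phi> x) * sdiff e v x \<noteq> 0"
  show "x \<in> B (Suc m)"
  proof (rule ccontr)
    assume "x \<notin> B (Suc m)"
    then have "g (x + e j) = 0" "g (x - e j) = 0" for j
      using supp_add[OF assms(2), of j] supp_diff[OF assms(2), of j] unfolding supp_on_def by blast+
    then have "v (x + e j) = 0" "v (x - e j) = 0" for j unfolding assms(1) by auto
    then show False using nz unfolding sdiff_def cd_def by simp
  qed
qed

text \<open>Stated for a general pair because it is used twice: for v = u, and for v =
  \<open>sdiff e u\<close> to reach the second order norm. The conjugation factors are 1 up to order
  \<eta>, which produces the term without differences.\<close>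

lemma conj_sdiff_le:
  assumes g: "\<And>x. g x = exp (\<Phi> x) * v x" and supp: "supp_on (B 3) g"
  shows "S (\<lambda>x. (exp (\<Phi> x) * sdiff e v x)\<^sup>2) \<le>
    3 * D * (\<Sum>j\<in>UNIV. S (\<lambda>x. (fd (e j) g x)\<^sup>2)) + 648 * D\<^sup>2 * \<eta>\<^sup>2 * S (\<lambda>x. (g x)\<^sup>2)"
proof -
  have g4: "supp_on (B 4) g" by (rule supp_mono[OF supp]) simp
  have "S (\<lambda>x. (exp (\<Phi> x) * sdiff e v x)\<^sup>2) \<le> S (\<lambda>x. D / 4 * (\<Sum>j\<in>UNIV. 3 * (cd (e j) g x)\<^sup>2
      + 3 * ((18 * \<eta>)\<^sup>2 * (g (x + e j))\<^sup>2) + 3 * ((18 * \<eta>)\<^sup>2 * (g (x - e j))\<^sup>2)))"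
  proof (rule sum_mono)
    fix x assume "x \<in> B 6"
    then have x: "x \<in> B 7" by (rule B6_7)
    define r where "r j = cd (e j) g x + (ap j x - 1) * g (x + e j) + - ((am j x - 1) * g (x - e j))" for j
    have "(exp (\<Phi> x) * sdiff e v x)\<^sup>2 = 1 / 4 * (\<Sum>j\<in>UNIV. r j)\<^sup>2"
      unfolding conj_sdiff_eq[of g v, OF g] r_def by (simp add: power_divide)
    also have "\<dots> \<le> 1 / 4 * (D * (\<Sum>j\<in>UNIV. (r j)\<^sup>2))"
      unfolding D_eq by (intro mult_left_mono sum_square_le_card) auto
    also have "\<dots> = D / 4 * (\<Sum>j\<in>UNIV. (r j)\<^sup>2)" by simp
    also have "\<dots> \<le> D / 4 * (\<Sum>j\<in>UNIV. 3 * (cd (e j) g x)\<^sup>2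
      + 3 * ((18 * \<eta>)\<^sup>2 * (g (x + e j))\<^sup>2) + 3 * ((18 * \<eta>)\<^sup>2 * (g (x - e j))\<^sup>2))"
    proof (intro mult_left_mono sum_mono)
      fix j
      have "(r j)\<^sup>2 \<le> 3 * (cd (e j) g x)\<^sup>2 + 3 * ((ap j x - 1)\<^sup>2 * (g (x + e j))\<^sup>2)
          + 3 * ((am j x - 1)\<^sup>2 * (g (x - e j))\<^sup>2)"
        unfolding r_def power_mult_distrib[symmetric] power2_minus[of "(am j x - 1) * g (x - e j)", symmetric]
        by (rule square_add3_le)
      also have "\<dots> \<le> 3 * (cd (e j) g x)\<^sup>2
      + 3 * ((18 * \<eta>)\<^sup>2 * (g (x + e j))\<^sup>2) + 3 * ((18 * \<eta>)\<^sup>2 * (g (x - e j))\<^sup>2)"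
        by (intro add_mono mult_left_mono mult_right_mono square_bound ap_am_1 x order_refl) auto
      finally show "(r j)\<^sup>2 \<le> 3 * (cd (e j) g x)\<^sup>2
      + 3 * ((18 * \<eta>)\<^sup>2 * (g (x + e j))\<^sup>2) + 3 * ((18 * \<eta>)\<^sup>2 * (g (x - e j))\<^sup>2)" .
    qed (use D_ge_1 in simp)
    finally show "(exp (\<Phi> x) * sdiff e v x)\<^sup>2 \<le> D / 4 * (\<Sum>j\<in>UNIV. 3 * (cd (e j) g x)\<^sup>2
      + 3 * ((18 * \<eta>)\<^sup>2 * (g (x + e j))\<^sup>2) + 3 * ((18 * \<eta>)\<^sup>2 * (g (x - e j))\<^sup>2))" .
  qed
  also have "\<dots> = D / 4 * (\<Sum>j\<in>UNIV. S (\<lambda>x. 3 * (cd (e j) g x)\<^sup>2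
      + 3 * ((18 * \<eta>)\<^sup>2 * (g (x + e j))\<^sup>2) + 3 * ((18 * \<eta>)\<^sup>2 * (g (x - e j))\<^sup>2)))"
    unfolding sum_distrib_left[symmetric] by (subst sum.swap) (rule refl)
  also have "\<dots> \<le> D / 4 * (\<Sum>j\<in>UNIV. 12 * S (\<lambda>x. (fd (e j) g x)\<^sup>2) + 1944 * \<eta>\<^sup>2 * S (\<lambda>x. (g x)\<^sup>2))"
  proof (intro mult_left_mono sum_mono)
    fix j
    show "S (\<lambda>x. 3 * (cd (e j) g x)\<^sup>2
      + 3 * ((18 * \<eta>)\<^sup>2 * (g (x + e j))\<^sup>2) + 3 * ((18 * \<eta>)\<^sup>2 * (g (x - e j))\<^sup>2))
      \<le> 12 * S (\<lambda>x. (fd (e j) g x)\<^sup>2) + 1944 * \<eta>\<^sup>2 * S (\<lambda>x. (g x)\<^sup>2)"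
      unfolding sum.distrib sum_distrib_left[symmetric] S_square_shift[OF g4]
      using S_cd_square_le[OF supp, of j] by (simp add: power_mult_distrib)
  qed (use D_ge_1 in simp)
  also have "\<dots> = 3 * D * (\<Sum>j\<in>UNIV. S (\<lambda>x. (fd (e j) g x)\<^sup>2)) + 486 * D\<^sup>2 * \<eta>\<^sup>2 * S (\<lambda>x. (g x)\<^sup>2)"
    by (simp add: sum.distrib sum_distrib_left[symmetric] D_eq[symmetric] power2_eq_square algebra_simps)
  also have "\<dots> \<le> 3 * D * (\<Sum>j\<in>UNIV. S (\<lambda>x. (fd (e j) g x)\<^sup>2)) + 648 * D\<^sup>2 * \<eta>\<^sup>2 * S (\<lambda>x. (g x)\<^sup>2)"
    by (intro add_left_mono mult_right_mono sum_nonneg) auto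
  finally show ?thesis .
qed

text \<open>Bounds the gradient term that arises in the second use of \<open>conj_sdiff_le\<close>.
  By the product rule the difference falls on f or on the factors \<open>ap\<close> and
  \<open>am\<close>, whose increments are of order \<open>\<eta>\<^sup>2\<close>.\<close>

lemma fd_conj_sdiff_le:
  "(\<Sum>l\<in>UNIV. S (\<lambda>x. (fd (e l) (\<lambda>x. exp (\<Phi> x) * sdiff e u x) x)\<^sup>2)) \<le>
    3 * D * N2 + 972 * D\<^sup>2 * \<eta>\<^sup>2 * N1 + 3888 * D ^ 3 * \<eta> ^ 4 * N0"
proof -
  have f3: "supp_on (B 3) f" and f4: "supp_on (B 4) f" by (rule supp_mono[OF supp_f], simp)+
  have df3: "supp_on (B 3) (fd (e l) f)" and df4: "supp_on (B 4) (fd (e l) f)" for l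
    by (rule supp_mono[OF supp_fd[OF supp_f]], simp)+
  have shift2: "S (\<lambda>x. (f (x + e l + e j))\<^sup>2) = N0" "S (\<lambda>x. (f (x + e l - e j))\<^sup>2) = N0" for j l
  proof -
    have s1: "supp_on (B 4) (\<lambda>x. f (x + e j))"
      by (rule supp_mono[OF supp_add[OF supp_f]]) simp
    have s2: "supp_on (B 4) (\<lambda>x. f (x - e j))"
      by (rule supp_mono[OF supp_diff[OF supp_f]]) simp
    show "S (\<lambda>x. (f (x + e l + e j))\<^sup>2) = N0" "S (\<lambda>x. (f (x + e l - e j))\<^sup>2) = N0"
      unfolding S_square_shift(1)[OF s1, of l] S_square_shift(1)[OF s2, of l] S_square_shift[OF f4] N0_def
      by (rule refl)+
  qed
  have fd_le: "S (\<lambda>x. (fd (e l) (\<lambda>x. exp (\<Phi> x) * sdiff e u x) x)\<^sup>2) \<le>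
     3 * D * (\<Sum>j\<in>UNIV. S (\<lambda>x. (fd (e j) (fd (e l) f) x)\<^sup>2)) + 972 * D\<^sup>2 * \<eta>\<^sup>2 * S (\<lambda>x. (fd (e l) f x)\<^sup>2)
     + 3888 * D\<^sup>2 * \<eta> ^ 4 * N0" for l
  proof -
    define U where "U j x = 3 * (cd (e j) (fd (e l) f) x)\<^sup>2
      + 3 * (2 * ((36 * \<eta>\<^sup>2)\<^sup>2 * (f (x + e l + e j))\<^sup>2) + 2 * ((18 * \<eta>)\<^sup>2 * (fd (e l) f (x + e j))\<^sup>2))
      + 3 * (2 * ((36 * \<eta>\<^sup>2)\<^sup>2 * (f (x + e l - e j))\<^sup>2) + 2 * ((18 * \<eta>)\<^sup>2 * (fd (e l) f (x - e j))\<^sup>2))" for j x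
    have "S (\<lambda>x. (fd (e l) (\<lambda>x. exp (\<Phi> x) * sdiff e u x) x)\<^sup>2) \<le> S (\<lambda>x. D / 4 * (\<Sum>j\<in>UNIV. U j x))"
    proof (rule sum_mono)
      fix x assume x6: "x \<in> B 6"
      then have x: "x \<in> B 7" by (rule B6_7)
      define t1 where "t1 j = fd (e l) (ap j) x * f (x + e l + e j) + (ap j x - 1) * fd (e l) f (x + e j)" for j
      define t2 where "t2 j = fd (e l) (am j) x * f (x + e l - e j) + (am j x - 1) * fd (e l) f (x - e j)" for j
      have "fd (e l) (\<lambda>x. exp (\<Phi> x) * sdiff e u x) x =
          1 / 2 * (\<Sum>j\<in>UNIV. cd (e j) (fd (e l) f) x + t1 j + - t2 j)"
        unfolding conj_sdiff_eq[of f u, OF f_eq] t1_def t2_def unfolding fd_def cd_def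
          right_diff_distrib[symmetric] sum_subtractf[symmetric]
        by (intro arg_cong[where f = "\<lambda>y. 1 / 2 * y"] sum.cong refl) (simp add: algebra_simps)
      then have "(fd (e l) (\<lambda>x. exp (\<Phi> x) * sdiff e u x) x)\<^sup>2 =
          1 / 4 * (\<Sum>j\<in>UNIV. cd (e j) (fd (e l) f) x + t1 j + - t2 j)\<^sup>2"
        by (simp only: power_mult_distrib) (simp add: power2_eq_square)
      also have "\<dots> \<le> 1 / 4 * (D * (\<Sum>j\<in>UNIV. (cd (e j) (fd (e l) f) x + t1 j + - t2 j)\<^sup>2))"
        unfolding D_eq by (intro mult_left_mono sum_square_le_card) auto
      also have "\<dots> = D / 4 * (\<Sum>j\<in>UNIV. (cd (e j) (fd (e l) f) x + t1 j + - t2 j)\<^sup>2)" by simp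
      also have "\<dots> \<le> D / 4 * (\<Sum>j\<in>UNIV. U j x)"
      proof (intro mult_left_mono sum_mono)
        fix j
        have "(t1 j)\<^sup>2 \<le> 2 * ((fd (e l) (ap j) x)\<^sup>2 * (f (x + e l + e j))\<^sup>2) + 2 * ((ap j x - 1)\<^sup>2 * (fd (e l) f (x + e j))\<^sup>2)"
          unfolding t1_def power_mult_distrib[symmetric] by (rule square_add_le)
        also have "\<dots> \<le> 2 * ((36 * \<eta>\<^sup>2)\<^sup>2 * (f (x + e l + e j))\<^sup>2) + 2 * ((18 * \<eta>)\<^sup>2 * (fd (e l) f (x + e j))\<^sup>2)"
          by (intro add_mono mult_left_mono mult_right_mono square_bound ap_am_1 x fd_ap_am x6) auto
        finally have 1: "(t1 j)\<^sup>2 \<le> 2 * ((36 * \<eta>\<^sup>2)\<^sup>2 * (f (x + e l + e j))\<^sup>2) + 2 * ((18 * \<eta>)\<^sup>2 * (fd (e l) f (x + e j))\<^sup>2)" .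
        have "(t2 j)\<^sup>2 \<le> 2 * ((fd (e l) (am j) x)\<^sup>2 * (f (x + e l - e j))\<^sup>2) + 2 * ((am j x - 1)\<^sup>2 * (fd (e l) f (x - e j))\<^sup>2)"
          unfolding t2_def power_mult_distrib[symmetric] by (rule square_add_le)
        also have "\<dots> \<le> 2 * ((36 * \<eta>\<^sup>2)\<^sup>2 * (f (x + e l - e j))\<^sup>2) + 2 * ((18 * \<eta>)\<^sup>2 * (fd (e l) f (x - e j))\<^sup>2)"
          by (intro add_mono mult_left_mono mult_right_mono square_bound ap_am_1 x fd_ap_am x6) auto
        finally have 2: "(t2 j)\<^sup>2 \<le> 2 * ((36 * \<eta>\<^sup>2)\<^sup>2 * (f (x + e l - e j))\<^sup>2) + 2 * ((18 * \<eta>)\<^sup>2 * (fd (e l) f (x - e j))\<^sup>2)" .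
        show "(cd (e j) (fd (e l) f) x + t1 j + - t2 j)\<^sup>2 \<le> U j x"
          unfolding U_def using 1 2
          by (intro order_trans[OF square_add3_le] add_mono mult_left_mono) auto
      qed (use D_ge_1 in simp)
      finally show "(fd (e l) (\<lambda>x. exp (\<Phi> x) * sdiff e u x) x)\<^sup>2 \<le> D / 4 * (\<Sum>j\<in>UNIV. U j x)" .
    qed
    also have "\<dots> = D / 4 * (\<Sum>j\<in>UNIV. S (U j))"
      unfolding sum_distrib_left[symmetric] by (subst sum.swap) (rule refl)
    also have "\<dots> \<le> D / 4 * (\<Sum>j\<in>UNIV. 12 * S (\<lambda>x. (fd (e j) (fd (e l) f) x)\<^sup>2)
        + (15552 * \<eta> ^ 4 * N0 + 3888 * \<eta>\<^sup>2 * S (\<lambda>x. (fd (e l) f x)\<^sup>2)))"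
    proof (intro mult_left_mono sum_mono)
      fix j
      have e4: "(36 * \<eta>\<^sup>2)\<^sup>2 = 1296 * \<eta> ^ 4" "(18 * \<eta>)\<^sup>2 = 324 * \<eta>\<^sup>2"
        by (simp_all add: power_mult_distrib flip: power_mult)
      show "S (U j) \<le> 12 * S (\<lambda>x. (fd (e j) (fd (e l) f) x)\<^sup>2)
        + (15552 * \<eta> ^ 4 * N0 + 3888 * \<eta>\<^sup>2 * S (\<lambda>x. (fd (e l) f x)\<^sup>2))"
        unfolding U_def sum.distrib sum_distrib_left[symmetric] shift2 S_square_shift[OF df4] e4
        using S_cd_square_le[OF df3, of j l] by simp
    qed (use D_ge_1 in simp)
    also have "\<dots> = 3 * D * (\<Sum>j\<in>UNIV. S (\<lambda>x. (fd (e j) (fd (e l) f) x)\<^sup>2)) + 972 * D\<^sup>2 * \<eta>\<^sup>2 * S (\<lambda>x. (fd (e l) f x)\<^sup>2)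
     + 3888 * D\<^sup>2 * \<eta> ^ 4 * N0"
      by (simp add: sum.distrib sum_distrib_left[symmetric] D_eq[symmetric] power2_eq_square algebra_simps)
    finally show ?thesis .
  qed
  have "(\<Sum>l\<in>UNIV. S (\<lambda>x. (fd (e l) (\<lambda>x. exp (\<Phi> x) * sdiff e u x) x)\<^sup>2)) \<le>
     (\<Sum>l\<in>UNIV. 3 * D * (\<Sum>j\<in>UNIV. S (\<lambda>x. (fd (e j) (fd (e l) f) x)\<^sup>2)) + 972 * D\<^sup>2 * \<eta>\<^sup>2 * S (\<lambda>x. (fd (e l) f x)\<^sup>2)
     + 3888 * D\<^sup>2 * \<eta> ^ 4 * N0)"
    by (intro sum_mono fd_le)
  also have "\<dots> = 3 * D * (\<Sum>l\<in>UNIV. \<Sum>j\<in>UNIV. S (\<lambda>x. (fd (e j) (fd (e l) f) x)\<^sup>2)) + 972 * D\<^sup>2 * \<eta>\<^sup>2 * N1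
     + 3888 * D ^ 3 * \<eta> ^ 4 * N0"
    unfolding N1_def by (simp add: sum.distrib sum_distrib_left[symmetric] D_eq[symmetric] power2_eq_square power3_eq_cube)
  also have "(\<Sum>l\<in>UNIV. \<Sum>j\<in>UNIV. S (\<lambda>x. (fd (e j) (fd (e l) f) x)\<^sup>2)) = N2"
    unfolding N2_def by (rule sum.swap)
  finally show ?thesis .
qed

text \<open>Undoing the conjugation trades a difference for a factor \<eta>. This respects the
  energy, since its consecutive weights differ by \<open>\<eta>\<^sup>2\<close> and the norms are
  squared.\<close>

lemma weighted_norms_le_energy:
  "\<eta> ^ 3 * S (\<lambda>x. (exp (\<Phi> x) * u x)\<^sup>2) + \<eta> * S (\<lambda>x. (exp (\<Phi> x) * sdiff e u x)\<^sup>2)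
    + 1 / \<eta> * S (\<lambda>x. (exp (\<Phi> x) * sdiff e (sdiff e u) x)\<^sup>2) \<le> 1000000 * D ^ 4 * energy"
proof -
  define F where "F x = exp (\<Phi> x) * sdiff e u x" for x
  have D4: "1 \<le> D ^ 4" "D\<^sup>2 \<le> D ^ 4" "D ^ 3 \<le> D ^ 4" "D \<le> D ^ 4"
    using D_ge_1 by (auto intro!: power_increasing simp: self_le_power)
  have f3: "supp_on (B 3) f" by (rule supp_mono[OF supp_f]) simp
  have suppF: "supp_on (B 3) F"
    using supp_mono[OF supp_conj_sdiff[of f u 0, OF f_eq supp_f], of 3] unfolding F_def by simp
  have 1: "S (\<lambda>x. (F x)\<^sup>2) \<le> 3 * D * N1 + 648 * D\<^sup>2 * \<eta>\<^sup>2 * N0"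
    using conj_sdiff_le[of f u, OF f_eq f3] unfolding F_def N0_def N1_def .
  have "S (\<lambda>x. (exp (\<Phi> x) * sdiff e (sdiff e u) x)\<^sup>2) \<le>
     3 * D * (\<Sum>l\<in>UNIV. S (\<lambda>x. (fd (e l) F x)\<^sup>2)) + 648 * D\<^sup>2 * \<eta>\<^sup>2 * S (\<lambda>x. (F x)\<^sup>2)"
    by (rule conj_sdiff_le[of F "sdiff e u", OF F_def suppF])
  also have "\<dots> \<le> 3 * D * (3 * D * N2 + 972 * D\<^sup>2 * \<eta>\<^sup>2 * N1 + 3888 * D ^ 3 * \<eta> ^ 4 * N0)
     + 648 * D\<^sup>2 * \<eta>\<^sup>2 * (3 * D * N1 + 648 * D\<^sup>2 * \<eta>\<^sup>2 * N0)"
    using fd_conj_sdiff_le 1 D_ge_1 unfolding F_def by (intro add_mono mult_left_mono) auto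
  also have "\<dots> = D\<^sup>2 * (9 * N2) + D ^ 3 * (4860 * (\<eta>\<^sup>2 * N1)) + D ^ 4 * (431568 * (\<eta> ^ 4 * N0))"
    by (simp add: algebra_simps eval_nat_numeral)
  also have "\<dots> \<le> D ^ 4 * (9 * N2) + D ^ 4 * (4860 * (\<eta>\<^sup>2 * N1)) + D ^ 4 * (431568 * (\<eta> ^ 4 * N0))"
    using D4 N_nonneg by (intro add_mono mult_right_mono) auto
  finally have "1 / \<eta> * S (\<lambda>x. (exp (\<Phi> x) * sdiff e (sdiff e u) x)\<^sup>2) \<le>
     1 / \<eta> * (D ^ 4 * (9 * N2) + D ^ 4 * (4860 * (\<eta>\<^sup>2 * N1)) + D ^ 4 * (431568 * (\<eta> ^ 4 * N0)))"
    using eta_pos by (intro mult_left_mono) auto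
  also have "\<dots> = D ^ 4 * (9 * (N2 / \<eta>) + 4860 * (\<eta> * N1) + 431568 * (\<eta> ^ 3 * N0))"
    using eta_pos by (simp add: field_simps eval_nat_numeral)
  finally have t2: "1 / \<eta> * S (\<lambda>x. (exp (\<Phi> x) * sdiff e (sdiff e u) x)\<^sup>2) \<le>
     D ^ 4 * (9 * (N2 / \<eta>) + 4860 * (\<eta> * N1) + 431568 * (\<eta> ^ 3 * N0))" .
  have "\<eta> * S (\<lambda>x. (F x)\<^sup>2) \<le> \<eta> * (3 * D * N1 + 648 * D\<^sup>2 * \<eta>\<^sup>2 * N0)"
    using 1 eta_pos by (intro mult_left_mono) auto
  also have "\<dots> = D * (3 * (\<eta> * N1)) + D\<^sup>2 * (648 * (\<eta> ^ 3 * N0))"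
    by (simp add: algebra_simps eval_nat_numeral)
  also have "\<dots> \<le> D ^ 4 * (3 * (\<eta> * N1)) + D ^ 4 * (648 * (\<eta> ^ 3 * N0))"
    using D4 N_nonneg eta_pos by (intro add_mono mult_right_mono) auto
  finally have t1: "\<eta> * S (\<lambda>x. (F x)\<^sup>2) \<le> D ^ 4 * (3 * (\<eta> * N1) + 648 * (\<eta> ^ 3 * N0))"
    by (simp add: algebra_simps)
  have t0: "\<eta> ^ 3 * S (\<lambda>x. (exp (\<Phi> x) * u x)\<^sup>2) \<le> D ^ 4 * (\<eta> ^ 3 * N0)"
    using mult_right_mono[OF D4(1), of "\<eta> ^ 3 * N0"] N_nonneg eta_pos unfolding N0_def f_eq by simp
  have "D ^ 4 * (\<eta> ^ 3 * N0) + D ^ 4 * (3 * (\<eta> * N1) + 648 * (\<eta> ^ 3 * N0)) +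
     D ^ 4 * (9 * (N2 / \<eta>) + 4860 * (\<eta> * N1) + 431568 * (\<eta> ^ 3 * N0)) \<le> D ^ 4 * (1000000 * energy)"
    unfolding distrib_left[symmetric]
  proof (rule mult_left_mono)
    have *: "a + (3 * b + 648 * a) + (9 * c + 4860 * b + 431568 * a) \<le> 1000000 * (a + b + c)"
      if "0 \<le> a" "0 \<le> b" "0 \<le> c" for a b c :: real
    proof -
      have "432217 * a \<le> 1000000 * a" "4863 * b \<le> 1000000 * b" "9 * c \<le> 1000000 * c"
        using that by (auto intro!: mult_right_mono)
      then show ?thesis by simp
    qed
    show "\<eta> ^ 3 * N0 + (3 * (\<eta> * N1) + 648 * (\<eta> ^ 3 * N0)) +
      (9 * (N2 / \<eta>) + 4860 * (\<eta> * N1) + 431568 * (\<eta> ^ 3 * N0)) \<le> 1000000 * energy"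
      unfolding energy_def by (rule *) (use N_nonneg eta_pos in auto)
  qed (use D4 in simp)
  then show ?thesis using t0 t1 t2 unfolding F_def by (simp add: mult_ac)
qed

end

section \<open>The Carleman weight\<close>

text \<open>Taylor's formula by two uses of the mean value theorem, which costs the factor 1/2 in
  the remainder. The segment formulation admits negative h, as backward steps require.\<close>

lemma second_order_bound:
  fixes g g' g'' :: "real \<Rightarrow> real"
  assumes g: "\<And>t. t \<in> closed_segment 0 h \<Longrightarrow> (g has_real_derivative g' t) (at t)"
    and g': "\<And>t. t \<in> closed_segment 0 h \<Longrightarrow> (g' has_real_derivative g'' t) (at t)"
    and bound: "\<And>t. t \<in> closed_segment 0 h \<Longrightarrow> \<bar>g'' t\<bar> \<le> K"
  shows "\<bar>g h - g 0 - h * g' 0\<bar> \<le> K * h\<^sup>2"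
proof -
  have K: "0 \<le> K" using bound[of 0] by auto
  have d: "\<bar>g' t - g' 0\<bar> \<le> K * \<bar>h\<bar>" if t: "t \<in> closed_segment 0 h" for t
  proof -
    have "norm (g' t - g' 0) \<le> K * norm (t - 0)"
      by (rule field_differentiable_bound[where S = "closed_segment 0 h" and f' = g''])
        (use t bound in \<open>auto intro: has_field_derivative_at_within g'\<close>)
    also have "\<dots> \<le> K * \<bar>h\<bar>"
      using t K by (intro mult_left_mono) (auto simp: closed_segment_eq_real_ivl split: if_splits)
    finally show ?thesis by simp
  qed
  have "norm ((g h - h * g' 0) - (g 0 - 0 * g' 0)) \<le> (K * \<bar>h\<bar>) * norm (h - 0)"
  proof (rule field_differentiable_bound[where S = "closed_segment 0 h" and f = "\<lambda>t. g t - t * g' 0" and f' = "\<lambda>t. g' t - g' 0"])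
    show "((\<lambda>t. g t - t * g' 0) has_field_derivative g' t - g' 0) (at t within closed_segment 0 h)"
      if "t \<in> closed_segment 0 h" for t
      using g[OF that] by (auto intro!: derivative_eq_intros intro: has_field_derivative_at_within)
  qed (use d in auto)
  then show ?thesis by (simp add: power2_eq_square algebra_simps abs_mult_self_eq)
qed

text \<open>The weight as a function of \<open>\<rho> = |x|\<^sup>2\<close>, with \<open>c_ps = 1 / 4\<close>. Its gradient is \<open>psi \<rho> * x\<close>, and
  \<open>psi1\<close>, \<open>psi2\<close> are the derivatives of \<open>psi\<close>.\<close>

definition profile_sq :: "real \<Rightarrow> real" where
  "profile_sq \<rho> = - (ln \<rho> / 2) +
     1 / 4 * (ln \<rho> / 2 * arctan (ln \<rho> / 2) - 1 / 2 * ln (1 + (ln \<rho> / 2)\<^sup>2))"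

definition psi :: "real \<Rightarrow> real" where
  "psi \<rho> = - (1 - arctan (ln \<rho> / 2) / 4) / \<rho>"

definition psi1 :: "real \<Rightarrow> real" where
  "psi1 \<rho> = (1 - arctan (ln \<rho> / 2) / 4) / \<rho>\<^sup>2 + 1 / (8 * \<rho>\<^sup>2 * (1 + (ln \<rho> / 2)\<^sup>2))"

definition psi2 :: "real \<Rightarrow> real" where
  "psi2 \<rho> = - 2 * (1 - arctan (ln \<rho> / 2) / 4) / \<rho> ^ 3 - 3 / (8 * \<rho> ^ 3 * (1 + (ln \<rho> / 2)\<^sup>2))
     - (ln \<rho> / 2) / (8 * \<rho> ^ 3 * (1 + (ln \<rho> / 2)\<^sup>2)\<^sup>2)"

section \<open>Calculus of the radial profile\<close>

lemma one_plus_square_pos: "0 < 1 + (s::real)\<^sup>2"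
  by (rule add_pos_nonneg) auto

lemma profile_eq:
  fixes x :: "real ^ 'd"
  assumes "x \<noteq> 0"
  shows "carleman_profile (1 / 4) (norm x) = profile_sq (x \<bullet> x)"
proof -
  have "ln (norm x) = ln (x \<bullet> x) / 2"
    using assms by (simp add: norm_eq_sqrt_inner ln_sqrt)
  then show ?thesis unfolding carleman_profile_def profile_sq_def by metis
qed

lemma half_ln_deriv: "0 < \<rho> \<Longrightarrow> ((\<lambda>\<rho>. ln \<rho> / 2) has_real_derivative 1 / (2 * \<rho>)) (at \<rho>)"
  by (auto intro!: derivative_eq_intros)

text \<open>The correction s arctan s - log (1 + s^2) / 2 is the antiderivative of arctan, so as a
  function of log |x| the profile has slope -1 + arctan (log |x|) / 4. The half compensates for the
  gradient 2 x of |x|^2.\<close>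

lemma profile_deriv:
  assumes "0 < \<rho>"
  shows "(profile_sq has_real_derivative psi \<rho> / 2) (at \<rho>)"
proof -
  define F where "F s = s * arctan s - 1 / 2 * ln (1 + s\<^sup>2)" for s :: real
  have "(F has_real_derivative arctan s) (at s)" for s
  proof -
    have "(F has_real_derivative (1 * arctan s + inverse (1 + s\<^sup>2) * s) - 1 / 2 * (1 / (1 + s\<^sup>2) * (2 * s))) (at s)"
      unfolding F_def[abs_def]
    proof (intro DERIV_diff DERIV_mult DERIV_ident DERIV_arctan DERIV_cmult)
      have "((\<lambda>s. 1 + s\<^sup>2) has_real_derivative 2 * s) (at s)"
        by (auto intro!: derivative_eq_intros)
      then show "((\<lambda>s. ln (1 + s\<^sup>2)) has_real_derivative 1 / (1 + s\<^sup>2) * (2 * s)) (at s)"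
        using DERIV_chain2[where f = ln and g = "\<lambda>s. 1 + s\<^sup>2", OF DERIV_ln_divide[OF one_plus_square_pos]]
        by blast
    qed
    moreover have "(1 * arctan s + inverse (1 + s\<^sup>2) * s) - 1 / 2 * (1 / (1 + s\<^sup>2) * (2 * s)) = arctan s"
      by (simp add: inverse_eq_divide)
    ultimately show ?thesis by simp
  qed
  from DERIV_add[OF DERIV_minus[OF half_ln_deriv[OF assms]]
      DERIV_cmult[OF DERIV_chain2[where f = F and g = "\<lambda>\<rho>. ln \<rho> / 2", OF this half_ln_deriv[OF assms]], of "1 / 4"]]
  have "(profile_sq has_real_derivative - (1 / (2 * \<rho>)) + 1 / 4 * (arctan (ln \<rho> / 2) * (1 / (2 * \<rho>)))) (at \<rho>)"
    unfolding profile_sq_def[abs_def] F_def .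
  moreover have "- (1 / (2 * \<rho>)) + 1 / 4 * (a * (1 / (2 * \<rho>))) = - (1 - a / 4) / \<rho> / 2" for a
    using assms by (simp add: field_simps)
  ultimately show ?thesis unfolding psi_def by simp
qed

lemma arctan_half_ln_deriv:
  assumes "0 < \<rho>"
  shows "((\<lambda>\<rho>. 1 - arctan (ln \<rho> / 2) / 4) has_real_derivative - (1 / (8 * \<rho> * (1 + (ln \<rho> / 2)\<^sup>2)))) (at \<rho>)"
proof -
  have "((\<lambda>\<rho>. 1 - arctan (ln \<rho> / 2) / 4) has_real_derivative
      0 - inverse (1 + (ln \<rho> / 2)\<^sup>2) * (1 / (2 * \<rho>)) / 4) (at \<rho>)"
    by (intro DERIV_diff DERIV_const DERIV_cdivide DERIV_chain2[where f = arctan, OF DERIV_arctan half_ln_deriv[OF assms]])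
  moreover have "0 - inverse w * (1 / (2 * \<rho>)) / 4 = - (1 / (8 * \<rho> * w))" for w
    by (simp add: inverse_eq_divide)
  ultimately show ?thesis by metis
qed

lemma psi_deriv:
  assumes "0 < \<rho>"
  shows "(psi has_real_derivative psi1 \<rho>) (at \<rho>)"
proof -
  define A where "A \<rho> = 1 - arctan (ln \<rho> / 2) / 4" for \<rho> :: real
  define w where "w = 1 + (ln \<rho> / 2)\<^sup>2"
  have "(A has_real_derivative - (1 / (8 * \<rho> * w))) (at \<rho>)"
    unfolding A_def[abs_def] w_def by (rule arctan_half_ln_deriv[OF assms])
  from DERIV_divide[OF DERIV_minus[OF this] DERIV_ident]
  have "((\<lambda>\<rho>. - A \<rho> / \<rho>) has_real_derivative (- (- (1 / (8 * \<rho> * w))) * \<rho> - - A \<rho> * 1) / (\<rho> * \<rho>)) (at \<rho>)"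
    using assms by simp
  moreover have "(- (- (1 / (8 * \<rho> * w))) * \<rho> - - A \<rho> * 1) / (\<rho> * \<rho>) = psi1 \<rho>"
  proof -
    have "1 / (8 * \<rho> * w) * \<rho> / (\<rho> * \<rho>) = 1 / (8 * \<rho>\<^sup>2 * w)"
      using assms by (simp add: power2_eq_square)
    then show ?thesis unfolding psi1_def w_def[symmetric] A_def[symmetric]
      by (simp add: add_divide_distrib power2_eq_square)
  qed
  moreover have "psi = (\<lambda>\<rho>. - A \<rho> / \<rho>)" unfolding psi_def[abs_def] A_def ..
  ultimately show ?thesis by simp
qed

lemma psi1_deriv:
  assumes "0 < \<rho>"
  shows "(psi1 has_real_derivative psi2 \<rho>) (at \<rho>)"
proof -
  define w where "w \<rho> = 1 + (ln \<rho> / 2)\<^sup>2" for \<rho> :: real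
  define A where "A \<rho> = 1 - arctan (ln \<rho> / 2) / 4" for \<rho> :: real
  have p: "0 < w \<rho>" unfolding w_def by (rule one_plus_square_pos)
  have dw: "(w has_real_derivative (ln \<rho> / 2) / \<rho>) (at \<rho>)"
    unfolding w_def[abs_def] using assms by (auto intro!: derivative_eq_intros)
  have dA: "(A has_real_derivative - (1 / (8 * \<rho> * w \<rho>))) (at \<rho>)"
    unfolding A_def[abs_def] w_def by (rule arctan_half_ln_deriv[OF assms])
  have d2: "((\<lambda>\<rho>. \<rho>\<^sup>2) has_real_derivative 2 * \<rho>) (at \<rho>)"
    by (auto intro!: derivative_eq_intros)
  have d3: "((\<lambda>\<rho>. 8 * \<rho>\<^sup>2 * w \<rho>) has_real_derivative 16 * \<rho> * w \<rho> + 4 * \<rho> * ln \<rho>) (at \<rho>)"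
    using dw assms by (auto intro!: derivative_eq_intros simp: power2_eq_square)
  have t1: "((\<lambda>\<rho>. A \<rho> / \<rho>\<^sup>2) has_real_derivative
      (- (1 / (8 * \<rho> * w \<rho>)) * \<rho>\<^sup>2 - A \<rho> * (2 * \<rho>)) / (\<rho>\<^sup>2 * \<rho>\<^sup>2)) (at \<rho>)"
    by (rule DERIV_divide[OF dA d2]) (use assms in simp)
  have t2: "((\<lambda>\<rho>. 1 / (8 * \<rho>\<^sup>2 * w \<rho>)) has_real_derivative
      (0 * (8 * \<rho>\<^sup>2 * w \<rho>) - 1 * (16 * \<rho> * w \<rho> + 4 * \<rho> * ln \<rho>)) /
        ((8 * \<rho>\<^sup>2 * w \<rho>) * (8 * \<rho>\<^sup>2 * w \<rho>))) (at \<rho>)"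
    by (rule DERIV_divide[OF DERIV_const d3]) (use assms p in simp)
  have e1: "(- (1 / (8 * \<rho> * w \<rho>)) * \<rho>\<^sup>2 - A \<rho> * (2 * \<rho>)) / (\<rho>\<^sup>2 * \<rho>\<^sup>2)
      = - 2 * A \<rho> / \<rho> ^ 3 - 1 / (8 * \<rho> ^ 3 * w \<rho>)"
  proof -
    have "(1 / (8 * \<rho> * w \<rho>)) * \<rho>\<^sup>2 / (\<rho>\<^sup>2 * \<rho>\<^sup>2) = 1 / (8 * \<rho> ^ 3 * w \<rho>)"
      "A \<rho> * (2 * \<rho>) / (\<rho>\<^sup>2 * \<rho>\<^sup>2) = 2 * A \<rho> / \<rho> ^ 3"
      using assms p by (simp_all add: power2_eq_square power3_eq_cube mult_ac)
    then show ?thesis by (simp add: diff_divide_distrib)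
  qed
  have e2: "(0 * (8 * \<rho>\<^sup>2 * w \<rho>) - 1 * (16 * \<rho> * w \<rho> + 4 * \<rho> * ln \<rho>)) /
        ((8 * \<rho>\<^sup>2 * w \<rho>) * (8 * \<rho>\<^sup>2 * w \<rho>))
      = - (2 / (8 * \<rho> ^ 3 * w \<rho>)) - (ln \<rho> / 2) / (8 * \<rho> ^ 3 * (w \<rho>)\<^sup>2)"
  proof -
    have "(16 * \<rho> * w \<rho>) / ((8 * \<rho>\<^sup>2 * w \<rho>) * (8 * \<rho>\<^sup>2 * w \<rho>)) = 2 / (8 * \<rho> ^ 3 * w \<rho>)"
      "(4 * \<rho> * ln \<rho>) / ((8 * \<rho>\<^sup>2 * w \<rho>) * (8 * \<rho>\<^sup>2 * w \<rho>)) = (ln \<rho> / 2) / (8 * \<rho> ^ 3 * (w \<rho>)\<^sup>2)"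
      using assms p by (simp_all add: power2_eq_square power3_eq_cube mult_ac)
    then show ?thesis by (simp add: add_divide_distrib diff_divide_distrib)
  qed
  have e3: "psi2 \<rho> = (- 2 * A \<rho> / \<rho> ^ 3 - 1 / (8 * \<rho> ^ 3 * w \<rho>))
      + (- (2 / (8 * \<rho> ^ 3 * w \<rho>)) - (ln \<rho> / 2) / (8 * \<rho> ^ 3 * (w \<rho>)\<^sup>2))"
  proof -
    have "3 / (8 * \<rho> ^ 3 * w \<rho>) = 1 / (8 * \<rho> ^ 3 * w \<rho>) + 2 / (8 * \<rho> ^ 3 * w \<rho>)"
      unfolding add_divide_distrib[symmetric] by simp
    then show ?thesis unfolding psi2_def A_def[symmetric] w_def[symmetric] by linarith
  qed
  have "psi1 = (\<lambda>\<rho>. A \<rho> / \<rho>\<^sup>2 + 1 / (8 * \<rho>\<^sup>2 * w \<rho>))"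
    unfolding psi1_def[abs_def] A_def w_def ..
  then show ?thesis using DERIV_add[OF t1 t2] unfolding e1 e2 e3 by simp
qed

lemma arctan_bounds: "\<bar>arctan s\<bar> \<le> 2"
  using arctan_bounded[of s] pi_less_4 by auto

lemma inverse_power_le:
  fixes \<rho> :: real
  assumes "1 / 16 \<le> \<rho>"
  shows "1 / \<rho> ^ n \<le> 16 ^ n"
proof -
  have "(1 / \<rho>) ^ n \<le> 16 ^ n"
    using assms by (intro power_mono) (auto simp: field_simps)
  then show ?thesis by (simp add: power_divide)
qed

text \<open>25000 is one crude bound for all three: for \<rho> \<ge> 1/16 the functions are at most
  24, 512 and 4 * 4096 in modulus. The sign of \<open>psi1\<close> makes the radial part of the
  gradient form harmless.\<close>

lemma psi_bounds:
  assumes "1 / 16 \<le> \<rho>"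
  shows "\<bar>psi \<rho>\<bar> \<le> 25000" "\<bar>psi1 \<rho>\<bar> \<le> 25000" "\<bar>psi2 \<rho>\<bar> \<le> 25000" "0 \<le> psi1 \<rho>"
proof -
  define s where "s = ln \<rho> / 2"
  define A where "A = 1 - arctan s / 4"
  define w where "w = 1 + s\<^sup>2"
  have pos: "0 < \<rho>" using assms by linarith
  \<comment> \<open>Here the value 1/4 of \<open>c_ps\<close> matters: as arctan is at most 2 in
    modulus, the slope - A of the profile in log |x| stays away from 0.\<close>
  have A: "1 / 2 \<le> A" "A \<le> 3 / 2" using arctan_bounds[of s] unfolding A_def by auto
  have w: "1 \<le> w" unfolding w_def by simp
  have w': "0 \<le> 1 / w" "1 / w \<le> 1" using w by auto
  have sw: "\<bar>s / w\<^sup>2\<bar> \<le> 1"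
  proof -
    have "\<bar>s\<bar> \<le> w" unfolding w_def using sum_squares_bound[of "\<bar>s\<bar>" 1] by (simp add: power2_eq_square)
    also have "\<dots> \<le> w\<^sup>2" using w by (simp add: self_le_power)
    finally show ?thesis using w by (simp add: abs_div)
  qed
  have r1: "0 \<le> 1 / \<rho>" "1 / \<rho> \<le> 16" using inverse_power_le[OF assms, of 1] pos by auto
  have r2: "0 \<le> 1 / \<rho>\<^sup>2" "1 / \<rho>\<^sup>2 \<le> 256" using inverse_power_le[OF assms, of 2] pos by auto
  have r3: "0 \<le> 1 / \<rho> ^ 3" "1 / \<rho> ^ 3 \<le> 4096" using inverse_power_le[OF assms, of 3] pos by auto
  have "psi \<rho> = - A * (1 / \<rho>)" unfolding psi_def A_def s_def by simp
  then have "\<bar>psi \<rho>\<bar> = A * (1 / \<rho>)" using A pos by (simp add: abs_mult)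
  also have "\<dots> \<le> (3 / 2) * 16" using A r1 by (intro mult_mono) auto
  finally show "\<bar>psi \<rho>\<bar> \<le> 25000" by simp
  have e1: "psi1 \<rho> = (A + 1 / 8 * (1 / w)) * (1 / \<rho>\<^sup>2)"
    unfolding psi1_def A_def[unfolded s_def, symmetric] w_def[unfolded s_def, symmetric]
    by (simp add: add_divide_distrib mult_ac)
  show nn: "0 \<le> psi1 \<rho>" unfolding e1 using A w' by (intro mult_nonneg_nonneg) auto
  have "psi1 \<rho> \<le> 2 * 256" unfolding e1 using A w' r2 by (intro mult_mono) auto
  then show "\<bar>psi1 \<rho>\<bar> \<le> 25000" using nn by simp
  have e2: "psi2 \<rho> = (- 2 * A - 3 / 8 * (1 / w) - 1 / 8 * (s / w\<^sup>2)) * (1 / \<rho> ^ 3)"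
  proof -
    have "psi2 \<rho> = - 2 * A / \<rho> ^ 3 - 3 / (8 * \<rho> ^ 3 * w) - s / (8 * \<rho> ^ 3 * w\<^sup>2)"
      unfolding psi2_def A_def w_def s_def ..
    then show ?thesis by (simp add: diff_divide_distrib mult_ac)
  qed
  have "\<bar>psi2 \<rho>\<bar> \<le> 4 * 4096"
    unfolding e2 abs_mult
  proof (rule mult_mono)
    show "\<bar>- 2 * A - 3 / 8 * (1 / w) - 1 / 8 * (s / w\<^sup>2)\<bar> \<le> 4" using A w' sw by linarith
  qed (use r3 in auto)
  then show "\<bar>psi2 \<rho>\<bar> \<le> 25000" by simp
qed

text \<open>The combination \<open>psi + \<rho> * psi1\<close> is the derivative of \<open>\<rho> * psi\<close>, which vanishes for the pure
  logarithm; its positivity comes from the arctangent alone.\<close>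

lemma psi_positivity:
  assumes "1 / 16 \<le> \<rho>" "\<rho> \<le> 9"
  shows "1 / 100000 \<le> (psi \<rho>)\<^sup>2 * \<rho> * (8 * (psi \<rho> + \<rho> * psi1 \<rho>) - 1 / 160)"
proof -
  define s where "s = ln \<rho> / 2"
  define A where "A = 1 - arctan s / 4"
  have pos: "0 < \<rho>" using assms by linarith
  have A: "1 / 2 \<le> A" using arctan_bounds[of s] unfolding A_def by auto
  \<comment> \<open>The interval from 1/16 to 9 lies between exp (-4) and exp 4, because exp 1 \<ge>
    2.\<close>
  have s2: "s\<^sup>2 \<le> 4"
  proof -
    have "(16::real) = 2 ^ 4" by simp
    also have "\<dots> \<le> exp 1 ^ 4" using exp_ge_add_one_self[of 1] by (intro power_mono) auto
    also have "\<dots> = exp 4" by (simp flip: exp_of_nat_mult)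
    finally have e4: "(16::real) \<le> exp 4" .
    have "\<rho> \<le> exp 4" using e4 assms by linarith
    then have "ln \<rho> \<le> 4" using pos by (metis exp_le_cancel_iff exp_ln)
    moreover have "exp (- 4) \<le> \<rho>"
    proof -
      have "exp (- 4) \<le> (1 / 16 :: real)" using e4 by (simp add: exp_minus field_simps)
      then show ?thesis using assms by linarith
    qed
    then have "- 4 \<le> ln \<rho>" using pos by (simp add: ln_ge_iff)
    ultimately have "\<bar>s\<bar> \<le> 2" unfolding s_def by auto
    then show ?thesis using abs_le_square_iff[of s 2] by simp
  qed
  have "psi \<rho> + \<rho> * psi1 \<rho> = 1 / (8 * (\<rho> * (1 + s\<^sup>2)))"
  proof -
    have "\<rho> * (A / \<rho>\<^sup>2) = A / \<rho>" "\<rho> * (1 / (8 * \<rho>\<^sup>2 * (1 + s\<^sup>2))) = 1 / (8 * (\<rho> * (1 + s\<^sup>2)))"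
      using pos by (simp_all add: power2_eq_square)
    then show ?thesis unfolding psi_def psi1_def s_def[symmetric] A_def[symmetric]
      by (simp add: distrib_left)
  qed
  \<comment> \<open>Origin of 1/160: 8 (psi + \<rho> psi1) is at least 1/45, more than 2/160. So
    1/160 can be given to the multiplier while 1/160 is left for the coefficient of f^2.\<close>
  moreover have "\<rho> * (1 + s\<^sup>2) \<le> 9 * 5" using assms s2 by (intro mult_mono) auto
  then have "1 / 45 \<le> 1 / (\<rho> * (1 + s\<^sup>2))"
    using pos one_plus_square_pos[of s] by (intro divide_left_mono) auto
  ultimately have 1: "1 / 160 \<le> 8 * (psi \<rho> + \<rho> * psi1 \<rho>) - 1 / 160" by simp
  have "(psi \<rho>)\<^sup>2 * \<rho> = A\<^sup>2 / \<rho>"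
  proof -
    have "psi \<rho> = - A / \<rho>" unfolding psi_def A_def s_def by simp
    then show ?thesis using pos by (simp add: power_divide power2_eq_square)
  qed
  moreover have "(1 / 2)\<^sup>2 / 9 \<le> A\<^sup>2 / \<rho>"
    using A assms pos by (intro frac_le power_mono) auto
  ultimately have 2: "1 / 36 \<le> (psi \<rho>)\<^sup>2 * \<rho>" by (simp add: power2_eq_square)
  have "1 / 100000 \<le> 1 / 36 * (1 / 160 :: real)" by simp
  also have "\<dots> \<le> (psi \<rho>)\<^sup>2 * \<rho> * (8 * (psi \<rho> + \<rho> * psi1 \<rho>) - 1 / 160)"
    using 1 2 by (intro mult_mono) auto
  finally show ?thesis .
qed

section \<open>Cartesian form of gradient, Hessian and multiplier\<close>

definition grad_weight :: "'d \<Rightarrow> real ^ 'd \<Rightarrow> real" where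
  "grad_weight j y = psi (y \<bullet> y) * y $ j"

definition hess_weight :: "'d \<Rightarrow> 'd \<Rightarrow> real ^ 'd \<Rightarrow> real" where
  "hess_weight j k y = (if j = k then psi (y \<bullet> y) else 0) + 2 * psi1 (y \<bullet> y) * y $ j * y $ k"

text \<open>Up to the small constant \<open>1 / 160\<close> this is \<open>2 * \<Delta>\<phi> - 4 * psi\<close>, the choice for which the
  coefficient of the tangential gradient cancels.\<close>

definition multiplier :: "real ^ 'd \<Rightarrow> real" where
  "multiplier y = (2 * real CARD('d) - 4) * psi (y \<bullet> y) + 4 * (y \<bullet> y) * psi1 (y \<bullet> y) + 1 / 160"

lemma inner_self_sum: "y \<bullet> y = (\<Sum>j\<in>UNIV. (y $ j)\<^sup>2)" for y :: "real ^ 'd"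
  by (simp add: inner_vec_def power2_eq_square)

lemma hess_quadratic_form:
  fixes y :: "real ^ 'd"
  shows "(\<Sum>j\<in>UNIV. \<Sum>k\<in>UNIV. hess_weight k j y * \<xi> j * \<xi> k) =
    psi (y \<bullet> y) * (\<Sum>j\<in>UNIV. (\<xi> j)\<^sup>2) + 2 * psi1 (y \<bullet> y) * (\<Sum>j\<in>UNIV. y $ j * \<xi> j)\<^sup>2"
proof -
  have "(\<Sum>k\<in>UNIV. hess_weight k j y * \<xi> j * \<xi> k) =
      psi (y \<bullet> y) * (\<xi> j)\<^sup>2 + 2 * psi1 (y \<bullet> y) * (y $ j * \<xi> j) * (\<Sum>k\<in>UNIV. y $ k * \<xi> k)" for j
  proof -
    have "(\<Sum>k\<in>UNIV. hess_weight k j y * \<xi> j * \<xi> k) =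
        (\<Sum>k\<in>UNIV. if k = j then psi (y \<bullet> y) * \<xi> j * \<xi> k else 0)
        + (\<Sum>k\<in>UNIV. 2 * psi1 (y \<bullet> y) * (y $ j * \<xi> j) * (y $ k * \<xi> k))"
      unfolding hess_weight_def sum.distrib[symmetric] by (intro sum.cong refl) (simp add: algebra_simps)
    then show ?thesis by (simp add: sum_distrib_left power2_eq_square)
  qed
  then have "(\<Sum>j\<in>UNIV. \<Sum>k\<in>UNIV. hess_weight k j y * \<xi> j * \<xi> k) =
      (\<Sum>j\<in>UNIV. psi (y \<bullet> y) * (\<xi> j)\<^sup>2) +
      (\<Sum>j\<in>UNIV. 2 * psi1 (y \<bullet> y) * (y $ j * \<xi> j) * (\<Sum>k\<in>UNIV. y $ k * \<xi> k))"
    by (simp add: sum.distrib)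
  then show ?thesis
    by (simp only: sum_distrib_left[symmetric] sum_distrib_right[symmetric]) (simp add: power2_eq_square mult.assoc)
qed

lemma hess_trace:
  fixes y :: "real ^ 'd"
  shows "(\<Sum>k\<in>UNIV. hess_weight k k y) = real CARD('d) * psi (y \<bullet> y) + 2 * psi1 (y \<bullet> y) * (y \<bullet> y)"
  unfolding hess_weight_def inner_self_sum
  by (simp add: sum.distrib sum_distrib_left power2_eq_square mult.assoc)

text \<open>With this multiplier all multiples of \<open>psi\<close> cancel. What remains on the
  right is 8 psi1 times the square of the inner product of y and \<xi>, plus 1/160 times
  |\<xi>|^2.\<close>

lemma weight_pos_grad:
  fixes y :: "real ^ 'd"
  assumes "1 / 16 \<le> y \<bullet> y"
  shows "1 / 160 * (\<Sum>j\<in>UNIV. (\<xi> j)\<^sup>2) \<le>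
     4 * (\<Sum>j\<in>UNIV. \<Sum>k\<in>UNIV. hess_weight k j y * \<xi> j * \<xi> k)
     + (multiplier y - 2 * (\<Sum>k\<in>UNIV. hess_weight k k y)) * (\<Sum>j\<in>UNIV. (\<xi> j)\<^sup>2)"
proof -
  have "0 \<le> psi1 (y \<bullet> y) * (\<Sum>j\<in>UNIV. y $ j * \<xi> j)\<^sup>2"
    using psi_bounds(4)[OF assms] by simp
  then show ?thesis unfolding hess_quadratic_form hess_trace multiplier_def
    by (simp add: algebra_simps)
qed

text \<open>The gradient is radial, so the Hessian acts by its radial eigenvalue psi + 2 \<rho>
  psi1. Four times this, plus the 4 psi that the trace and the multiplier leave, is the 8 (psi +
  \<rho> psi1) of \<open>psi_positivity\<close>.\<close>

lemma weight_pos_fun: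
  fixes y :: "real ^ 'd"
  assumes "1 / 16 \<le> y \<bullet> y" "y \<bullet> y \<le> 9"
  shows "1 / 100000 \<le>
     4 * (\<Sum>j\<in>UNIV. \<Sum>k\<in>UNIV. hess_weight j k y * grad_weight j y * grad_weight k y)
     + (2 * (\<Sum>k\<in>UNIV. hess_weight k k y) - multiplier y) * (\<Sum>j\<in>UNIV. (grad_weight j y)\<^sup>2)"
proof -
  have hq: "(\<Sum>j\<in>UNIV. \<Sum>k\<in>UNIV. hess_weight j k y * \<xi> j * \<xi> k) =
    psi (y \<bullet> y) * (\<Sum>j\<in>UNIV. (\<xi> j)\<^sup>2) + 2 * psi1 (y \<bullet> y) * (\<Sum>j\<in>UNIV. y $ j * \<xi> j)\<^sup>2" for \<xi>
    unfolding hess_quadratic_form[symmetric] by (subst sum.swap, intro sum.cong refl) simp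
  have g2: "(\<Sum>j\<in>UNIV. (grad_weight j y)\<^sup>2) = (psi (y \<bullet> y))\<^sup>2 * (y \<bullet> y)"
    unfolding grad_weight_def by (simp add: power_mult_distrib sum_distrib_left[symmetric] inner_self_sum)
  have "(\<Sum>j\<in>UNIV. y $ j * (r * y $ j)) = r * (y \<bullet> y)" for r
    by (simp add: inner_self_sum sum_distrib_left power2_eq_square mult_ac)
  then have yg: "(\<Sum>j\<in>UNIV. y $ j * grad_weight j y) = psi (y \<bullet> y) * (y \<bullet> y)"
    unfolding grad_weight_def .
  have "4 * (\<Sum>j\<in>UNIV. \<Sum>k\<in>UNIV. hess_weight j k y * grad_weight j y * grad_weight k y)
     + (2 * (\<Sum>k\<in>UNIV. hess_weight k k y) - multiplier y) * (\<Sum>j\<in>UNIV. (grad_weight j y)\<^sup>2)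
     = (psi (y \<bullet> y))\<^sup>2 * (y \<bullet> y) * (8 * (psi (y \<bullet> y) + (y \<bullet> y) * psi1 (y \<bullet> y)) - 1 / 160)"
    unfolding hq hess_trace multiplier_def g2 yg
    by (simp add: algebra_simps power2_eq_square)
  then show ?thesis using psi_positivity[OF assms] by simp
qed

section \<open>Derivatives along coordinate lines\<close>

definition axis_path :: "real ^ 'd \<Rightarrow> 'd \<Rightarrow> real \<Rightarrow> real ^ 'd" where
  "axis_path x k t = x + t *\<^sub>R axis k 1"

lemma axis_path_0 [simp]: "axis_path x k 0 = x"
  unfolding axis_path_def by simp

lemma axis_path_nth: "axis_path x k t $ j = x $ j + (if j = k then t else 0)"
  unfolding axis_path_def by (simp add: axis_def)

lemma axis_path_inner: "axis_path x k t \<bullet> axis_path x k t = x \<bullet> x + 2 * t * x $ k + t\<^sup>2"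
  unfolding axis_path_def
  by (simp add: inner_add_left inner_add_right inner_axis inner_axis' power2_eq_square algebra_simps)

lemma axis_path_nth_deriv:
  "((\<lambda>t. axis_path x k t $ j) has_real_derivative (if j = k then 1 else 0)) (at t)"
  unfolding axis_path_nth by (auto intro!: derivative_eq_intros)

lemma axis_path_inner_deriv:
  "((\<lambda>t. axis_path x k t \<bullet> axis_path x k t) has_real_derivative 2 * axis_path x k t $ k) (at t)"
  unfolding axis_path_inner axis_path_nth by (auto intro!: derivative_eq_intros)

text \<open>Room for eight lattice steps around the support of u when h < 1/40: 1/2 - 8/40 \<ge> 1/4
  and 2 + 8/40 \<le> 3. The singularity of the weight at 0 stays outside.\<close>

definition annulus :: "(real ^ 'd) set" where
  "annulus = {y. 1 / 4 \<le> norm y \<and> norm y \<le> 3}"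

lemma annulus_bounds:
  assumes "y \<in> annulus"
  shows "1 / 16 \<le> y \<bullet> y" "y \<bullet> y \<le> 9" "\<bar>y $ j\<bar> \<le> 3" "y \<noteq> 0"
proof -
  have n: "1 / 4 \<le> norm y" "norm y \<le> 3" using assms unfolding annulus_def by auto
  show "\<bar>y $ j\<bar> \<le> 3" using component_le_norm_cart[of y j] n by linarith
  have "(1 / 4)\<^sup>2 \<le> (norm y)\<^sup>2" "(norm y)\<^sup>2 \<le> 3\<^sup>2" using n by (intro power_mono; simp)+
  then show "1 / 16 \<le> y \<bullet> y" "y \<bullet> y \<le> 9" by (simp_all add: dot_square_norm power2_eq_square)
  show "y \<noteq> 0" using n by auto
qed

lemma comp_deriv:
  assumes "\<And>\<rho>. 0 < \<rho> \<Longrightarrow> (F has_real_derivative F' \<rho>) (at \<rho>)" "axis_path x k t \<in> annulus"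
  shows "((\<lambda>t. F (axis_path x k t \<bullet> axis_path x k t)) has_real_derivative
    F' (axis_path x k t \<bullet> axis_path x k t) * (2 * axis_path x k t $ k)) (at t)"
proof (rule DERIV_chain2[where f = F])
  show "(F has_real_derivative F' (axis_path x k t \<bullet> axis_path x k t)) (at (axis_path x k t \<bullet> axis_path x k t))"
    using annulus_bounds(1)[OF assms(2)] by (intro assms(1)) linarith
qed (rule axis_path_inner_deriv)

text \<open>The derivative of \<open>hess_weight j k\<close> along axis k, hence the second
  derivative of the gradient component j in the direction of the step.\<close>

definition third :: "'d \<Rightarrow> 'd \<Rightarrow> real ^ 'd \<Rightarrow> real" where
  "third j k y = (if j = k then psi1 (y \<bullet> y) * (2 * y $ k) else 0) +
    2 * (psi2 (y \<bullet> y) * (2 * y $ k) * y $ j * y $ k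
      + psi1 (y \<bullet> y) * ((if j = k then 1 else 0) * y $ k + y $ j))"

definition multiplier_deriv :: "'d \<Rightarrow> real ^ 'd \<Rightarrow> real" where
  "multiplier_deriv k y = (2 * real CARD('d) - 4) * (psi1 (y \<bullet> y) * (2 * y $ k))
    + 4 * (2 * y $ k * psi1 (y \<bullet> y) + (y \<bullet> y) * (psi2 (y \<bullet> y) * (2 * y $ k)))"

lemma grad_weight_deriv:
  assumes "axis_path x k t \<in> annulus"
  shows "((\<lambda>t. grad_weight j (axis_path x k t)) has_real_derivative hess_weight j k (axis_path x k t)) (at t)"
  using DERIV_mult[OF comp_deriv[OF psi_deriv assms] axis_path_nth_deriv[of x k j t]]
  unfolding grad_weight_def hess_weight_def
  by (rule DERIV_cong; cases "j = k"; simp add: algebra_simps)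

lemma hess_weight_deriv:
  assumes "axis_path x k t \<in> annulus"
  shows "((\<lambda>t. hess_weight j k (axis_path x k t)) has_real_derivative third j k (axis_path x k t)) (at t)"
proof -
  have "((\<lambda>t. 2 * (psi1 (axis_path x k t \<bullet> axis_path x k t) * axis_path x k t $ j * axis_path x k t $ k))
     has_real_derivative 2 * ((psi1 (axis_path x k t \<bullet> axis_path x k t) * (if j = k then 1 else 0)
       + (psi2 (axis_path x k t \<bullet> axis_path x k t) * (2 * axis_path x k t $ k)) * axis_path x k t $ j) * axis_path x k t $ k
       + psi1 (axis_path x k t \<bullet> axis_path x k t) * axis_path x k t $ j)) (at t)"
    using DERIV_cmult[OF DERIV_mult[OF DERIV_mult[OF comp_deriv[OF psi1_deriv assms]
      axis_path_nth_deriv[of x k j t]] axis_path_nth_deriv[of x k k t]], of 2]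
    by (rule DERIV_cong; cases "j = k"; simp add: algebra_simps)
  moreover have "((\<lambda>t. if j = k then psi (axis_path x k t \<bullet> axis_path x k t) else 0) has_real_derivative
      (if j = k then psi1 (axis_path x k t \<bullet> axis_path x k t) * (2 * axis_path x k t $ k) else 0)) (at t)"
    using comp_deriv[OF psi_deriv assms] by simp
  ultimately have "((\<lambda>t. (if j = k then psi (axis_path x k t \<bullet> axis_path x k t) else 0)
      + 2 * (psi1 (axis_path x k t \<bullet> axis_path x k t) * axis_path x k t $ j * axis_path x k t $ k)) has_real_derivative
     (if j = k then psi1 (axis_path x k t \<bullet> axis_path x k t) * (2 * axis_path x k t $ k) else 0)
      + 2 * ((psi1 (axis_path x k t \<bullet> axis_path x k t) * (if j = k then 1 else 0)
       + (psi2 (axis_path x k t \<bullet> axis_path x k t) * (2 * axis_path x k t $ k)) * axis_path x k t $ j) * axis_path x k t $ k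
       + psi1 (axis_path x k t \<bullet> axis_path x k t) * axis_path x k t $ j)) (at t)"
    by (intro DERIV_add)
  then show ?thesis unfolding hess_weight_def third_def mult.assoc
    by (rule DERIV_cong; cases "j = k"; simp add: algebra_simps)
qed

lemma multiplier_has_deriv:
  assumes "axis_path x k t \<in> annulus"
  shows "((\<lambda>t. multiplier (axis_path x k t)) has_real_derivative multiplier_deriv k (axis_path x k t)) (at t)"
proof -
  have "((\<lambda>t. (axis_path x k t \<bullet> axis_path x k t) * psi1 (axis_path x k t \<bullet> axis_path x k t)) has_real_derivative
     2 * axis_path x k t $ k * psi1 (axis_path x k t \<bullet> axis_path x k t)
     + (axis_path x k t \<bullet> axis_path x k t) * (psi2 (axis_path x k t \<bullet> axis_path x k t) * (2 * axis_path x k t $ k))) (at t)"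
    using DERIV_mult[OF axis_path_inner_deriv[of x k t] comp_deriv[OF psi1_deriv assms]]
    by (rule DERIV_cong; simp add: algebra_simps)
  from DERIV_add[OF DERIV_add[OF DERIV_cmult[OF comp_deriv[OF psi_deriv assms], of "2 * real CARD('a) - 4"]
      DERIV_cmult[OF this, of 4]] DERIV_const[of "1 / 160"]]
  show ?thesis unfolding multiplier_def multiplier_deriv_def by (simp add: mult.assoc)
qed

text \<open>The factors before 25000 count terms, with coordinates at most 3 and y \<bullet> y at
  most 9: for instance 19 = 1 + 2 * 9 and 126 = 6 + 2 * (2 * 27 + 6). They determine the choice of
  M.\<close>

lemma weight_bounds:
  fixes y :: "real ^ 'd"
  assumes "y \<in> annulus"
  shows "\<bar>grad_weight j y\<bar> \<le> 3 * 25000" "\<bar>hess_weight j k y\<bar> \<le> 19 * 25000" "\<bar>third j k y\<bar> \<le> 126 * 25000"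
    "\<bar>multiplier y\<bar> \<le> (2 * real CARD('d) + 41) * 25000"
    "\<bar>multiplier_deriv k y\<bar> \<le> (12 * real CARD('d) + 264) * 25000"
proof -
  note y = annulus_bounds[OF assms]
  note b = psi_bounds[OF y(1)]
  define K :: real where "K = 25000"
  define c0 where "c0 = psi (y \<bullet> y)"
  define c1 where "c1 = psi1 (y \<bullet> y)"
  define c2 where "c2 = psi2 (y \<bullet> y)"
  have c: "\<bar>c0\<bar> \<le> K" "\<bar>c1\<bar> \<le> K" "\<bar>c2\<bar> \<le> K" using b unfolding K_def c0_def c1_def c2_def by auto
  have K: "1 \<le> K" unfolding K_def by simp
  have m1: "\<bar>u * y $ i\<bar> \<le> L * 3" if "\<bar>u\<bar> \<le> L" for u L :: real and i
    unfolding abs_mult using that y(3) by (intro mult_mono) auto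
  show "\<bar>grad_weight j y\<bar> \<le> 3 * 25000"
    using m1[OF c(1), of j] unfolding grad_weight_def c0_def K_def by simp
  have m2: "\<bar>c1 * y $ j * y $ k\<bar> \<le> K * 3 * 3" by (intro m1 c)
  show "\<bar>hess_weight j k y\<bar> \<le> 19 * 25000"
  proof -
    have "\<bar>if j = k then c0 else 0\<bar> \<le> K" using c K by auto
    moreover have "hess_weight j k y = (if j = k then c0 else 0) + 2 * (c1 * y $ j * y $ k)"
      unfolding hess_weight_def c0_def c1_def by simp
    ultimately show ?thesis using m2 unfolding K_def[symmetric] by linarith
  qed
  have m3: "\<bar>c2 * y $ k * y $ j * y $ k\<bar> \<le> K * 3 * 3 * 3" by (intro m1 c)
  have m4: "\<bar>c1 * y $ i\<bar> \<le> K * 3" for i by (intro m1 c)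
  show "\<bar>third j k y\<bar> \<le> 126 * 25000"
  proof -
    have "\<bar>if j = k then 2 * (c1 * y $ k) else 0\<bar> \<le> 2 * (K * 3)"
      "\<bar>if j = k then c1 * y $ k else 0\<bar> \<le> K * 3"
      using m4[of k] K by auto
    moreover have "third j k y = (if j = k then 2 * (c1 * y $ k) else 0)
        + 2 * (2 * (c2 * y $ k * y $ j * y $ k) + ((if j = k then c1 * y $ k else 0) + c1 * y $ j))"
      unfolding third_def c1_def[symmetric] c2_def[symmetric] by (simp add: algebra_simps)
    moreover have "\<bar>d1 + 2 * (2 * d2 + (d3 + d4))\<bar> \<le> 126 * K"
      if "\<bar>d1\<bar> \<le> 2 * (K * 3)" "\<bar>d2\<bar> \<le> K * 3 * 3 * 3" "\<bar>d3\<bar> \<le> K * 3" "\<bar>d4\<bar> \<le> K * 3" for d1 d2 d3 d4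
      using that unfolding distrib_left by linarith
    ultimately show ?thesis using m3 m4[of j] unfolding K_def[symmetric] by metis
  qed
  define n where "n = real CARD('d)"
  have n: "1 \<le> n" unfolding n_def using one_le_card_finite[where 'a = 'd] by linarith
  then have n4: "\<bar>2 * n - 4\<bar> \<le> 2 * n + 2" by auto
  have yy: "\<bar>y \<bullet> y\<bar> \<le> 9" using y by auto
  have y1: "\<bar>(y \<bullet> y) * c1\<bar> \<le> 9 * K" unfolding abs_mult using yy c by (intro mult_mono) auto
  show "\<bar>multiplier y\<bar> \<le> (2 * real CARD('d) + 41) * 25000"
  proof -
    have "\<bar>(2 * n - 4) * c0\<bar> \<le> (2 * n + 2) * K" unfolding abs_mult using n4 c n by (intro mult_mono) auto
    moreover have "multiplier y = (2 * n - 4) * c0 + 4 * ((y \<bullet> y) * c1) + 1 / 160"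
      unfolding multiplier_def n_def c0_def c1_def by simp
    ultimately have "\<bar>multiplier y\<bar> \<le> (2 * n + 2) * K + 4 * (9 * K) + K" using y1 K by linarith
    then show ?thesis unfolding n_def K_def by (simp add: algebra_simps)
  qed
  show "\<bar>multiplier_deriv k y\<bar> \<le> (12 * real CARD('d) + 264) * 25000"
  proof -
    have "\<bar>(2 * n - 4) * (c1 * y $ k)\<bar> \<le> (2 * n + 2) * (K * 3)"
      unfolding abs_mult[of "2 * n - 4"] using n4 m4[of k] n by (intro mult_mono) auto
    moreover have "\<bar>(y \<bullet> y) * (c2 * y $ k)\<bar> \<le> 9 * (K * 3)"
      unfolding abs_mult[of "y \<bullet> y"] using yy m1[OF c(3), of k] by (intro mult_mono) auto
    moreover have "multiplier_deriv k y = 2 * ((2 * n - 4) * (c1 * y $ k))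
      + 8 * (c1 * y $ k) + 8 * ((y \<bullet> y) * (c2 * y $ k))"
      unfolding multiplier_deriv_def n_def[symmetric] c1_def[symmetric] c2_def[symmetric]
      by (simp add: algebra_simps)
    ultimately have "\<bar>multiplier_deriv k y\<bar> \<le> 2 * ((2 * n + 2) * (K * 3)) + 8 * (K * 3) + 8 * (9 * (K * 3))"
      using m4[of k] by linarith
    then show ?thesis unfolding n_def K_def by (simp add: algebra_simps)
  qed
qed

section \<open>Taylor estimates over one lattice step\<close>

lemma weight_taylor:
  assumes "\<And>t. t \<in> closed_segment 0 h \<Longrightarrow> axis_path x k t \<in> annulus"
  shows "\<bar>carleman_profile (1 / 4) (norm (axis_path x k h)) - carleman_profile (1 / 4) (norm x)
      - h * grad_weight k x\<bar> \<le> 19 * 25000 * h\<^sup>2"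
proof -
  have ends: "x \<noteq> 0" "axis_path x k h \<noteq> 0"
    using annulus_bounds(4)[OF assms[of 0]] annulus_bounds(4)[OF assms[of h]] by auto
  have "\<bar>profile_sq (axis_path x k h \<bullet> axis_path x k h) - profile_sq (axis_path x k 0 \<bullet> axis_path x k 0)
      - h * grad_weight k (axis_path x k 0)\<bar> \<le> 19 * 25000 * h\<^sup>2"
  proof (rule second_order_bound[where g = "\<lambda>t. profile_sq (axis_path x k t \<bullet> axis_path x k t)"
        and g' = "\<lambda>t. grad_weight k (axis_path x k t)" and g'' = "\<lambda>t. hess_weight k k (axis_path x k t)"])
    fix t :: real assume t: "t \<in> closed_segment 0 h"
    show "((\<lambda>t. profile_sq (axis_path x k t \<bullet> axis_path x k t)) has_real_derivative grad_weight k (axis_path x k t)) (at t)"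
      using comp_deriv[OF profile_deriv assms[OF t]] unfolding grad_weight_def by simp
  qed (use grad_weight_deriv weight_bounds(2) assms in blast)+
  then show ?thesis unfolding profile_eq[OF ends(1)] profile_eq[OF ends(2)] by simp
qed

lemma grad_weight_taylor:
  assumes "\<And>t. t \<in> closed_segment 0 h \<Longrightarrow> axis_path x k t \<in> annulus"
  shows "\<bar>grad_weight j (axis_path x k h) - grad_weight j x - h * hess_weight j k x\<bar> \<le> 126 * 25000 * h\<^sup>2"
proof -
  have "\<bar>grad_weight j (axis_path x k h) - grad_weight j (axis_path x k 0)
      - h * hess_weight j k (axis_path x k 0)\<bar> \<le> 126 * 25000 * h\<^sup>2"
    by (rule second_order_bound[where g' = "\<lambda>t. hess_weight j k (axis_path x k t)"
        and g'' = "\<lambda>t. third j k (axis_path x k t)"])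
      (use grad_weight_deriv hess_weight_deriv weight_bounds(3) assms in blast)+
  then show ?thesis by simp
qed

lemma multiplier_lipschitz:
  fixes x :: "real ^ 'd"
  assumes "\<And>t. t \<in> closed_segment 0 h \<Longrightarrow> axis_path x k t \<in> annulus"
  shows "\<bar>multiplier (axis_path x k h) - multiplier x\<bar> \<le> (12 * real CARD('d) + 264) * 25000 * \<bar>h\<bar>"
proof -
  have "norm (multiplier (axis_path x k h) - multiplier (axis_path x k 0)) \<le>
      (12 * real CARD('d) + 264) * 25000 * norm (h - 0)"
  proof (rule field_differentiable_bound[where S = "closed_segment 0 h"
        and f = "\<lambda>t. multiplier (axis_path x k t)" and f' = "\<lambda>t. multiplier_deriv k (axis_path x k t)"])
    show "norm (multiplier_deriv k (axis_path x k t)) \<le> (12 * real CARD('d) + 264) * 25000"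
      if "t \<in> closed_segment 0 h" for t
      unfolding real_norm_def by (rule weight_bounds(5)[OF assms[OF that]])
  qed (auto intro: has_field_derivative_at_within multiplier_has_deriv assms)
  then show ?thesis by simp
qed

section \<open>The Carleman estimate\<close>

definition layer :: "real \<Rightarrow> nat \<Rightarrow> (real ^ 'd) set" where
  "layer h m = {x \<in> grid h. 1 / 2 - real m * h \<le> norm x \<and> norm x \<le> 2 + real m * h}"

lemma finite_grid_bounded:
  assumes "0 < h"
  shows "finite {x \<in> grid h. norm (x :: real ^ 'd) \<le> r}"
proof (rule finite_subset)
  define N where "N = \<lceil>r / h\<rceil>"
  let ?F = "(UNIV :: 'd set) \<rightarrow>\<^sub>E {-N..N}"
  show "finite ((\<lambda>f. \<chi> i. h * of_int (f i)) ` ?F :: (real ^ 'd) set)"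
    by (intro finite_imageI finite_PiE) auto
  show "{x \<in> grid h. norm (x :: real ^ 'd) \<le> r} \<subseteq> (\<lambda>f. \<chi> i. h * of_int (f i)) ` ?F"
  proof
    fix x :: "real ^ 'd" assume x: "x \<in> {x \<in> grid h. norm x \<le> r}"
    then have "\<forall>i. \<exists>k::int. x $ i = h * of_int k" unfolding grid_def by simp
    then obtain f :: "'d \<Rightarrow> int" where f: "\<And>i. x $ i = h * of_int (f i)" by metis
    have "f i \<in> {-N..N}" for i
    proof -
      have "\<bar>h * of_int (f i)\<bar> \<le> r" using component_le_norm_cart[of x i] x unfolding f by simp
      then have "\<bar>of_int (f i)\<bar> \<le> r / h" using assms by (simp add: abs_mult field_simps)
      then show ?thesis unfolding N_def by (auto simp: abs_le_iff le_ceiling_iff ceiling_le_iff) linarith+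
    qed
    then show "x \<in> (\<lambda>f. \<chi> i. h * of_int (f i)) ` ?F"
      by (intro image_eqI[of _ _ f]) (auto simp: vec_eq_iff f)
  qed
qed

lemma grid_add_axis:
  assumes "x \<in> grid h"
  shows "x + h *\<^sub>R axis j 1 \<in> grid h" "x - h *\<^sub>R axis j 1 \<in> grid h"
proof -
  have "\<forall>i. \<exists>k::int. x $ i = h * of_int k" using assms unfolding grid_def by simp
  then obtain f :: "'a \<Rightarrow> int" where f: "\<And>i. x $ i = h * of_int (f i)" by metis
  have "(x + h *\<^sub>R axis j 1) $ i = h * of_int (f i + (if i = j then 1 else 0))"
    "(x - h *\<^sub>R axis j 1) $ i = h * of_int (f i - (if i = j then 1 else 0))" for i
    by (auto simp: f axis_def algebra_simps)
  then show "x + h *\<^sub>R axis j 1 \<in> grid h" "x - h *\<^sub>R axis j 1 \<in> grid h"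
    unfolding grid_def by blast+
qed

lemma norm_scaled_axis: "norm (t *\<^sub>R axis k (1::real)) = \<bar>t\<bar>"
  by (simp add: norm_axis_1)

lemma layer_lattice_layers:
  assumes "0 < h"
  shows "lattice_layers (layer h) (\<lambda>j. h *\<^sub>R axis j 1 :: real ^ 'd)"
proof
  fix m and x :: "real ^ 'd" and j
  show "finite (layer h m :: (real ^ 'd) set)"
    by (rule finite_subset[OF _ finite_grid_bounded[OF assms, of "2 + real m * h"]]) (auto simp: layer_def)
  show "layer h m \<subseteq> (layer h (Suc m) :: (real ^ 'd) set)"
    using assms unfolding layer_def by (auto simp: algebra_simps)
  assume x: "x \<in> layer h m"
  have n: "norm (h *\<^sub>R axis j 1 :: real ^ 'd) = h" using assms by (simp add: norm_scaled_axis)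
  note tri = norm_triangle_ineq[of x "h *\<^sub>R axis j 1"] norm_triangle_ineq4[of x "h *\<^sub>R axis j 1"]
    norm_triangle_ineq4[of "x + h *\<^sub>R axis j 1" "h *\<^sub>R axis j 1"]
    norm_triangle_ineq[of "x - h *\<^sub>R axis j 1" "h *\<^sub>R axis j 1"]
  show "x + h *\<^sub>R axis j 1 \<in> layer h (Suc m)" "x - h *\<^sub>R axis j 1 \<in> layer h (Suc m)"
    using x tri grid_add_axis[of x h j] unfolding layer_def n by (auto simp: distrib_right)
qed

lemma layer_annulus:
  assumes "x \<in> layer h 7" "0 < h" "h < 1 / 40" "\<bar>t\<bar> \<le> h"
  shows "axis_path x k t \<in> annulus"
proof -
  have "norm (axis_path x k t) \<le> norm x + \<bar>t\<bar>"
    unfolding axis_path_def using norm_triangle_ineq[of x "t *\<^sub>R axis k 1"] by (simp add: norm_scaled_axis)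
  moreover have "norm x \<le> norm (axis_path x k t) + \<bar>t\<bar>"
    unfolding axis_path_def using norm_triangle_ineq4[of "x + t *\<^sub>R axis k 1" "t *\<^sub>R axis k 1"]
    by (simp add: norm_scaled_axis)
  ultimately show ?thesis using assms unfolding layer_def annulus_def by auto
qed

text \<open>Turns the infinite sums of the statement into finite sums over a layer or over a ball of
  the lattice.\<close>

lemma l2_norm_square:
  assumes "finite A" "A \<subseteq> G" "\<And>x. x \<in> G - A \<Longrightarrow> F x = 0"
  shows "(l2_norm G F)\<^sup>2 = (\<Sum>x\<in>A. (F x)\<^sup>2)"
proof -
  have "infsum (\<lambda>x. \<bar>F x\<bar>\<^sup>2) G = infsum (\<lambda>x. \<bar>F x\<bar>\<^sup>2) A"
    by (rule infsum_cong_neutral) (use assms in auto)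
  also have "\<dots> = (\<Sum>x\<in>A. (F x)\<^sup>2)" using assms(1) by simp
  finally have "infsum (\<lambda>x. \<bar>F x\<bar>\<^sup>2) G = (\<Sum>x\<in>A. (F x)\<^sup>2)" .
  moreover have "0 \<le> (\<Sum>x\<in>A. (F x)\<^sup>2)" by (intro sum_nonneg) auto
  ultimately show ?thesis unfolding l2_norm_def by simp
qed

text \<open>M dominates the derivative bounds of \<open>weight_bounds\<close>, and W is the constant
  in front of all errors to be absorbed. The lower bound on \<tau> gives
  \<open>W * (h / \<eta>) \<le> 1 / 4\<close>, since h / \<eta> = 1 / (M \<tau>); the upper bound
  gives \<open>W * \<eta> \<le> 1 / 4\<close>.\<close>

lemma carleman_estimate:
  fixes u g :: "real ^ 'd \<Rightarrow> real" and h \<tau> n M \<epsilon> C1 W :: real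
  assumes n: "n = real CARD('d)" and M: "M = 25000 * (12 * n + 300)"
    and eps: "\<epsilon> = 1 / (100000 * M ^ 3)" and C1: "C1 = 12 + (96 * n\<^sup>2 + 1) / \<epsilon>"
    and W: "W = C1 * (850 * n\<^sup>2 * (n + 1))"
    and hb: "0 < h" "h < 1 / 40" and tau: "4 * W < \<tau>" "\<tau> < 1 / (4 * W * M) / h"
    and g: "\<forall>x \<in> grid_ball h 4. discrete_laplacian h u x / h\<^sup>2 = g x"
    and supp: "grid_supp h u \<subseteq> grid_ball h 2 - grid_ball h (1 / 2)"
  shows "\<tau> ^ 3 * (l2_norm (grid h) (\<lambda>x. exp (carleman_weight (1 / 4) \<tau> x) * u x))\<^sup>2
        + \<tau> * (l2_norm (grid h) (\<lambda>x. exp (carleman_weight (1 / 4) \<tau> x) * (sym_diff_op h u x / h)))\<^sup>2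
        + 1 / \<tau> * (l2_norm (grid h) (\<lambda>x. exp (carleman_weight (1 / 4) \<tau> x)
            * (sym_diff_op h (sym_diff_op h u) x / h\<^sup>2)))\<^sup>2
        \<le> (8000000 * n ^ 4 * C1 * M) * (l2_norm (grid_ball h 4) (\<lambda>x. exp (carleman_weight (1 / 4) \<tau> x) * g x))\<^sup>2"
proof -
  have n1: "1 \<le> n" unfolding n using one_le_card_finite[where 'a = 'd] by linarith
  have M1: "1 \<le> M" unfolding M using n1 by simp
  have eps_pos: "0 < \<epsilon>" unfolding eps using M1 by simp
  have C1_12: "12 \<le> C1" unfolding C1 using eps_pos by simp
  have nn: "1 \<le> n\<^sup>2" using n1 one_le_power by blast
  have W1: "24 * n \<le> W" "1 \<le> W"
  proof -
    have "12 * (850 * 1 * (n + 0)) \<le> W"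
      unfolding W using C1_12 nn n1 by (intro mult_mono) auto
    then have "10200 * n \<le> W" by simp
    then show "24 * n \<le> W" "1 \<le> W" using n1 by linarith+
  qed
  have tau1: "1 < \<tau>" using tau W1 by linarith
  define \<eta> where "\<eta> = M * \<tau> * h"
  have eta_pos: "0 < \<eta>" unfolding \<eta>_def using M1 tau1 hb by simp
  have eta_W: "W * \<eta> \<le> 1 / 4"
  proof -
    have "\<tau> * h \<le> 1 / (4 * W * M)" using tau(2) hb(1) by (simp only: pos_less_divide_eq less_imp_le)
    then have "W * (M * (\<tau> * h)) \<le> W * (M * (1 / (4 * W * M)))"
      using W1 M1 by (intro mult_left_mono) auto
    also have "\<dots> = 1 / 4" using W1 M1 by simp
    finally show ?thesis unfolding \<eta>_def by (simp add: mult.assoc)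
  qed
  have eta_le: "\<eta> \<le> 1"
  proof -
    have "1 * \<eta> \<le> W * \<eta>" using W1 eta_pos by (intro mult_right_mono) auto
    then show ?thesis using eta_W by linarith
  qed
  have Mt: "1 \<le> M * \<tau>" using M1 tau1 mult_mono[of 1 M 1 \<tau>] by simp
  have h_eta: "h \<le> \<eta>" unfolding \<eta>_def using Mt hb by simp
  have ratio: "W * (h / \<eta>) \<le> 1 / 4"
  proof -
    have "h / \<eta> = 1 / (M * \<tau>)" unfolding \<eta>_def using hb by simp
    moreover have "W * (1 / (M * \<tau>)) \<le> 1 / 4"
    proof -
      have "1 * (4 * W) \<le> M * \<tau>" using M1 tau W1 by (intro mult_mono) auto
      then show ?thesis using Mt by (simp add: field_simps)
    qed
    ultimately show ?thesis by simp
  qed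
  have small': "C1 * (850 * n\<^sup>2 * (n + 1)) * (\<eta> + h / \<eta>) \<le> 1 / 2"
    using eta_W ratio unfolding W[symmetric] distrib_left[of W] by linarith
  have small: "24 * n * \<eta> ^ 4 \<le> 1"
  proof -
    have "\<eta> ^ 4 \<le> \<eta>" using eta_pos eta_le power_decreasing[of 1 4 \<eta>] by simp
    then have "24 * n * \<eta> ^ 4 \<le> W * \<eta>" using W1 n1 eta_pos by (intro mult_mono) auto
    then show ?thesis using eta_W by linarith
  qed
  define e where "e j = (h *\<^sub>R axis j 1 :: real ^ 'd)" for j
  define \<Phi> where "\<Phi> = (carleman_weight (1 / 4) \<tau> :: real ^ 'd \<Rightarrow> real)"
  \<comment> \<open>The hypotheses restrict u on the lattice only, while the locale asks for a
    function supported in a finite layer. Cutting u off outside the lattice changes none of the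
    operators at lattice points.\<close>
  define v where "v x = (if x \<in> grid h then u x else 0)" for x
  define f where "f x = exp (\<Phi> x) * v x" for x
  have e_path: "x + e k = axis_path x k h" "x - e k = axis_path x k (- h)" for x k
    unfolding e_def axis_path_def by simp_all
  have seg: "axis_path x k t \<in> annulus" if "x \<in> layer h 7" "t \<in> closed_segment 0 h \<or> t \<in> closed_segment 0 (- h)" for x :: "real ^ 'd" and k t
    using that(2) hb by (intro layer_annulus[OF that(1)]) (auto simp: closed_segment_eq_real_ivl split: if_splits)
  have ann: "x \<in> annulus" if "x \<in> layer h 7" for x :: "real ^ 'd"
    using seg[OF that, of 0 undefined] by simp
  have layers: "lattice_layers (layer h) e"
    unfolding e_def using layer_lattice_layers[OF hb(1)] .
  have l67: "layer h 6 \<subseteq> (layer h 7 :: (real ^ 'd) set)"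
    using lattice_layers.B_mono[OF layers, of 6 7] by simp
  have K: "3 * 25000 \<le> M" "19 * 25000 \<le> M" "126 * 25000 \<le> M" "(2 * n + 41) * 25000 \<le> M" "(12 * n + 264) * 25000 \<le> M"
    unfolding M using n1 by auto
  have div: "\<bar>a / M\<bar> \<le> r" if "\<bar>a\<bar> \<le> k * r" "k \<le> M" "0 \<le> r" for a k r :: real
  proof -
    have "\<bar>a\<bar> \<le> M * r" using that mult_right_mono[of k M r] by linarith
    then show ?thesis using M1 by (simp add: abs_div field_simps)
  qed
  interpret carleman_weighted "layer h" e "\<lambda>j x. grad_weight j x / M" "\<lambda>j k x. hess_weight j k x / M"
    "\<lambda>x. multiplier x / M" f h \<eta> \<epsilon> n \<Phi> v
  proof (unfold carleman_weighted_def carleman_coefficients_def, intro conjI layers)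
    show "carleman_weighted_axioms (layer h) e (\<lambda>j x. grad_weight j x / M) f h \<eta> \<Phi> v"
    proof
      show "f x = exp (\<Phi> x) * v x" for x by (rule f_def)
      fix x :: "real ^ 'd" and j assume x: "x \<in> layer h 7"
      have t: "\<bar>\<tau> * a\<bar> \<le> h * \<eta>" if "\<bar>a\<bar> \<le> 19 * 25000 * h\<^sup>2" for a
      proof -
        have "\<bar>a\<bar> \<le> M * h\<^sup>2" using that mult_right_mono[OF K(2), of "h\<^sup>2"] by linarith
        then have "\<tau> * \<bar>a\<bar> \<le> \<tau> * (M * h\<^sup>2)" using tau1 by (intro mult_left_mono) auto
        then show ?thesis unfolding \<eta>_def using tau1 by (simp add: abs_mult power2_eq_square mult_ac)
      qed
      have "\<Phi> (x + e j) - \<Phi> x - \<eta> * (grad_weight j x / M) =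
          \<tau> * (carleman_profile (1 / 4) (norm (axis_path x j h)) - carleman_profile (1 / 4) (norm x) - h * grad_weight j x)"
        unfolding \<Phi>_def carleman_weight_def e_path \<eta>_def using M1 by (simp add: algebra_simps)
      then show "\<bar>\<Phi> (x + e j) - \<Phi> x - \<eta> * (grad_weight j x / M)\<bar> \<le> h * \<eta>"
        using t[OF weight_taylor[of h x j]] seg[OF x] by auto
      have "\<Phi> (x - e j) - \<Phi> x + \<eta> * (grad_weight j x / M) =
          \<tau> * (carleman_profile (1 / 4) (norm (axis_path x j (- h))) - carleman_profile (1 / 4) (norm x) - (- h) * grad_weight j x)"
        unfolding \<Phi>_def carleman_weight_def e_path \<eta>_def using M1 by (simp add: algebra_simps)
      then show "\<bar>\<Phi> (x - e j) - \<Phi> x + \<eta> * (grad_weight j x / M)\<bar> \<le> h * \<eta>"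
        using t[of "carleman_profile (1 / 4) (norm (axis_path x j (- h))) - carleman_profile (1 / 4) (norm x) - (- h) * grad_weight j x"]
          weight_taylor[of "- h" x j] seg[OF x] by auto
    qed
    show "carleman_coefficients_axioms (layer h) e (\<lambda>j x. grad_weight j x / M) (\<lambda>j k x. hess_weight j k x / M)
      (\<lambda>x. multiplier x / M) f h \<eta> \<epsilon> n"
    proof
      show "0 < h" "h \<le> \<eta>" "\<eta> \<le> 1" "0 < \<epsilon>" "n = real CARD('d)"
        using hb h_eta eta_le eps_pos n by auto
      show "supp_on (layer h 0) f"
        using supp unfolding supp_on_def f_def v_def grid_supp_def grid_ball_def layer_def
        by (auto split: if_splits)
    next
      fix x :: "real ^ 'd" and j k assume "x \<in> layer h 7"
      note x = ann[OF this]
      show "\<bar>grad_weight j x / M\<bar> \<le> 1" using div[OF _ K(1), of _ 1] weight_bounds(1)[OF x] by simp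
      show "\<bar>hess_weight j k x / M\<bar> \<le> 1" using div[OF _ K(2), of _ 1] weight_bounds(2)[OF x] by simp
      show "\<bar>multiplier x / M\<bar> \<le> 1"
        using div[OF _ K(4), of "multiplier x" 1] weight_bounds(4)[OF x] unfolding n by simp
    next
      fix x :: "real ^ 'd" and j k assume x6: "x \<in> layer h 6"
      then have x7: "x \<in> layer h 7" using l67 by auto
      have "fd (e k) (\<lambda>x. grad_weight j x / M) x - h * (hess_weight j k x / M) =
         (grad_weight j (axis_path x k h) - grad_weight j x - h * hess_weight j k x) / M"
        unfolding fd_def e_path by (simp add: diff_divide_distrib)
      then show "\<bar>fd (e k) (\<lambda>x. grad_weight j x / M) x - h * (hess_weight j k x / M)\<bar> \<le> h * h"
        using div[OF grad_weight_taylor[of h x k j] K(3)] seg[OF x7] by (simp add: power2_eq_square)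
      have "fd (e k) (\<lambda>x. multiplier x / M) x = (multiplier (axis_path x k h) - multiplier x) / M"
        unfolding fd_def e_path by (simp add: diff_divide_distrib)
      then show "\<bar>fd (e k) (\<lambda>x. multiplier x / M) x\<bar> \<le> h"
        using div[OF multiplier_lipschitz[of h x k, folded n] K(5)] seg[OF x7] hb by simp
    next
      fix x :: "real ^ 'd" and \<xi> :: "'d \<Rightarrow> real" assume "x \<in> layer h 6"
      then have x: "x \<in> annulus" using l67 ann by auto
      define X where "X = (\<Sum>j\<in>UNIV. (\<xi> j)\<^sup>2)"
      have X: "0 \<le> X" unfolding X_def by (intro sum_nonneg) auto
      have "\<epsilon> * X \<le> 1 / 160 * X / M"
      proof -
        have "\<epsilon> \<le> 1 / (160 * M)"
        proof -
          have "M \<le> M ^ 3" using M1 by (simp add: self_le_power)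
          then have "160 * M \<le> 100000 * M ^ 3" using M1 by linarith
          then show ?thesis unfolding eps using M1 by (intro divide_left_mono) auto
        qed
        then have "\<epsilon> * X \<le> 1 / (160 * M) * X" using X by (intro mult_right_mono) auto
        then show ?thesis by simp
      qed
      also have "\<dots> \<le> (4 * (\<Sum>j\<in>UNIV. \<Sum>k\<in>UNIV. hess_weight k j x * \<xi> j * \<xi> k)
        + (multiplier x - 2 * (\<Sum>k\<in>UNIV. hess_weight k k x)) * X) / M"
        using weight_pos_grad[OF annulus_bounds(1)[OF x], of \<xi>] M1 unfolding X_def[symmetric]
        by (intro divide_right_mono) auto
      also have "\<dots> = 4 * (\<Sum>j\<in>UNIV. \<Sum>k\<in>UNIV. hess_weight k j x / M * \<xi> j * \<xi> k)
        + (multiplier x / M - 2 * (\<Sum>k\<in>UNIV. hess_weight k k x / M)) * X"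
        by (simp add: sum_divide_distrib[symmetric] add_divide_distrib diff_divide_distrib left_diff_distrib)
      finally show "\<epsilon> * (\<Sum>j\<in>UNIV. (\<xi> j)\<^sup>2) \<le> 4 * (\<Sum>j\<in>UNIV. \<Sum>k\<in>UNIV. hess_weight k j x / M * \<xi> j * \<xi> k)
        + (multiplier x / M - 2 * (\<Sum>k\<in>UNIV. hess_weight k k x / M)) * (\<Sum>j\<in>UNIV. (\<xi> j)\<^sup>2)"
        unfolding X_def .
    next
      fix x :: "real ^ 'd" assume "x \<in> layer h 6"
      then have x: "x \<in> annulus" using l67 ann by auto
      define P where "P = (\<Sum>j\<in>UNIV. \<Sum>k\<in>UNIV. hess_weight j k x * grad_weight j x * grad_weight k x)"
      define T where "T = (\<Sum>k\<in>UNIV. hess_weight k k x)"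
      define N where "N = (\<Sum>j\<in>UNIV. (grad_weight j x)\<^sup>2)"
      \<comment> \<open>The coefficient of f^2 contains one second derivative of the weight (or Q)
        and two first derivatives; normalising each by M gives the cube.\<close>
      have "\<epsilon> = 1 / 100000 / M ^ 3" unfolding eps by simp
      also have "\<dots> \<le> (4 * P + (2 * T - multiplier x) * N) / M ^ 3"
        unfolding P_def T_def N_def
        using weight_pos_fun[OF annulus_bounds(1,2)[OF x]] M1 by (intro divide_right_mono) auto
      also have "\<dots> = 4 * (P / M ^ 3) + (2 * (T / M) - multiplier x / M) * (N / M\<^sup>2)"
        by (simp add: power3_eq_cube power2_eq_square add_divide_distrib diff_divide_distrib left_diff_distrib right_diff_distrib mult_ac)
      also have "P / M ^ 3 = (\<Sum>j\<in>UNIV. \<Sum>k\<in>UNIV. hess_weight j k x / M * (grad_weight j x / M) * (grad_weight k x / M))"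
        unfolding P_def sum_divide_distrib by (simp add: power3_eq_cube mult_ac)
      also have "T / M = (\<Sum>k\<in>UNIV. hess_weight k k x / M)" unfolding T_def by (rule sum_divide_distrib)
      also have "N / M\<^sup>2 = (\<Sum>j\<in>UNIV. (grad_weight j x / M)\<^sup>2)"
        unfolding N_def sum_divide_distrib by (simp add: power_divide)
      finally show "\<epsilon> \<le> 4 * (\<Sum>j\<in>UNIV. \<Sum>k\<in>UNIV. hess_weight j k x / M * (grad_weight j x / M) * (grad_weight k x / M))
        + (2 * (\<Sum>k\<in>UNIV. hess_weight k k x / M) - multiplier x / M) * (\<Sum>j\<in>UNIV. (grad_weight j x / M)\<^sup>2)" .
    qed
  qed
  have sd: "sdiff e v x = sym_diff_op h u x" if "x \<in> grid h" for x
    unfolding sdiff_def cd_def sym_diff_op_def v_def e_def using grid_add_axis[OF that] by simp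
  have sd2: "sdiff e (sdiff e v) x = sym_diff_op h (sym_diff_op h u) x" if "x \<in> grid h" for x
    unfolding sdiff_def[of e "sdiff e v"] cd_def sym_diff_op_def[of h "sym_diff_op h u"] e_def
    using sd[unfolded e_def] grid_add_axis[OF that] by (simp add: e_def[abs_def])
  have lap: "(\<Sum>j\<in>UNIV. lap (e j) v x) = discrete_laplacian h u x" if "x \<in> grid h" for x
    unfolding lap_def discrete_laplacian_def v_def e_def using grid_add_axis[OF that] that by simp
  have layer_grid: "layer h 6 \<subseteq> (grid h :: (real ^ 'd) set)" unfolding layer_def by auto
  have layer_ball: "layer h 6 \<subseteq> (grid_ball h 4 :: (real ^ 'd) set)"
    using hb unfolding layer_def grid_ball_def by auto
  have supp6: "F x = 0" if "supp_on (layer h m) F" "m \<le> 6" "x \<notin> layer h 6" for F and x :: "real ^ 'd" and m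
    using supp_mono[OF that(1,2)] that(3) by (rule supp_onD)
  have supp1: "supp_on (layer h 1) (\<lambda>x. exp (\<Phi> x) * sdiff e v x)"
    using supp_conj_sdiff[of f v 0, OF f_def supp_f] by simp
  have supp2: "supp_on (layer h 2) (\<lambda>x. exp (\<Phi> x) * sdiff e (sdiff e v) x)"
    using supp_conj_sdiff[OF _ supp1] by (simp add: numeral_2_eq_2)
  define X0 where "X0 = S (\<lambda>x. (exp (\<Phi> x) * v x)\<^sup>2)"
  define X1 where "X1 = S (\<lambda>x. (exp (\<Phi> x) * sdiff e v x)\<^sup>2)"
  define X2 where "X2 = S (\<lambda>x. (exp (\<Phi> x) * sdiff e (sdiff e v) x)\<^sup>2)"
  define Y where "Y = S (\<lambda>x. (exp (\<Phi> x) * g x)\<^sup>2)"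
  have Xnn: "0 \<le> X0" "0 \<le> X1" "0 \<le> X2" unfolding X0_def X1_def X2_def by (intro sum_nonneg; simp)+
  have l0: "(l2_norm (grid h) (\<lambda>x. exp (\<Phi> x) * u x))\<^sup>2 = X0"
  proof -
    have "exp (\<Phi> x) * u x = 0" if "x \<in> grid h - layer h 6" for x
      using supp6[OF supp_f, of x] that unfolding f_def v_def by simp
    then have "(l2_norm (grid h) (\<lambda>x. exp (\<Phi> x) * u x))\<^sup>2 = S (\<lambda>x. (exp (\<Phi> x) * u x)\<^sup>2)"
      by (intro l2_norm_square finite_B layer_grid)
    then show ?thesis unfolding X0_def v_def using layer_grid by (simp add: subset_iff cong: sum.cong)
  qed
  have l1: "(l2_norm (grid h) (\<lambda>x. exp (\<Phi> x) * (sym_diff_op h u x / h)))\<^sup>2 = X1 / h\<^sup>2"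
  proof -
    have "exp (\<Phi> x) * (sym_diff_op h u x / h) = 0" if "x \<in> grid h - layer h 6" for x
      using supp6[OF supp1, of x] that sd[of x] by auto
    then have "(l2_norm (grid h) (\<lambda>x. exp (\<Phi> x) * (sym_diff_op h u x / h)))\<^sup>2 =
        S (\<lambda>x. (exp (\<Phi> x) * (sym_diff_op h u x / h))\<^sup>2)"
      by (intro l2_norm_square finite_B layer_grid)
    also have "\<dots> = X1 / h\<^sup>2"
      unfolding X1_def sum_divide_distrib using layer_grid sd
      by (intro sum.cong refl) (auto simp: power_mult_distrib power_divide)
    finally show ?thesis .
  qed
  have l2: "(l2_norm (grid h) (\<lambda>x. exp (\<Phi> x) * (sym_diff_op h (sym_diff_op h u) x / h\<^sup>2)))\<^sup>2 = X2 / h ^ 4"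
  proof -
    have "exp (\<Phi> x) * (sym_diff_op h (sym_diff_op h u) x / h\<^sup>2) = 0" if "x \<in> grid h - layer h 6" for x
      using supp6[OF supp2, of x] that sd2[of x] by auto
    then have "(l2_norm (grid h) (\<lambda>x. exp (\<Phi> x) * (sym_diff_op h (sym_diff_op h u) x / h\<^sup>2)))\<^sup>2 =
        S (\<lambda>x. (exp (\<Phi> x) * (sym_diff_op h (sym_diff_op h u) x / h\<^sup>2))\<^sup>2)"
      by (intro l2_norm_square finite_B layer_grid)
    also have "\<dots> = X2 / h ^ 4"
      unfolding X2_def sum_divide_distrib using layer_grid sd2
      by (intro sum.cong refl) (auto simp: power_mult_distrib power_divide)
    finally show ?thesis .
  qed
  \<comment> \<open>Only an inequality: the ball reaches beyond the layer and contains the origin,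
    where the weight is a placeholder. The squares at the extra points are nonnegative and are
    dropped.\<close>
  have r: "Y \<le> (l2_norm (grid_ball h 4) (\<lambda>x. exp (\<Phi> x) * g x))\<^sup>2"
  proof -
    have fin: "finite (grid_ball h 4 :: (real ^ 'd) set)"
      by (rule finite_subset[OF _ finite_grid_bounded[OF hb(1), of 4]]) (auto simp: grid_ball_def)
    have "(l2_norm (grid_ball h 4) (\<lambda>x. exp (\<Phi> x) * g x))\<^sup>2 = (\<Sum>x\<in>grid_ball h 4. (exp (\<Phi> x) * g x)\<^sup>2)"
      by (rule l2_norm_square[OF fin]) auto
    then show ?thesis unfolding Y_def by (simp add: sum_mono2[OF fin layer_ball])
  qed
  have lapY: "S (\<lambda>x. (exp (\<Phi> x) * (\<Sum>j\<in>UNIV. lap (e j) v x))\<^sup>2) = h ^ 4 * Y"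
    unfolding Y_def sum_distrib_left[of "h ^ 4"]
  proof (intro sum.cong refl)
    fix x :: "real ^ 'd" assume x: "x \<in> layer h 6"
    then have "discrete_laplacian h u x / h\<^sup>2 = g x" using g layer_ball by blast
    then have "(\<Sum>j\<in>UNIV. lap (e j) v x) = h\<^sup>2 * g x"
      using lap[of x] x layer_grid hb by (auto simp: field_simps)
    then show "(exp (\<Phi> x) * (\<Sum>j\<in>UNIV. lap (e j) v x))\<^sup>2 = h ^ 4 * (exp (\<Phi> x) * g x)\<^sup>2"
      by (simp add: power_mult_distrib)
  qed
  have energy: "h * energy \<le> 8 * C1 * (h ^ 4 * Y)"
    using energy_le_conj_laplacian[OF small C1 small'] unfolding lapY .
  have "h * (\<eta> ^ 3 * X0 + \<eta> * X1 + 1 / \<eta> * X2) \<le> h * (1000000 * n ^ 4 * energy)"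
    using weighted_norms_le_energy hb unfolding X0_def X1_def X2_def by (intro mult_left_mono) auto
  also have "\<dots> = 1000000 * n ^ 4 * (h * energy)" by simp
  also have "\<dots> \<le> 1000000 * n ^ 4 * (8 * C1 * (h ^ 4 * Y))"
    using energy n1 by (intro mult_left_mono) auto
  finally have "h * (\<eta> ^ 3 * X0 + \<eta> * X1 + 1 / \<eta> * X2) \<le> 1000000 * n ^ 4 * (8 * C1 * (h ^ 4 * Y))" .
  \<comment> \<open>With \<eta> = M \<tau> h the left side shows the same factor
    \<open>h ^ 4\<close> that the right side has because the discrete Laplacian is
    \<open>h\<^sup>2\<close> g.\<close>
  moreover have "h * (\<eta> ^ 3 * X0 + \<eta> * X1 + 1 / \<eta> * X2) =
     h ^ 4 * (M ^ 3 * (\<tau> ^ 3 * X0) + M * (\<tau> * (X1 / h\<^sup>2)) + 1 / M * (1 / \<tau> * (X2 / h ^ 4)))"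
    unfolding \<eta>_def using hb M1 tau1 by (simp add: power_mult_distrib distrib_left power2_eq_square power3_eq_cube power4_eq_xxxx)
  ultimately have "h ^ 4 * (M ^ 3 * (\<tau> ^ 3 * X0) + M * (\<tau> * (X1 / h\<^sup>2)) + 1 / M * (1 / \<tau> * (X2 / h ^ 4)))
      \<le> h ^ 4 * (8000000 * n ^ 4 * C1 * Y)" by (simp add: mult_ac)
  then have "M ^ 3 * (\<tau> ^ 3 * X0) + M * (\<tau> * (X1 / h\<^sup>2)) + 1 / M * (1 / \<tau> * (X2 / h ^ 4))
      \<le> 8000000 * n ^ 4 * C1 * Y"
    using hb by simp
  \<comment> \<open>1 / M is the least of the three factors \<open>M ^ 3\<close>, M and 1 / M; it
    accounts for the M in the final constant.\<close>
  moreover have "1 / M * (\<tau> ^ 3 * X0) + 1 / M * (\<tau> * (X1 / h\<^sup>2)) + 1 / M * (1 / \<tau> * (X2 / h ^ 4)) \<le>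
     M ^ 3 * (\<tau> ^ 3 * X0) + M * (\<tau> * (X1 / h\<^sup>2)) + 1 / M * (1 / \<tau> * (X2 / h ^ 4))"
  proof (intro add_mono mult_right_mono)
    have "1 / M \<le> 1" using M1 by simp
    then show "1 / M \<le> M ^ 3" "1 / M \<le> M" using M1 one_le_power[of M 3] by linarith+
  qed (use Xnn tau1 in auto)
  ultimately have "1 / M * (\<tau> ^ 3 * X0 + \<tau> * (X1 / h\<^sup>2) + 1 / \<tau> * (X2 / h ^ 4)) \<le> 8000000 * n ^ 4 * C1 * Y"
    by (simp add: distrib_left)
  then have "\<tau> ^ 3 * X0 + \<tau> * (X1 / h\<^sup>2) + 1 / \<tau> * (X2 / h ^ 4) \<le> 8000000 * n ^ 4 * C1 * M * Y"
    using M1 by (simp add: pos_divide_le_eq mult_ac)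
  also have "\<dots> \<le> 8000000 * n ^ 4 * C1 * M * (l2_norm (grid_ball h 4) (\<lambda>x. exp (\<Phi> x) * g x))\<^sup>2"
    using r n1 C1_12 M1 by (intro mult_left_mono) auto
  finally show ?thesis unfolding l0[symmetric] l1[symmetric] l2[symmetric] \<Phi>_def .
qed

theorem theorem3:
  "\<exists>c_ps::real. c_ps > 0 \<and>
    (\<exists>h\<^sub>0 \<delta>\<^sub>0 C \<tau>\<^sub>0 :: real.
      h\<^sub>0 \<in> {0<..<1} \<and> \<delta>\<^sub>0 \<in> {0<..<1} \<and> h\<^sub>0 < \<delta>\<^sub>0 \<and> C > 1 \<and> \<tau>\<^sub>0 > 1 \<and>
      (\<forall>h \<in> {0<..<h\<^sub>0}. \<forall>\<tau> \<in> {\<tau>\<^sub>0<..<\<delta>\<^sub>0 / h}. \<forall>(u :: real ^ 'd \<Rightarrow> real) (g :: real ^ 'd \<Rightarrow> real).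
        (\<forall>x \<in> grid_ball h 4. discrete_laplacian h u x / h\<^sup>2 = g x) \<longrightarrow>
        grid_supp h u \<subseteq> grid_ball h 2 - grid_ball h (1 / 2) \<longrightarrow>
        l2_on (grid_ball h 4) g \<longrightarrow>
        \<tau> ^ 3 * (l2_norm (grid h) (\<lambda>x. exp (carleman_weight c_ps \<tau> x) * u x))\<^sup>2
        + \<tau> * (l2_norm (grid h) (\<lambda>x. exp (carleman_weight c_ps \<tau> x) * (sym_diff_op h u x / h)))\<^sup>2
        + 1 / \<tau> * (l2_norm (grid h) (\<lambda>x. exp (carleman_weight c_ps \<tau> x)
            * (sym_diff_op h (sym_diff_op h u) x / h\<^sup>2)))\<^sup>2
        \<le> C * (l2_norm (grid_ball h 4) (\<lambda>x. exp (carleman_weight c_ps \<tau> x) * g x))\<^sup>2))"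
proof -
  define n where "n = real CARD('d)"
  define M where "M = 25000 * (12 * n + 300)"
  define \<epsilon> where "\<epsilon> = 1 / (100000 * M ^ 3)"
  define C1 where "C1 = 12 + (96 * n\<^sup>2 + 1) / \<epsilon>"
  define W where "W = C1 * (850 * n\<^sup>2 * (n + 1))"
  define \<delta> where "\<delta> = 1 / (4 * W * M)"
  \<comment> \<open>The bound \<delta> / 2 makes h0 smaller than \<delta>, and 1 / 40 keeps seven
    layers and one more step inside \<open>annulus\<close>.\<close>
  define h0 where "h0 = min (\<delta> / 2) (1 / 40)"
  have n1: "1 \<le> n" unfolding n_def using one_le_card_finite[where 'a = 'd] by linarith
  have M1: "1 \<le> M" unfolding M_def using n1 by simp
  have C1: "12 \<le> C1" unfolding C1_def \<epsilon>_def using M1 by simp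
  have W1: "1 \<le> W"
  proof -
    have "1 * (850 * 1 * (n + 0)) \<le> W"
      unfolding W_def using C1 one_le_power[OF n1, of 2] n1 by (intro mult_mono) auto
    then have "850 * n \<le> W" by simp
    then show ?thesis using n1 by linarith
  qed
  have WM: "1 \<le> W * M" using W1 M1 mult_mono[of 1 W 1 M] by simp
  then have delta: "0 < \<delta>" "\<delta> < 1" unfolding \<delta>_def by (auto simp: mult.assoc)
  have C: "1 < 8000000 * n ^ 4 * C1 * M"
  proof -
    have "8000000 * 1 * 12 * 1 \<le> 8000000 * n ^ 4 * C1 * M"
      using C1 M1 one_le_power[OF n1, of 4] by (intro mult_mono) auto
    then show ?thesis by linarith
  qed
  show ?thesis
  proof (rule exI[of _ "1 / 4"], rule conjI, simp, rule exI[of _ h0], rule exI[of _ \<delta>],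
      rule exI[of _ "8000000 * n ^ 4 * C1 * M"], rule exI[of _ "4 * W"], intro conjI ballI allI impI)
    fix h \<tau> and u g :: "real ^ 'd \<Rightarrow> real"
    assume "h \<in> {0<..<h0}" "\<tau> \<in> {4 * W<..<\<delta> / h}"
      and "\<forall>x \<in> grid_ball h 4. discrete_laplacian h u x / h\<^sup>2 = g x"
      and "grid_supp h u \<subseteq> grid_ball h 2 - grid_ball h (1 / 2)"
    then show "\<tau> ^ 3 * (l2_norm (grid h) (\<lambda>x. exp (carleman_weight (1 / 4) \<tau> x) * u x))\<^sup>2
        + \<tau> * (l2_norm (grid h) (\<lambda>x. exp (carleman_weight (1 / 4) \<tau> x) * (sym_diff_op h u x / h)))\<^sup>2
        + 1 / \<tau> * (l2_norm (grid h) (\<lambda>x. exp (carleman_weight (1 / 4) \<tau> x)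
            * (sym_diff_op h (sym_diff_op h u) x / h\<^sup>2)))\<^sup>2
        \<le> (8000000 * n ^ 4 * C1 * M) * (l2_norm (grid_ball h 4) (\<lambda>x. exp (carleman_weight (1 / 4) \<tau> x) * g x))\<^sup>2"
      by (intro carleman_estimate[OF n_def M_def \<epsilon>_def C1_def W_def]) (auto simp: h0_def \<delta>_def)
  qed (use delta C W1 in \<open>auto simp: h0_def min_def\<close>)
qed

end
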